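(* Let $u$ be a Dirichlet harmonic function on $\mathbb R_+\times K$ such that $$\sup_{t>0}\|u(t,\cdot)\|_{L^\infty(K,\mu)}<\infty.$$ Then $u$ is the Dirichlet Poisson integral of a function $f\in L^\infty(K,\mu)$, i.e. there is $f\in L^\infty(K,\mu)$ with $u(t,x)=\mathcal P^D_tf(x)$ for all $(t,x)\in\mathbb R_+\times K$.
   Context: Setting. $(K,S,\{F_i\}_{i\in S})$ is a self-similar structure ($S$ finite, $K$ compact metrizable, $F_i:K\to K$ continuous injections, with a continuous surjection $\pi:S^{\mathbb N}\to K$ satisfying $\pi(i\omega)=F_i(\pi(\omega))$). $W_m=S^m$, $W_*=\bigcup_{m\ge0}W_m$; for $w=w_1\cdots w_m$, $F_w=F_{w_1}\circ\cdots\circ F_{w_m}$, and $r_w=r_{w_1}\cdots r_{w_m}$ for numbers $r_i$. The critical set is $\mathcal C=\bigcup_{i\ne j}F_i(K)\cap F_j(K)$ and the boundary is $V_0=\{p\in K:\ F_w(p)\in\mathcal C\text{ for some nonempty word }w\}$. $K$ is assumed post-critically finite: $V_0$ is finite, and $V_0\neq\emptyset$. $V_m=\bigcup_{w\in W_m}F_w(V_0)$. A regular harmonic structure $(D,\mathbf r)$ is fixed: $\mathbf r=(r_i)_{i\in S}$ with $0<r_i<1$; $D$ is a real symmetric matrix indexed by $V_0$ with nonnegative off-diagonal entries, nonpositive definite, with kernel exactly the constants; with $\mathcal E_0(u,v)=-\sum_{p,q}u(p)D_{pq}v(q)$ and $\mathcal E_m(u,v)=\sum_{w\in W_m}r_w^{-1}\mathcal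 E_0(u\circ F_w|_{V_0},v\circ F_w|_{V_0})$, one has $\mathcal E_0(u,u)=\min\{\mathcal E_1(v,v):v|_{V_0}=u\}$. The Dirichlet form is $\mathcal E(u,v)=\lim_m\mathcal E_m(u|_{V_m},v|_{V_m})$ on $\mathcal F=\{u\in C(K):\lim_m\mathcal E_m(u,u)<\infty\}$, and $\mathcal F_0=\{u\in\mathcal F:u|_{V_0}=0\}$. $d$ is the unique real number with $\sum_{i\in S}r_i^d=1$, and $\mu$ is the self-similar (Bernoulli) probability measure on $K$ with weights $\mu_i=r_i^d$. $\mathbb R_+=(0,\infty)$. Laplacian: $u\in\mathcal D$ and $\Delta u=g$ mean $u\in\mathcal F$, $g\in C(K)$ and $\mathcal E(u,v)=-\int_Kgv\,d\mu$ for all $v\in\mathcal F_0$. $\mathcal D_D=\{u\in\mathcal D:u|_{V_0}=0\}$. There are Dirichlet eigenvalues $0<\lambda^D_1\le\lambda^D_2\le\cdots$ (with multiplicity) and real-valued $\phi^D_n\in\mathcal D_D$ with $\Delta\phi^D_n=-\lambda^D_n\phi^D_n$ such that $\{\phi^D_n\}_{n\ge1}$ is a complete orthonormal system of $L^2(K,\mu)$. Dirichlet Poisson kernel: $P^D(t,x,y)=\sum_{n\ge1}e^{-\sqrt{\lambda^D_n}\,t}\phi^D_n(x)\phi^D_n(y)$ on $\mathbb R_+\times K\times K$ (uniformly convergent on $[T,\infty)\times K\times K$ for every $T>0$). The Dirichlet Poisson integral of $f\in L^1(K,\mu)$ is $\mathcal P^D_tf(x)=\int_KP^D(t,x,y)f(y)\,d\mu(y)$.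 A continuous function $u$ on $\mathbb R_+\times K$ is a harmonic function if (i) $u(\cdot,x)\in C^2(\mathbb R_+)$ for each $x\in K$; (ii) $u(t,\cdot)\in\mathcal D$ for each $t>0$; (iii) $\frac{\partial^2u}{\partial t^2}(t,x)+\Delta u(t,x)=0$ for each $(t,x)\in\mathbb R_+\times(K\setminus V_0)$, with $\Delta$ acting in $x$. It is a Dirichlet harmonic function if moreover $u(t,p)=0$ for all $t>0$ and $p\in V_0$. *)

theory Defs
  imports "HOL-Analysis.Analysis" "HOL-Probability.Probability"
begin

definition Linf_norm :: "'a measure \<Rightarrow> ('a \<Rightarrow> real) \<Rightarrow> ereal" where
  "Linf_norm M f = esssup M (\<lambda>x. ereal \<bar>f x\<bar>)"

definition Linf :: "'a measure \<Rightarrow> ('a \<Rightarrow> real) set" where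
  "Linf M = {f \<in> borel_measurable M. Linf_norm M f < \<infinity>}"

definition complete_orthonormal_L2 :: "'a measure \<Rightarrow> (nat \<Rightarrow> 'a \<Rightarrow> real) \<Rightarrow> bool" where
  "complete_orthonormal_L2 M \<phi> \<longleftrightarrow>
    (\<forall>n. \<phi> n \<in> borel_measurable M \<and> integrable M (\<lambda>x. (\<phi> n x)\<^sup>2)) \<and>
    (\<forall>m n. (LINT x|M. \<phi> m x * \<phi> n x) = (if m = n then 1 else 0)) \<and>
    (\<forall>f. f \<in> borel_measurable M \<and> integrable M (\<lambda>x. (f x)\<^sup>2) \<and>
         (\<forall>n. (LINT x|M. f x * \<phi> n x) = 0) \<longrightarrow> (AE x in M. f x = 0))"

definition C2_pos :: "(real \<Rightarrow> real) \<Rightarrow> bool" where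
  "C2_pos f \<longleftrightarrow> (\<forall>t>0. f differentiable (at t)) \<and> (\<forall>t>0. deriv f differentiable (at t)) \<and>
     continuous_on {0<..} (deriv (deriv f))"

text \<open>
  The space \<open>K\<close> is a subset of a metric type and functions on \<open>K\<close> are represented by
  functions on the whole type, of which only the values on \<open>K\<close> matter. Infinite words are the
  functions \<open>nat \<Rightarrow> 'i\<close> with values in \<open>S\<close>, and \<open>\<pi>\<close> is the coding map of the self-similar
  structure.
\<close>

locale harmonic_data =
  fixes K :: "'a::metric_space set"
    and S :: "'i set"
    and F :: "'i \<Rightarrow> 'a \<Rightarrow> 'a"
    and \<pi> :: "(nat \<Rightarrow> 'i) \<Rightarrow> 'a"
    and r :: "'i \<Rightarrow> real"
    and D :: "'a \<Rightarrow> 'a \<Rightarrow> real"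
begin

definition words :: "nat \<Rightarrow> 'i list set" where
  "words m = {w. set w \<subseteq> S \<and> length w = m}"

text \<open>\<open>foldr F [i\<^sub>1, \<dots>, i\<^sub>m] x = F i\<^sub>1 (\<dots> (F i\<^sub>m x))\<close>\<close>

definition Fw :: "'i list \<Rightarrow> 'a \<Rightarrow> 'a" where
  "Fw w = foldr F w"

definition rw :: "'i list \<Rightarrow> real" where
  "rw w = prod_list (map r w)"

definition critical_set :: "'a set" where
  "critical_set = (\<Union>i\<in>S. \<Union>j\<in>S - {i}. F i ` K \<inter> F j ` K)"

definition V0 :: "'a set" where
  "V0 = {p \<in> K. \<exists>w. set w \<subseteq> S \<and> w \<noteq> [] \<and> Fw w p \<in> critical_set}"

definition energy0 :: "('a \<Rightarrow> real) \<Rightarrow> ('a \<Rightarrow> real) \<Rightarrow> real" where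
  "energy0 u v = - (\<Sum>p\<in>V0. \<Sum>q\<in>V0. u p * D p q * v q)"

text \<open>\<open>energy_m m u v\<close> only uses the values of \<open>u\<close> and \<open>v\<close> on the union of the sets
  \<open>Fw w ` V0\<close> for \<open>w \<in> words m\<close>.\<close>

definition energy_m :: "nat \<Rightarrow> ('a \<Rightarrow> real) \<Rightarrow> ('a \<Rightarrow> real) \<Rightarrow> real" where
  "energy_m m u v = (\<Sum>w\<in>words m. inverse (rw w) * energy0 (u \<circ> Fw w) (v \<circ> Fw w))"

definition energy :: "('a \<Rightarrow> real) \<Rightarrow> ('a \<Rightarrow> real) \<Rightarrow> real" where
  "energy u v = lim (\<lambda>m. energy_m m u v)"

definition form_dom :: "('a \<Rightarrow> real) set" where
  "form_dom = {u. continuous_on K u \<and> convergent (\<lambda>m. energy_m m u u)}"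

definition form_dom0 :: "('a \<Rightarrow> real) set" where
  "form_dom0 = {u \<in> form_dom. \<forall>p\<in>V0. u p = 0}"

definition sim_dim :: real where
  "sim_dim = (THE d. (\<Sum>i\<in>S. r i powr d) = 1)"

text \<open>The self-similar measure with weights \<open>r i powr sim_dim\<close>: the image under \<open>\<pi>\<close> of the Bernoulli
  measure on infinite words, as a measure on the Borel sets of \<open>K\<close>.\<close>

definition mu :: "'a measure" where
  "mu = distr (Pi\<^sub>M (UNIV :: nat set) (\<lambda>_. point_measure S (\<lambda>i. ennreal (r i powr sim_dim))))
          (restrict_space borel K) \<pi>"

text \<open>\<open>has_laplacian u g\<close> means that \<open>u\<close> is in the domain of the Laplacian and \<open>\<Delta>u = g\<close> on
  \<open>K\<close>; such a \<open>g\<close> is unique on \<open>K\<close>, by continuity and since \<open>mu\<close> has full support and no atoms.\<close>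

definition has_laplacian :: "('a \<Rightarrow> real) \<Rightarrow> ('a \<Rightarrow> real) \<Rightarrow> bool" where
  "has_laplacian u g \<longleftrightarrow> u \<in> form_dom \<and> continuous_on K g \<and>
     (\<forall>v\<in>form_dom0. energy u v = - (LINT x|mu. g x * v x))"

text \<open>The enumeration starts at 0, so \<open>lam n\<close> and \<open>\<phi> n\<close> are the eigenvalue and eigenfunction
  usually numbered \<open>n + 1\<close>.\<close>

definition dirichlet_eigensystem :: "(nat \<Rightarrow> real) \<Rightarrow> (nat \<Rightarrow> 'a \<Rightarrow> real) \<Rightarrow> bool" where
  "dirichlet_eigensystem lam \<phi> \<longleftrightarrow>
     (\<forall>n. 0 < lam n) \<and> incseq lam \<and>
     (\<forall>n. has_laplacian (\<phi> n) (\<lambda>x. - lam n * \<phi> n x) \<and> (\<forall>p\<in>V0. \<phi> n p = 0)) \<and>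
     complete_orthonormal_L2 mu \<phi>"

definition harmonic :: "(real \<Rightarrow> 'a \<Rightarrow> real) \<Rightarrow> bool" where
  "harmonic u \<longleftrightarrow>
     continuous_on ({0<..} \<times> K) (\<lambda>(t, x). u t x) \<and>
     (\<forall>x\<in>K. C2_pos (\<lambda>t. u t x)) \<and>
     (\<forall>t>0. \<exists>g. has_laplacian (u t) g \<and>
        (\<forall>x\<in>K - V0. deriv (deriv (\<lambda>s. u s x)) t + g x = 0))"

definition dirichlet_harmonic :: "(real \<Rightarrow> 'a \<Rightarrow> real) \<Rightarrow> bool" where
  "dirichlet_harmonic u \<longleftrightarrow> harmonic u \<and> (\<forall>t>0. \<forall>p\<in>V0. u t p = 0)"

end

definition poisson_kernel ::
  "(nat \<Rightarrow> real) \<Rightarrow> (nat \<Rightarrow> 'a \<Rightarrow> real) \<Rightarrow> real \<Rightarrow> 'a \<Rightarrow> 'a \<Rightarrow> real" where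
  "poisson_kernel lam \<phi> t x y = (\<Sum>n. exp (- sqrt (lam n) * t) * \<phi> n x * \<phi> n y)"

definition poisson_integral ::
  "'a measure \<Rightarrow> (nat \<Rightarrow> real) \<Rightarrow> (nat \<Rightarrow> 'a \<Rightarrow> real) \<Rightarrow> real \<Rightarrow> ('a \<Rightarrow> real) \<Rightarrow> 'a \<Rightarrow> real" where
  "poisson_integral M lam \<phi> t f x = (LINT y|M. poisson_kernel lam \<phi> t x y * f y)"

locale self_similar_structure = harmonic_data K S F \<pi> r D
  for K :: "'a::metric_space set" and S :: "'i set" and F \<pi> r D +
  assumes finite_S: "finite S"
    and compact_K: "compact K"
    and F_continuous: "i \<in> S \<Longrightarrow> continuous_on K (F i)"
    and F_inj: "i \<in> S \<Longrightarrow> inj_on (F i) K"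
    and F_maps: "i \<in> S \<Longrightarrow> F i ` K \<subseteq> K"
    and pi_continuous:
      "continuous_map (product_topology (\<lambda>_::nat. discrete_topology S) UNIV) (top_of_set K) \<pi>"
    and pi_surj: "\<pi> ` (UNIV \<rightarrow> S) = K"
    and pi_shift: "i \<in> S \<Longrightarrow> \<omega> \<in> UNIV \<rightarrow> S \<Longrightarrow> \<pi> (case_nat i \<omega>) = F i (\<pi> \<omega>)"

locale regular_harmonic_structure = self_similar_structure K S F \<pi> r D
  for K :: "'a::metric_space set" and S :: "'i set" and F \<pi> r D +
  assumes pcf: "finite V0" "V0 \<noteq> {}"
    and r_regular: "i \<in> S \<Longrightarrow> 0 < r i \<and> r i < 1"
    and D_sym: "p \<in> V0 \<Longrightarrow> q \<in> V0 \<Longrightarrow> D p q = D q p"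
    and D_offdiag: "p \<in> V0 \<Longrightarrow> q \<in> V0 \<Longrightarrow> p \<noteq> q \<Longrightarrow> 0 \<le> D p q"
    and D_nonpos: "(\<Sum>p\<in>V0. \<Sum>q\<in>V0. v p * D p q * v q) \<le> 0"
    and D_kernel:
      "(\<forall>p\<in>V0. (\<Sum>q\<in>V0. D p q * v q) = 0) \<longleftrightarrow> (\<exists>c. \<forall>p\<in>V0. v p = c)"
    and energy_min:
      "(\<exists>v. (\<forall>p\<in>V0. v p = u p) \<and> energy_m 1 v v = energy0 u u) \<and>
       (\<forall>v. (\<forall>p\<in>V0. v p = u p) \<longrightarrow> energy0 u u \<le> energy_m 1 v v)"

end

theory Submission
  imports Defs "HOL-Real_Asymp.Real_Asymp"
begin

text \<open>
Write \<open>a\<^sub>n(t)\<close> for the coefficient of \<open>u(t, \<cdot>)\<close> along the eigenfunction \<open>\<phi>\<^sub>n\<close>. Formally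
\<open>u\<^sub>t\<^sub>t = - \<Delta>u\<close> and the symmetry of \<open>\<Delta>\<close> give \<open>a\<^sub>n'' = \<lambda>\<^sub>n a\<^sub>n\<close>; a bounded solution on the half line is
\<open>c\<^sub>n exp (- sqrt \<lambda>\<^sub>n t)\<close>. Letting \<open>t\<close> tend to 0 in Bessel's inequality shows that \<open>c\<close> is square
summable, so \<open>c\<close> is the coefficient sequence of some \<open>f\<close> in L2 (lemma \<open>riesz_fischer\<close>). As \<open>t\<close> tends to 0,
\<open>u(t, \<cdot>)\<close> converges to \<open>f\<close> in L2, hence \<open>f\<close> inherits the bound of \<open>u\<close>, and summing the modes gives the
Poisson integral of \<open>f\<close>. Two steps need an argument.

Differentiating \<open>a\<^sub>n\<close> under the integral sign. The definition of a harmonic function makes \<open>u\<^sub>t\<^sub>t\<close>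
continuous in \<open>t\<close> and, off the boundary, in \<open>x\<close>, but gives no bound that is uniform in \<open>t\<close>. Parseval
identifies the squared L2 norm of \<open>u\<^sub>t\<^sub>t(t, \<cdot>)\<close> with \<open>N(t) = \<Sum>n. (\<lambda>\<^sub>n a\<^sub>n(t))\<^sup>2\<close>. Near a time around which
\<open>N\<close> is bounded, Fubini is available and \<open>a\<^sub>n\<close> has symmetric second derivative \<open>\<lambda>\<^sub>n a\<^sub>n\<close>
(lemma \<open>second_difference_coefficient\<close>). The times around which \<open>N\<close> is unbounded form a closed
set \<open>E\<close>; being a supremum of continuous functions that is finite everywhere, \<open>N\<close> is bounded on a relatively
open part of \<open>E\<close> by Baire's theorem. In a gap of \<open>E\<close> the equation holds, so the maximum principle
bounds \<open>N\<close> by its values at the two ends. Hence \<open>N\<close> is bounded on a whole neighbourhood of a point of \<open>E\<close>, which is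
absurd, so \<open>E\<close> is empty (lemma \<open>sym_deriv2_from_local_bounds\<close>).

Convergence at every point of \<open>K\<close>, instead of in L2 only. This rests on the bound \<open>v(x)\<^sup>2 \<le> A \<E>(v, v)\<close> for
functions \<open>v\<close> of finite energy that vanish on the boundary (lemma \<open>sup_bound\<close>), obtained by chaining differences
along cells that shrink to \<open>x\<close>. It yields a uniform bound on \<open>\<Sum>n. \<phi>\<^sub>n(x)\<^sup>2 / \<lambda>\<^sub>n\<close> (the diagonal of the Green
function), thus absolute convergence of the Poisson kernel, and uniform convergence of the expansion of each such
\<open>v\<close>. For a general self-similar structure the sup bound would require the level one graph to be connected. Here this
follows from the eigensystem: the indicator of a component away from the boundary would have energy zero,
and would therefore be orthogonal to all eigenfunctions, against completeness.
\<close>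

section \<open>Symmetric second derivatives\<close>

text \<open>The symmetric (Schwarz) second derivative. It can be read off from averages of a second derivative, and it is
nonpositive at an interior maximum, which is what the comparison arguments below rest on.\<close>

definition has_sym_deriv2 :: "(real \<Rightarrow> real) \<Rightarrow> real \<Rightarrow> real \<Rightarrow> bool" where
  "has_sym_deriv2 f L t \<longleftrightarrow> ((\<lambda>h. (f (t + h) - 2 * f t + f (t - h)) / h\<^sup>2) \<longlongrightarrow> L) (at_right 0)"

lemma has_sym_deriv2_add:
  "has_sym_deriv2 f a t \<Longrightarrow> has_sym_deriv2 g b t \<Longrightarrow> has_sym_deriv2 (\<lambda>s. f s + g s) (a + b) t"
  unfolding has_sym_deriv2_def
  by (drule (1) tendsto_add) (simp add: diff_divide_distrib add_divide_distrib algebra_simps)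

lemma has_sym_deriv2_cmult:
  "has_sym_deriv2 f a t \<Longrightarrow> has_sym_deriv2 (\<lambda>s. c * f s) (c * a) t"
  unfolding has_sym_deriv2_def
  by (drule tendsto_mult_left[where c = c]) (simp add: diff_divide_distrib add_divide_distrib algebra_simps)

lemma has_sym_deriv2_exp: "has_sym_deriv2 (\<lambda>s. exp (k * s)) (k\<^sup>2 * exp (k * t)) t"
proof -
  have "((\<lambda>h::real. (exp (k * h) - 2 + exp (- (k * h))) / h\<^sup>2) \<longlongrightarrow> k\<^sup>2) (at_right 0)"
  proof (cases "k = 0")
    case True then show ?thesis by simp
  next
    case False
    have "((\<lambda>h::real. (exp (k * h) - 2 + exp (- (k * h))) / h\<^sup>2) \<longlongrightarrow> k * k) (at_right 0)"
      using False by real_asymp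
    then show ?thesis by (simp add: power2_eq_square)
  qed
  then have "((\<lambda>h::real. exp (k * t) * ((exp (k * h) - 2 + exp (- (k * h))) / h\<^sup>2)) \<longlongrightarrow> exp (k * t) * k\<^sup>2) (at_right 0)"
    by (rule tendsto_mult_left)
  moreover have "exp (k * t) * ((exp (k * h) - 2 + exp (- (k * h))) / h\<^sup>2)
      = (exp (k * (t + h)) - 2 * exp (k * t) + exp (k * (t - h))) / h\<^sup>2" for h
  proof -
    have "exp (k * (t + h)) = exp (k * t) * exp (k * h)"
      by (simp only: distrib_left exp_add)
    moreover have "exp (k * (t - h)) = exp (k * t) * exp (- (k * h))"
      by (simp only: exp_add[symmetric] right_diff_distrib) simp
    ultimately show ?thesis by (simp only:) (simp add: field_simps)
  qed
  ultimately show ?thesis unfolding has_sym_deriv2_def by (simp only: mult.commute[of "exp (k * t)" "k\<^sup>2"])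
qed

text \<open>At a positive interior maximum the second differences of the sum would be at most 0, while
the second difference of \<open>f\<^sup>2\<close> is at least \<open>2 f\<close> times that of \<open>f\<close>, which tends to \<open>2 \<lambda> f\<^sup>2\<close>
after division by \<open>h\<^sup>2\<close>.\<close>

lemma sum_squares_max_principle:
  fixes f :: "nat \<Rightarrow> real \<Rightarrow> real"
  assumes cont: "\<And>n. n < N \<Longrightarrow> continuous_on {c..d} (f n)"
    and sym: "\<And>n t. n < N \<Longrightarrow> t \<in> {c<..<d} \<Longrightarrow> has_sym_deriv2 (f n) (lam n * f n t) t"
    and pos: "\<And>n. 0 < lam n" "\<And>n. 0 \<le> w n"
    and ends: "(\<Sum>n<N. w n * (f n c)\<^sup>2) \<le> B" "(\<Sum>n<N. w n * (f n d)\<^sup>2) \<le> B"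
    and t: "t \<in> {c..d}"
  shows "(\<Sum>n<N. w n * (f n t)\<^sup>2) \<le> B"
proof -
  define Q where "Q = (\<lambda>t. \<Sum>n<N. w n * (f n t)\<^sup>2)"
  have Q_nonneg: "0 \<le> Q s" for s
    unfolding Q_def by (intro sum_nonneg) (simp add: pos)
  have "continuous_on {c..d} Q"
    unfolding Q_def by (intro continuous_intros cont) auto
  then obtain m where m: "m \<in> {c..d}" and max: "\<And>s. s \<in> {c..d} \<Longrightarrow> Q s \<le> Q m"
    using continuous_attains_sup[of "{c..d}" Q] t by auto
  have "Q m \<le> B"
  proof (cases "m = c \<or> m = d")
    case True then show ?thesis using ends unfolding Q_def by auto
  next
    case False
    then have mi: "m \<in> {c<..<d}" using m by auto
    have lim: "((\<lambda>h. \<Sum>n<N. w n * (2 * f n m * ((f n (m + h) - 2 * f n m + f n (m - h)) / h\<^sup>2))) \<longlongrightarrow>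
        (\<Sum>n<N. w n * (2 * f n m * (lam n * f n m)))) (at_right 0)"
      using sym[OF _ mi] unfolding has_sym_deriv2_def by (intro tendsto_intros) auto
    have "eventually (\<lambda>h::real. 0 < h \<and> h < min (m - c) (d - m)) (at_right 0)"
      using mi by (auto simp: eventually_at_right[of 0 1] intro!: exI[of _ "min (m - c) (d - m)"])
    then have "eventually (\<lambda>h. (\<Sum>n<N. w n * (2 * f n m * ((f n (m + h) - 2 * f n m + f n (m - h)) / h\<^sup>2))) \<le> 0) (at_right 0)"
    proof eventually_elim
      case (elim h)
      have "w n * (2 * f n m * (f n (m + h) - 2 * f n m + f n (m - h)))
          \<le> w n * (f n (m + h))\<^sup>2 + w n * (f n (m - h))\<^sup>2 - 2 * (w n * (f n m)\<^sup>2)" for n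
      proof -
        have "2 * f n m * (f n (m + h) - 2 * f n m + f n (m - h))
           = (f n (m + h))\<^sup>2 + (f n (m - h))\<^sup>2 - 2 * (f n m)\<^sup>2 - (f n (m + h) - f n m)\<^sup>2 - (f n (m - h) - f n m)\<^sup>2"
          by (simp add: power2_eq_square algebra_simps)
        also have "\<dots> \<le> (f n (m + h))\<^sup>2 + (f n (m - h))\<^sup>2 - 2 * (f n m)\<^sup>2" by simp
        finally show ?thesis using mult_left_mono[OF _ pos(2)[of n]] by (fastforce simp: algebra_simps)
      qed
      then have "(\<Sum>n<N. w n * (2 * f n m * (f n (m + h) - 2 * f n m + f n (m - h))))
          \<le> (\<Sum>n<N. w n * (f n (m + h))\<^sup>2 + w n * (f n (m - h))\<^sup>2 - 2 * (w n * (f n m)\<^sup>2))"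
        by (intro sum_mono)
      also have "\<dots> = Q (m + h) + Q (m - h) - 2 * Q m"
        unfolding Q_def by (simp add: sum.distrib sum_subtractf sum_distrib_left)
      also have "\<dots> \<le> 0"
        using max[of "m + h"] max[of "m - h"] elim by simp
      finally have "(\<Sum>n<N. w n * (2 * f n m * (f n (m + h) - 2 * f n m + f n (m - h)))) / h\<^sup>2 \<le> 0"
        by (simp add: divide_le_0_iff)
      then show ?case by (simp add: sum_divide_distrib)
    qed
    then have le0: "(\<Sum>n<N. w n * (2 * f n m * (lam n * f n m))) \<le> 0"
      using tendsto_upperbound[OF lim] by simp
    have term0: "0 \<le> w n * (2 * f n m * (lam n * f n m))" for n
    proof -
      have "w n * (2 * f n m * (lam n * f n m)) = 2 * lam n * w n * (f n m)\<^sup>2"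
        by (simp add: power2_eq_square algebra_simps)
      then show ?thesis using pos[of n] by simp
    qed
    have "(\<Sum>n<N. w n * (2 * f n m * (lam n * f n m))) = 0"
      by (rule order_antisym[OF le0]) (rule sum_nonneg, rule term0)
    then have "\<forall>n\<in>{..<N}. w n * (2 * f n m * (lam n * f n m)) = 0"
      by (subst (asm) sum_nonneg_eq_0_iff) (use term0 in auto)
    then have "\<forall>n\<in>{..<N}. w n * (f n m)\<^sup>2 = 0"
      using pos(1) by (metis mult_eq_0_iff order_less_irrefl power2_eq_square zero_neq_numeral)
    then have "Q m = 0" unfolding Q_def by (intro sum.neutral)
    also have "0 \<le> Q c" by (rule Q_nonneg)
    also have "\<dots> \<le> B" using ends unfolding Q_def by simp
    finally show ?thesis .
  qed
  then show ?thesis using max[OF t] unfolding Q_def by simp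
qed

lemma sym_deriv2_nonpos:
  assumes cont: "continuous_on {c..d} f"
    and sym: "\<And>t. t \<in> {c<..<d} \<Longrightarrow> has_sym_deriv2 f (l * f t) t"
    and l: "0 < l"
    and ends: "f c \<le> 0" "f d \<le> 0"
    and t: "t \<in> {c..d}"
  shows "f t \<le> 0"
proof -
  obtain m where m: "m \<in> {c..d}" and max: "\<And>s. s \<in> {c..d} \<Longrightarrow> f s \<le> f m"
    using continuous_attains_sup[OF _ _ cont] t by auto
  have "f m \<le> 0"
  proof (cases "m = c \<or> m = d")
    case True then show ?thesis using ends by auto
  next
    case False
    then have mi: "m \<in> {c<..<d}" using m by auto
    have "eventually (\<lambda>h::real. 0 < h \<and> h < min (m - c) (d - m)) (at_right 0)"
      using mi by (auto simp: eventually_at_right[of 0 1] intro!: exI[of _ "min (m - c) (d - m)"])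
    then have "eventually (\<lambda>h. (f (m + h) - 2 * f m + f (m - h)) / h\<^sup>2 \<le> 0) (at_right 0)"
    proof eventually_elim
      case (elim h)
      then show ?case using max[of "m + h"] max[of "m - h"] by (simp add: divide_le_0_iff)
    qed
    then have "l * f m \<le> 0"
      using tendsto_upperbound[OF sym[OF mi, unfolded has_sym_deriv2_def]] by simp
    then show ?thesis using l by (simp add: mult_le_0_iff)
  qed
  then show ?thesis using max[OF t] by simp
qed

text \<open>The growing exponential is the second solution of the equation. Subtracting a small multiple of it
makes the difference to the decaying solution negative far out, so that the maximum principle applies on a
bounded interval; then the multiple tends to 0.\<close>

lemma bounded_sym_deriv2_le:
  assumes cont: "continuous_on {0<..} f"
    and sym: "\<And>t. 0 < t \<Longrightarrow> has_sym_deriv2 f (l * f t) t"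
    and l: "0 < l"
    and bdd: "\<And>t. 0 < t \<Longrightarrow> f t \<le> M"
    and s: "0 < s" "s \<le> t"
  shows "f t \<le> f s * exp (- sqrt l * (t - s))"
proof -
  define k where "k = sqrt l"
  have k: "0 < k" "k\<^sup>2 = l" using l by (auto simp: k_def)
  have approx: "f t \<le> f s * exp (- k * (t - s)) + \<epsilon> * exp (k * t)" if e: "0 < \<epsilon>" for \<epsilon>
  proof -
    define g where "g = (\<lambda>r. f r + ((- f s * exp (k * s)) * exp ((- k) * r) + (- \<epsilon>) * exp (k * r)))"
    have "filterlim (\<lambda>r. \<epsilon> * exp (k * r)) at_top at_top"
      using e k(1) by real_asymp
    then have "eventually (\<lambda>r. M + \<bar>f s\<bar> \<le> \<epsilon> * exp (k * r)) at_top"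
      by (auto simp: filterlim_at_top)
    then have "eventually (\<lambda>r. M + \<bar>f s\<bar> \<le> \<epsilon> * exp (k * r) \<and> t \<le> r) at_top"
      by (intro eventually_conj eventually_ge_at_top)
    then obtain T where T: "M + \<bar>f s\<bar> \<le> \<epsilon> * exp (k * T)" "t \<le> T"
      by (auto simp: eventually_at_top_linorder)
    have "g t \<le> 0"
    proof (rule sym_deriv2_nonpos[of s T g l])
      have "continuous_on {s..T} f" using s by (intro continuous_on_subset[OF cont]) auto
      then show "continuous_on {s..T} g" unfolding g_def by (intro continuous_intros)
      show "has_sym_deriv2 g (l * g r) r" if "r \<in> {s<..<T}" for r
      proof -
        have *: "l * g r = l * f r + ((- f s * exp (k * s)) * ((- k)\<^sup>2 * exp ((- k) * r)) + (- \<epsilon>) * (k\<^sup>2 * exp (k * r)))"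
          by (simp add: g_def k algebra_simps)
        show ?thesis unfolding g_def
          apply (subst *[unfolded g_def])
          using that s by (intro has_sym_deriv2_add has_sym_deriv2_cmult has_sym_deriv2_exp sym) auto
      qed
      show "g s \<le> 0" using e by (simp add: g_def mult.assoc exp_add[symmetric])
      show "g T \<le> 0"
      proof -
        have "k * s \<le> k * T" using k T s by (intro mult_left_mono) auto
        then have ex: "exp (k * s) * exp (- k * T) \<le> 1" by (simp add: exp_add[symmetric])
        have "(- f s) * (exp (k * s) * exp (- k * T)) \<le> \<bar>f s\<bar> * (exp (k * s) * exp (- k * T))"
          by (intro mult_right_mono) auto
        also have "\<dots> \<le> \<bar>f s\<bar>" using mult_left_mono[OF ex, of "\<bar>f s\<bar>"] by simp
        finally have "(- f s * exp (k * s)) * exp ((- k) * T) \<le> \<bar>f s\<bar>" by (simp add: mult.assoc)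
        then show ?thesis using T bdd[of T] s unfolding g_def by simp
      qed
    qed (use T s l in auto)
    moreover have "exp (- k * (t - s)) = exp (k * s) * exp ((- k) * t)"
      by (simp add: exp_add[symmetric] algebra_simps)
    ultimately show ?thesis unfolding g_def by (simp add: algebra_simps)
  qed
  have "((\<lambda>\<epsilon>. f s * exp (- k * (t - s)) + \<epsilon> * exp (k * t)) \<longlongrightarrow> f s * exp (- k * (t - s)) + 0 * exp (k * t)) (at_right 0)"
    by (intro tendsto_intros)
  then have "f t \<le> f s * exp (- k * (t - s)) + 0 * exp (k * t)"
    by (rule tendsto_lowerbound) (auto simp: eventually_at_right[of 0 1] intro!: exI[of _ 1] approx[simplified])
  then show ?thesis by (simp add: k_def)
qed

lemma bounded_sym_deriv2_eq:
  assumes cont: "continuous_on {0<..} f"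
    and sym: "\<And>t. 0 < t \<Longrightarrow> has_sym_deriv2 f (l * f t) t"
    and l: "0 < l"
    and bdd: "\<And>t. 0 < t \<Longrightarrow> \<bar>f t\<bar> \<le> M"
    and s: "0 < s" "s \<le> t"
  shows "f t = f s * exp (- sqrt l * (t - s))"
proof (rule antisym)
  show "f t \<le> f s * exp (- sqrt l * (t - s))"
    by (rule bounded_sym_deriv2_le[OF cont sym l abs_le_D1[OF bdd] s])
  have "(\<lambda>t. - f t) t \<le> (\<lambda>t. - f t) s * exp (- sqrt l * (t - s))"
  proof (rule bounded_sym_deriv2_le[where f = "\<lambda>t. - f t" and M = M, OF _ _ l _ s])
    show "has_sym_deriv2 (\<lambda>t. - f t) (l * - f r) r" if "0 < r" for r
      using has_sym_deriv2_cmult[OF sym[OF that], of "-1"] by simp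
    show "continuous_on {0<..} (\<lambda>t. - f t)" using cont by (rule continuous_on_minus)
    show "- f r \<le> M" if "0 < r" for r using bdd[OF that] by simp
  qed
  then show "f s * exp (- sqrt l * (t - s)) \<le> f t" by simp
qed

text \<open>Local boundedness of \<open>\<Sum>n. w n * (f n)\<^sup>2\<close> is only assumed pointwise, yet the equation propagates:
on the closed set \<open>E\<close> of times around which the sum is unbounded, Baire's theorem gives a relatively open piece where
it is bounded, and across the gaps of \<open>E\<close> the maximum principle carries the bound over.\<close>

lemma sym_deriv2_from_local_bounds:
  fixes f :: "nat \<Rightarrow> real \<Rightarrow> real"
  assumes cont: "\<And>n. continuous_on {a..b} (f n)"
    and pos: "\<And>n. 0 < lam n" "\<And>n. 0 \<le> w n"
    and fin: "\<And>t. t \<in> {a..b} \<Longrightarrow> \<exists>C. \<forall>N. (\<Sum>n<N. w n * (f n t)\<^sup>2) \<le> C"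
    and loc: "\<And>n t C \<epsilon>. t \<in> {a<..<b} \<Longrightarrow> 0 < \<epsilon> \<Longrightarrow>
       (\<And>s N. s \<in> {a..b} \<Longrightarrow> \<bar>s - t\<bar> < \<epsilon> \<Longrightarrow> (\<Sum>n<N. w n * (f n s)\<^sup>2) \<le> C) \<Longrightarrow>
       has_sym_deriv2 (f n) (lam n * f n t) t"
    and t: "t \<in> {a<..<b}"
  shows "has_sym_deriv2 (f n) (lam n * f n t) t"
proof -
  define Q where "Q = (\<lambda>N t. \<Sum>n<N. w n * (f n t)\<^sup>2)"
  define bdd where "bdd = (\<lambda>t. \<exists>C \<epsilon>. 0 < \<epsilon> \<and> (\<forall>s\<in>{a..b}. \<bar>s - t\<bar> < \<epsilon> \<longrightarrow> (\<forall>N. Q N s \<le> C)))"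
  define E where "E = {t \<in> {a..b}. \<not> bdd t}"
  have sym: "has_sym_deriv2 (f n) (lam n * f n t) t" if "t \<in> {a<..<b}" "bdd t" for t n
    using that(2) unfolding bdd_def Q_def by (elim exE conjE, intro loc[OF that(1)]) auto
  have "open {t. bdd t}"
    unfolding open_dist
  proof safe
    fix t assume "bdd t"
    then obtain C \<epsilon> where C: "0 < \<epsilon>" "\<And>s N. s \<in> {a..b} \<Longrightarrow> \<bar>s - t\<bar> < \<epsilon> \<Longrightarrow> Q N s \<le> C"
      unfolding bdd_def by blast
    have "bdd t'" if t': "dist t' t < \<epsilon> / 2" for t'
      unfolding bdd_def
    proof (rule exI[of _ C], rule exI[of _ "\<epsilon> / 2"], intro conjI ballI impI allI)
      show "Q N s \<le> C" if "s \<in> {a..b}" "\<bar>s - t'\<bar> < \<epsilon> / 2" for s N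
        using that t' unfolding dist_real_def by (intro C) linarith+
    qed (use C in auto)
    then show "\<exists>e>0. \<forall>y. dist y t < e \<longrightarrow> y \<in> {t. bdd t}"
      using C by (intro exI[of _ "\<epsilon> / 2"]) auto
  qed
  moreover have "E = {a..b} \<inter> - {t. bdd t}" by (auto simp: E_def)
  ultimately have E_closed: "closed E" by auto
  have "E = {}"
  proof (rule ccontr)
    assume "E \<noteq> {}"
    have contQ: "continuous_on {a..b} (Q N)" for N
      unfolding Q_def by (intro continuous_intros cont)
    define G where "G = (\<lambda>k::nat. {t \<in> E. \<exists>N. real k < Q N t})"
    have openG: "openin (top_of_set E) (G k)" for k
    proof -
      have "G k = (\<Union>N. E \<inter> Q N -` {real k<..})" by (auto simp: G_def)
      moreover have "openin (top_of_set E) (E \<inter> Q N -` {real k<..})" for N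
        by (intro continuous_openin_preimage_gen continuous_on_subset[OF contQ]) (auto simp: E_def)
      ultimately show ?thesis by (metis (no_types, lifting) openin_Union imageE)
    qed
    have "(\<Inter>k. G k) = {}"
    proof -
      have False if t: "\<And>k. t \<in> G k" for t
      proof -
        have "t \<in> {a..b}" using t[of 0] by (simp add: G_def E_def)
        then obtain C where C: "\<And>N. Q N t \<le> C"
          using fin[of t] unfolding Q_def by blast
        obtain k where "C \<le> real k" using real_arch_simple by blast
        moreover obtain N where "real k < Q N t" using t[of k] unfolding G_def by auto
        ultimately show False using C[of N] by simp
      qed
      then show ?thesis by auto
    qed
    then have "\<not> E \<subseteq> closure (\<Inter>(range G))" using \<open>E \<noteq> {}\<close> by simp
    then obtain k where "\<not> E \<subseteq> closure (G k)"
      using Baire[OF E_closed, of "range G"] openG by auto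
    then obtain t1 where t1: "t1 \<in> E" "t1 \<notin> closure (G k)" by auto
    then obtain \<epsilon> where e: "0 < \<epsilon>" "\<And>s. s \<in> G k \<Longrightarrow> \<epsilon> \<le> dist s t1"
      unfolding closure_approachable by (auto simp: not_less)
    have bound_E: "Q N s \<le> real k" if "s \<in> E" "\<bar>s - t1\<bar> < \<epsilon>" for s N
    proof (rule ccontr)
      assume "\<not> Q N s \<le> real k"
      then have "s \<in> G k" using that(1) unfolding G_def by (auto simp: not_le)
      then show False using e(2)[of s] that(2) by (simp add: dist_real_def)
    qed
    define \<alpha> where "\<alpha> = max a (t1 - \<epsilon> / 2)"
    define \<beta> where "\<beta> = min b (t1 + \<epsilon> / 2)"
    have ab: "a \<le> \<alpha>" "\<alpha> \<le> t1" "t1 \<le> \<beta>" "\<beta> \<le> b" "t1 - \<epsilon> / 2 \<le> \<alpha>" "\<beta> \<le> t1 + \<epsilon> / 2"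
      using t1 e by (auto simp: \<alpha>_def \<beta>_def E_def)
    obtain C1 where C1: "\<And>N. Q N \<alpha> \<le> C1" using fin[of \<alpha>] ab unfolding Q_def by fastforce
    obtain C2 where C2: "\<And>N. Q N \<beta> \<le> C2" using fin[of \<beta>] ab unfolding Q_def by fastforce
    define C where "C = max (real k) (max C1 C2)"
    have bound: "Q N s \<le> C" if s: "s \<in> {\<alpha>..\<beta>}" for s N
    proof -
      have in_E: "Q N x \<le> C" if "x \<in> E" "x \<in> {\<alpha>..\<beta>}" for x
      proof -
        have "\<bar>x - t1\<bar> \<le> \<epsilon> / 2" using that ab unfolding abs_le_iff by (simp; linarith)
        then show ?thesis using bound_E[OF that(1), of N] e(1) by (simp add: C_def)
      qed
      \<comment> \<open>The gap of \<open>E\<close> around \<open>s\<close>, cut off at the ends of the window.\<close>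
      define L where "L = insert \<alpha> (E \<inter> {\<alpha>..s})"
      define R where "R = insert \<beta> (E \<inter> {s..\<beta>})"
      have LR: "closed L" "closed R" "bdd_above L" "bdd_below R" "L \<noteq> {}" "R \<noteq> {}"
        using E_closed s unfolding L_def R_def by (auto intro!: closed_insert closed_Int)
      have c: "Sup L \<in> L" and d: "Inf R \<in> R"
        using closed_contains_Sup[of L] closed_contains_Inf[of R] LR by auto
      have cd: "Sup L \<le> s" "s \<le> Inf R" "\<alpha> \<le> Sup L" "Inf R \<le> \<beta>"
        using c d s unfolding L_def R_def by auto
      have gap: "x \<notin> E" if x: "x \<in> {Sup L<..<Inf R}" for x
      proof
        assume "x \<in> E"
        show False
        proof (cases "x \<le> s")
          case True
          then have "x \<in> L" using \<open>x \<in> E\<close> x cd unfolding L_def by auto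
          then show False using cSup_upper[OF _ LR(3)] x by force
        next
          case False
          then have "x \<in> R" using \<open>x \<in> E\<close> x cd unfolding R_def by auto
          then show False using cInf_lower[OF _ LR(4)] x by force
        qed
      qed
      have "Q N (Sup L) \<le> C" "Q N (Inf R) \<le> C"
        using c d in_E C1[of N] C2[of N] s unfolding L_def R_def by (auto simp: C_def)
      then show ?thesis unfolding Q_def
      proof (rule sum_squares_max_principle[where lam = lam, rotated 4])
        show "continuous_on {Sup L..Inf R} (f n)" for n
          using cd ab by (intro continuous_on_subset[OF cont]) auto
        show "has_sym_deriv2 (f n) (lam n * f n x) x" if "x \<in> {Sup L<..<Inf R}" for n x
        proof (rule sym)
          show "x \<in> {a<..<b}" using that cd ab by auto
          then show "bdd x" using gap[OF that] by (auto simp: E_def)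
        qed
      qed (use cd pos in auto)
    qed
    have "bdd t1" unfolding bdd_def
    proof (rule exI[of _ C], rule exI[of _ "\<epsilon> / 2"], intro conjI ballI impI allI)
      show "Q N s \<le> C" if "s \<in> {a..b}" "\<bar>s - t1\<bar> < \<epsilon> / 2" for s N
        using that unfolding abs_less_iff by (intro bound) (simp add: \<alpha>_def \<beta>_def; linarith)
    qed (use e in simp)
    then show False using t1 by (simp add: E_def)
  qed
  then show ?thesis using t by (intro sym) (auto simp: E_def)
qed

section \<open>Orthonormal expansions in L2\<close>

definition square_integrable :: "'a measure \<Rightarrow> ('a \<Rightarrow> real) \<Rightarrow> bool" where
  "square_integrable M f \<longleftrightarrow> f \<in> borel_measurable M \<and> integrable M (\<lambda>x. (f x)\<^sup>2)"

lemma square_integrable_measurable: "square_integrable M f \<Longrightarrow> f \<in> borel_measurable M"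
  by (simp add: square_integrable_def)

lemma square_integrable_mult:
  assumes "square_integrable M f" "square_integrable M g"
  shows "integrable M (\<lambda>x. f x * g x)"
proof (rule Bochner_Integration.integrable_bound)
  show "integrable M (\<lambda>x. (f x)\<^sup>2 + (g x)\<^sup>2)" "(\<lambda>x. f x * g x) \<in> borel_measurable M"
    using assms by (auto simp: square_integrable_def)
  have "\<bar>f x * g x\<bar> \<le> (f x)\<^sup>2 + (g x)\<^sup>2" for x
  proof -
    have "0 \<le> (\<bar>f x\<bar> - \<bar>g x\<bar>)\<^sup>2 + (f x)\<^sup>2 + (g x)\<^sup>2" by simp
    then show ?thesis by (simp add: power2_diff abs_mult)
  qed
  then show "AE x in M. norm (f x * g x) \<le> norm ((f x)\<^sup>2 + (g x)\<^sup>2)"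
    by simp
qed

lemma square_integrable_cmult: "square_integrable M f \<Longrightarrow> square_integrable M (\<lambda>x. c * f x)"
  by (auto simp: square_integrable_def power_mult_distrib)

lemma square_integrable_add:
  assumes "square_integrable M f" "square_integrable M g"
  shows "square_integrable M (\<lambda>x. f x + g x)"
  using assms square_integrable_mult[OF assms]
  by (auto simp: square_integrable_def power2_sum mult.assoc)

lemma square_integrable_diff:
  assumes "square_integrable M f" "square_integrable M g"
  shows "square_integrable M (\<lambda>x. f x - g x)"
  using square_integrable_add[OF assms(1) square_integrable_cmult[OF assms(2), of "-1"]] by simp

lemma square_integrable_sum:
  "(\<And>n. n \<in> A \<Longrightarrow> square_integrable M (f n)) \<Longrightarrow> square_integrable M (\<lambda>x. \<Sum>n\<in>A. f n x)"
proof (induction A rule: infinite_finite_induct)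
  case (insert n A)
  then show ?case using square_integrable_add[of M "f n"] by simp
qed (simp_all add: square_integrable_def)

lemma fatou_square_integrable:
  fixes h :: "nat \<Rightarrow> 'a \<Rightarrow> real"
  assumes h: "\<And>j. square_integrable M (h j)" and g: "g \<in> borel_measurable M"
    and lim: "AE x in M. (\<lambda>j. h j x) \<longlonglongrightarrow> g x"
    and bound: "eventually (\<lambda>j. (LINT x|M. (h j x)\<^sup>2) \<le> C) sequentially"
  shows "square_integrable M g \<and> (LINT x|M. (g x)\<^sup>2) \<le> C"
proof -
  have [measurable]: "\<And>j. h j \<in> borel_measurable M" "g \<in> borel_measurable M"
    using h g by (auto simp: square_integrable_def)
  obtain j where "(LINT x|M. (h j x)\<^sup>2) \<le> C" using bound by (auto simp: eventually_sequentially)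
  moreover have "0 \<le> (LINT x|M. (h j x)\<^sup>2)" by simp
  ultimately have C: "0 \<le> C" by linarith
  have "(\<integral>\<^sup>+x. ennreal ((g x)\<^sup>2) \<partial>M) = (\<integral>\<^sup>+x. liminf (\<lambda>j. ennreal ((h j x)\<^sup>2)) \<partial>M)"
  proof (rule nn_integral_cong_AE)
    show "AE x in M. ennreal ((g x)\<^sup>2) = liminf (\<lambda>j. ennreal ((h j x)\<^sup>2))"
      using lim
    proof eventually_elim
      case (elim x)
      then have "(\<lambda>j. ennreal ((h j x)\<^sup>2)) \<longlonglongrightarrow> ennreal ((g x)\<^sup>2)"
        by (intro tendsto_ennrealI tendsto_power)
      then show ?case by (rule lim_imp_Liminf[OF trivial_limit_sequentially, symmetric])
    qed
  qed
  also have "\<dots> \<le> liminf (\<lambda>j. \<integral>\<^sup>+x. ennreal ((h j x)\<^sup>2) \<partial>M)"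
    by (intro nn_integral_liminf) measurable
  also have "\<dots> \<le> ennreal C"
  proof (rule Liminf_le)
    show "\<forall>\<^sub>F j in sequentially. (\<integral>\<^sup>+x. ennreal ((h j x)\<^sup>2) \<partial>M) \<le> ennreal C"
      using bound
    proof eventually_elim
      case (elim j)
      have "(\<integral>\<^sup>+x. ennreal ((h j x)\<^sup>2) \<partial>M) = ennreal (LINT x|M. (h j x)\<^sup>2)"
        using h[of j] by (intro nn_integral_eq_integral) (auto simp: square_integrable_def)
      then show ?case using elim by (simp add: ennreal_leI)
    qed
  qed simp
  finally have le: "(\<integral>\<^sup>+x. ennreal ((g x)\<^sup>2) \<partial>M) \<le> ennreal C" .
  then have int: "integrable M (\<lambda>x. (g x)\<^sup>2)"
    by (intro integrableI_bounded) (auto simp: le_less_trans)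
  then have "ennreal (LINT x|M. (g x)\<^sup>2) \<le> ennreal C"
    using le by (subst (asm) nn_integral_eq_integral) auto
  then show ?thesis using C int g by (simp add: square_integrable_def)
qed

text \<open>On a probability space \<open>\<bar>d\<bar> \<le> 2^k d\<^sup>2 / 2 + 2^(-k) / 2\<close> turns the L2 bounds into summable
L1 bounds.\<close>

lemma (in prob_space) AE_summable_of_squares:
  fixes d :: "nat \<Rightarrow> 'a \<Rightarrow> real"
  assumes d: "\<And>k. square_integrable M (d k)" and bound: "\<And>k. (LINT x|M. (d k x)\<^sup>2) \<le> (1/4) ^ k"
  shows "AE x in M. summable (\<lambda>k. d k x)"
proof -
  have [measurable]: "\<And>j. d j \<in> borel_measurable M"
    using d by (auto simp: square_integrable_def)
  have int: "integrable M (d k)" for k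
    using d[of k] by (auto simp: square_integrable_def intro: square_integrable_imp_integrable[of "d k"])
  have "(LINT x|M. \<bar>d k x\<bar>) \<le> (1/2) ^ k" for k
  proof -
    have "(LINT x|M. \<bar>d k x\<bar>) \<le> (LINT x|M. 2 ^ k * (d k x)\<^sup>2 / 2 + (1/2) ^ k / 2)"
    proof (rule integral_mono)
      show "integrable M (\<lambda>x. 2 ^ k * (d k x)\<^sup>2 / 2 + (1 / 2) ^ k / 2)"
        using d[of k] by (auto simp: square_integrable_def)
      show "\<bar>d k x\<bar> \<le> 2 ^ k * (d k x)\<^sup>2 / 2 + (1 / 2) ^ k / 2" for x
      proof -
        have "0 \<le> 2 ^ k * (\<bar>d k x\<bar> - (1/2) ^ k)\<^sup>2" by simp
        also have "\<dots> = 2 ^ k * (d k x)\<^sup>2 + (1/2) ^ k - 2 * \<bar>d k x\<bar>"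
        proof -
          have *: "a * (\<bar>y\<bar> - b)\<^sup>2 = a * y\<^sup>2 + b - 2 * \<bar>y\<bar>" if "a * b = 1" for a b y :: real
          proof -
            have "a * (\<bar>y\<bar> - b)\<^sup>2 = a * y\<^sup>2 + (a * b) * b - 2 * (a * b) * \<bar>y\<bar>"
              by (simp add: power2_eq_square algebra_simps)
            then show ?thesis using that by simp
          qed
          show ?thesis by (rule *) (simp add: power_mult_distrib[symmetric])
        qed
        finally show ?thesis by simp
      qed
    qed (use int in auto)
    also have "\<dots> = 2 ^ k * (LINT x|M. (d k x)\<^sup>2) / 2 + (1/2) ^ k / 2"
      using d[of k] by (simp add: square_integrable_def prob_space)
    also have "\<dots> \<le> 2 ^ k * (1/4) ^ k / 2 + (1/2) ^ k / 2"
      using bound[of k] by (intro add_right_mono divide_right_mono mult_left_mono) auto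
    also have "\<dots> = (1/2) ^ k" by (simp add: power_mult_distrib[symmetric])
    finally show ?thesis .
  qed
  then have "(\<Sum>k. ennreal (LINT x|M. \<bar>d k x\<bar>)) \<le> (\<Sum>k. ennreal ((1/2) ^ k))"
    by (intro suminf_le ennreal_leI) auto
  also have "\<dots> < \<infinity>"
    by (simp add: suminf_ennreal_eq[OF _ geometric_sums])
  finally have "(\<integral>\<^sup>+x. (\<Sum>k. ennreal \<bar>d k x\<bar>) \<partial>M) < \<infinity>"
    by (subst nn_integral_suminf) (auto simp: nn_integral_eq_integral int)
  then have "AE x in M. (\<Sum>k. ennreal \<bar>d k x\<bar>) \<noteq> \<infinity>"
    by (intro nn_integral_PInf_AE) auto
  then show ?thesis
  proof eventually_elim
    case (elim x)
    then have "summable (\<lambda>k. \<bar>d k x\<bar>)"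
      by (intro summable_suminf_not_top) auto
    then show ?case by (rule summable_rabs_cancel)
  qed
qed

locale L2_basis = prob_space M for M :: "'a measure" +
  fixes \<phi> :: "nat \<Rightarrow> 'a \<Rightarrow> real"
  assumes complete: "complete_orthonormal_L2 M \<phi>"
begin

definition fourier :: "('a \<Rightarrow> real) \<Rightarrow> nat \<Rightarrow> real" where
  "fourier f n = (LINT x|M. f x * \<phi> n x)"

lemma basis_square_integrable: "square_integrable M (\<phi> n)"
  using complete by (simp add: complete_orthonormal_L2_def square_integrable_def)

lemma AE_zero_if_fourier_zero:
  assumes "square_integrable M f" "\<And>n. fourier f n = 0"
  shows "AE x in M. f x = 0"
proof -
  have "\<forall>f. f \<in> borel_measurable M \<and> integrable M (\<lambda>x. (f x)\<^sup>2) \<and>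
      (\<forall>n. (LINT x|M. f x * \<phi> n x) = 0) \<longrightarrow> (AE x in M. f x = 0)"
    using complete unfolding complete_orthonormal_L2_def by (elim conjE)
  then show ?thesis
    by (rule allE[of _ f]) (use assms in \<open>simp add: square_integrable_def fourier_def\<close>)
qed

lemma orthonormal: "(LINT x|M. \<phi> m x * \<phi> n x) = (if m = n then 1 else 0)"
  using complete by (simp add: complete_orthonormal_L2_def)

lemma square_integrable_combination: "square_integrable M (\<lambda>x. \<Sum>n\<in>A. c n * \<phi> n x)"
  by (intro square_integrable_sum square_integrable_cmult basis_square_integrable)

lemma fourier_diff:
  "square_integrable M f \<Longrightarrow> square_integrable M g \<Longrightarrow> fourier (\<lambda>x. f x - g x) n = fourier f n - fourier g n"
  unfolding fourier_def
  by (simp add: left_diff_distrib square_integrable_mult basis_square_integrable)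

lemma integral_combination:
  assumes "square_integrable M f"
  shows "(LINT x|M. f x * (\<Sum>n\<in>A. c n * \<phi> n x)) = (\<Sum>n\<in>A. c n * fourier f n)"
proof -
  have int: "integrable M (\<lambda>x. c n * (f x * \<phi> n x))" for n
    by (simp add: square_integrable_mult[OF assms basis_square_integrable])
  have "(LINT x|M. f x * (\<Sum>n\<in>A. c n * \<phi> n x)) = (LINT x|M. (\<Sum>n\<in>A. c n * (f x * \<phi> n x)))"
    by (simp add: sum_distrib_left mult_ac)
  also have "\<dots> = (\<Sum>n\<in>A. c n * fourier f n)"
    using int by (simp add: fourier_def)
  finally show ?thesis .
qed

lemma fourier_combination:
  assumes "finite A"
  shows "fourier (\<lambda>x. \<Sum>n\<in>A. c n * \<phi> n x) m = (if m \<in> A then c m else 0)"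
proof -
  have "fourier (\<lambda>x. \<Sum>n\<in>A. c n * \<phi> n x) m = (LINT x|M. \<phi> m x * (\<Sum>n\<in>A. c n * \<phi> n x))"
    by (simp add: fourier_def mult.commute)
  also have "\<dots> = (\<Sum>n\<in>A. c n * (if m = n then 1 else 0))"
    by (simp add: integral_combination[OF basis_square_integrable] fourier_def orthonormal)
  also have "\<dots> = (if m \<in> A then c m else 0)"
    using assms by (simp add: if_distrib[where f = "\<lambda>z. _ * z"] cong: if_cong)
  finally show ?thesis .
qed

lemma norm_combination:
  assumes "finite A"
  shows "(LINT x|M. (\<Sum>n\<in>A. c n * \<phi> n x)\<^sup>2) = (\<Sum>n\<in>A. (c n)\<^sup>2)"
  unfolding power2_eq_square
  by (simp add: integral_combination[OF square_integrable_combination] fourier_combination[OF assms])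

lemma bessel:
  assumes f: "square_integrable M f"
  shows "(\<Sum>n<N. (fourier f n)\<^sup>2) \<le> (LINT x|M. (f x)\<^sup>2)"
proof -
  let ?p = "\<lambda>x. \<Sum>n<N. fourier f n * \<phi> n x"
  have "0 \<le> (LINT x|M. (f x - ?p x)\<^sup>2)" by simp
  also have "\<dots> = (LINT x|M. (f x)\<^sup>2 + (?p x)\<^sup>2 - 2 * (f x * ?p x))"
    by (simp add: power2_diff mult.assoc)
  also have "\<dots> = (LINT x|M. (f x)\<^sup>2) + (LINT x|M. (?p x)\<^sup>2) - 2 * (LINT x|M. f x * ?p x)"
    using f square_integrable_combination[of "fourier f" "{..<N}"]
      square_integrable_mult[OF f square_integrable_combination[of "fourier f" "{..<N}"]]
    by (simp add: square_integrable_def)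
  also have "\<dots> = (LINT x|M. (f x)\<^sup>2) - (\<Sum>n<N. (fourier f n)\<^sup>2)"
    by (simp add: norm_combination integral_combination[OF f] power2_eq_square[of "fourier f _"])
  finally show ?thesis by simp
qed

lemma fourier_sq_le:
  assumes "square_integrable M f"
  shows "(fourier f n)\<^sup>2 \<le> (LINT x|M. (f x)\<^sup>2)"
proof -
  have "(fourier f n)\<^sup>2 \<le> (\<Sum>k<Suc n. (fourier f k)\<^sup>2)"
    by (rule member_le_sum[where f = "\<lambda>k. (fourier f k)\<^sup>2"]) auto
  also have "\<dots> \<le> (LINT x|M. (f x)\<^sup>2)" by (rule bessel[OF assms])
  finally show ?thesis .
qed

text \<open>Partial sums along a fast subsequence converge almost everywhere; Fatou's lemma makes the limit an L2
limit, so its coefficients are the prescribed ones.\<close>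

lemma riesz_fischer:
  assumes C: "\<And>N. (\<Sum>n<N. (c n)\<^sup>2) \<le> C"
  shows "\<exists>f. square_integrable M f \<and> (\<forall>n. fourier f n = c n) \<and> (LINT x|M. (f x)\<^sup>2) \<le> C"
proof -
  have sm: "summable (\<lambda>n. (c n)\<^sup>2)"
  proof (rule bounded_imp_summable[where B = C])
    show "(\<Sum>n\<le>N. (c n)\<^sup>2) \<le> C" for N
      using C[of "Suc N"] by (simp only: lessThan_Suc_atMost)
  qed simp
  have "\<forall>k. \<exists>K. \<forall>m\<ge>K. \<forall>n. (\<Sum>i\<in>{m..<n}. (c i)\<^sup>2) \<le> (1/4) ^ k"
  proof
    fix k
    obtain K where "\<And>m n. K \<le> m \<Longrightarrow> norm (\<Sum>i\<in>{m..<n}. (c i)\<^sup>2) < (1/4) ^ k"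
      using sm unfolding summable_Cauchy by (meson zero_less_divide_1_iff zero_less_numeral zero_less_power)
    then show "\<exists>K. \<forall>m\<ge>K. \<forall>n. (\<Sum>i\<in>{m..<n}. (c i)\<^sup>2) \<le> (1/4) ^ k"
      by (intro exI[of _ K] allI impI) (metis abs_le_D1 less_imp_le real_norm_def)
  qed
  from choice[OF this]
  obtain K where K: "\<And>k m n. K k \<le> m \<Longrightarrow> (\<Sum>i\<in>{m..<n}. (c i)\<^sup>2) \<le> (1/4) ^ k"
    by blast
  \<comment> \<open>The summand \<open>k\<close> makes \<open>N\<close> unbounded, so that every index is eventually below \<open>N k\<close>.\<close>
  define N where "N = (\<lambda>k. k + (\<Sum>j\<le>k. K j))"
  have KN: "K k \<le> N k" for k
    unfolding N_def by (rule trans_le_add2, rule member_le_sum) auto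
  have N_mono: "N j \<le> N k" if "j \<le> k" for j k
    using that unfolding N_def by (intro add_mono sum_mono2) auto
  define s where "s = (\<lambda>k x. \<Sum>n<N k. c n * \<phi> n x)"
  have s_sq: "square_integrable M (s k)" for k
    unfolding s_def by (rule square_integrable_combination)
  have s_diff: "s j x - s k x = (\<Sum>n\<in>{N k..<N j}. c n * \<phi> n x)" if "k \<le> j" for j k x
    unfolding s_def lessThan_atLeast0 by (rule sum_diff_nat_ivl) (use N_mono[OF that] in auto)
  have s_dist: "(LINT x|M. (s j x - s k x)\<^sup>2) \<le> (1/4) ^ k" if "k \<le> j" for j k
    using K[OF KN[of k], of "N j"] by (simp add: s_diff[OF that] norm_combination)
  have conv: "AE x in M. summable (\<lambda>k. s (Suc k) x - s k x)"
    by (rule AE_summable_of_squares) (auto intro: square_integrable_diff s_sq s_dist)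
  define f where "f = (\<lambda>x. lim (\<lambda>k. s k x))"
  have [measurable]: "s k \<in> borel_measurable M" for k
    using s_sq by (simp add: square_integrable_def)
  have f_meas[measurable]: "f \<in> borel_measurable M" unfolding f_def by measurable
  have lim: "AE x in M. (\<lambda>k. s k x) \<longlonglongrightarrow> f x"
    using conv
  proof eventually_elim
    case (elim x)
    then have "convergent (\<lambda>k. s k x - s 0 x)"
      by (simp add: summable_iff_convergent sum_lessThan_telescope[of "\<lambda>k. s k x"])
    then have "convergent (\<lambda>k. s k x)"
      by (simp add: convergent_diff_const_right_iff)
    then show ?case unfolding f_def by (rule convergent_LIMSEQ_iff[THEN iffD1])
  qed
  have f: "square_integrable M f \<and> (LINT x|M. (f x)\<^sup>2) \<le> C"
    by (rule fatou_square_integrable[OF s_sq f_meas lim]) (simp add: s_def norm_combination C)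
  have f_dist: "(LINT x|M. (f x - s k x)\<^sup>2) \<le> (1/4) ^ k" for k
  proof -
    have "square_integrable M (\<lambda>x. f x - s k x) \<and> (LINT x|M. (f x - s k x)\<^sup>2) \<le> (1/4) ^ k"
    proof (rule fatou_square_integrable)
      show "square_integrable M (\<lambda>x. s j x - s k x)" for j
        by (intro square_integrable_diff s_sq)
      show "AE x in M. (\<lambda>j. s j x - s k x) \<longlonglongrightarrow> f x - s k x"
        using lim by eventually_elim (intro tendsto_intros)
      show "\<forall>\<^sub>F j in sequentially. (LINT x|M. (s j x - s k x)\<^sup>2) \<le> (1/4) ^ k"
        using s_dist by (auto simp: eventually_sequentially)
    qed auto
    then show ?thesis by simp
  qed
  have "fourier f m = c m" for m
  proof -
    have le: "(fourier f m - c m)\<^sup>2 \<le> (1/4) ^ k" if "Suc m \<le> k" for k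
    proof -
      have "m < k + (\<Sum>j\<le>k. K j)" using that by (intro trans_less_add1) linarith
      then have "m \<in> {..<N k}" by (simp add: N_def)
      then have "fourier (s k) m = c m" unfolding s_def by (simp only: fourier_combination[OF finite_lessThan] if_True)
      moreover have "fourier (\<lambda>x. f x - s k x) m = fourier f m - fourier (s k) m"
        by (intro fourier_diff s_sq) (simp add: f)
      ultimately have "(fourier f m - c m)\<^sup>2 = (fourier (\<lambda>x. f x - s k x) m)\<^sup>2" by simp
      also have "\<dots> \<le> (LINT x|M. (f x - s k x)\<^sup>2)"
        by (intro fourier_sq_le square_integrable_diff s_sq) (simp add: f)
      also have "\<dots> \<le> (1/4) ^ k" by (rule f_dist)
      finally show ?thesis .
    qed
    have "(\<lambda>k. (1/4 :: real) ^ k) \<longlonglongrightarrow> 0" by (rule LIMSEQ_realpow_zero) auto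
    then have "(fourier f m - c m)\<^sup>2 \<le> 0"
      by (rule LIMSEQ_le_const) (intro exI[of _ "Suc m"] allI impI le)
    then show ?thesis by simp
  qed
  then show ?thesis using f by auto
qed

text \<open>By completeness \<open>f\<close> agrees almost everywhere with the function that \<open>riesz_fischer\<close> builds from its
coefficients.\<close>

lemma parseval_le:
  assumes f: "square_integrable M f" and C: "\<And>N. (\<Sum>n<N. (fourier f n)\<^sup>2) \<le> C"
  shows "(LINT x|M. (f x)\<^sup>2) \<le> C"
proof -
  obtain g where g: "square_integrable M g" "\<And>n. fourier g n = fourier f n" "(LINT x|M. (g x)\<^sup>2) \<le> C"
    using riesz_fischer[OF C] by auto
  have "fourier (\<lambda>x. f x - g x) n = 0" for n
    using f g by (simp add: fourier_diff)
  then have "AE x in M. f x - g x = 0"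
    by (intro AE_zero_if_fourier_zero square_integrable_diff f g(1))
  then have "(LINT x|M. (f x)\<^sup>2) = (LINT x|M. (g x)\<^sup>2)"
    using f g(1) by (intro integral_cong_AE) (auto simp: square_integrable_def)
  then show ?thesis using g by simp
qed

end

section \<open>Words and the coding map\<close>

context self_similar_structure
begin

lemma Fw_Nil [simp]: "Fw [] = id"
  by (simp add: Fw_def fun_eq_iff)

lemma Fw_Cons [simp]: "Fw (i # w) = F i \<circ> Fw w"
  by (simp add: Fw_def fun_eq_iff)

lemma Fw_append: "Fw (v @ w) = Fw v \<circ> Fw w"
  by (simp add: Fw_def fun_eq_iff)

lemma Fw_in_K: "set w \<subseteq> S \<Longrightarrow> x \<in> K \<Longrightarrow> Fw w x \<in> K"
  by (induction w) (use F_maps in auto)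

lemma V0_subset_K: "V0 \<subseteq> K" by (auto simp: V0_def)

lemma Fw_V0_in_K: "set w \<subseteq> S \<Longrightarrow> p \<in> V0 \<Longrightarrow> Fw w p \<in> K"
  using Fw_in_K V0_subset_K by blast

text \<open>A common point of two cells is critical by definition. This is what makes a function that
is constant on each cell well defined once it is consistent on the boundary points of the cells.\<close>

lemma cells_meet_in_V0:
  assumes "i \<in> S" "j \<in> S" "i \<noteq> j" "x \<in> K" "y \<in> K" "F i x = F j y"
  shows "x \<in> V0"
proof -
  have "F i x \<in> F i ` K" "F i x \<in> F j ` K" using imageI[OF assms(4), of "F i"] imageI[OF assms(5), of "F j"] by (simp_all add: assms(6))
  then have "F i x \<in> critical_set" unfolding critical_set_def using assms by blast
  then show ?thesis using assms unfolding V0_def by (intro CollectI conjI exI[of _ "[i]"]) auto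
qed

lemma pi_in_K: "\<omega> \<in> UNIV \<rightarrow> S \<Longrightarrow> \<pi> \<omega> \<in> K"
  using pi_surj by blast

lemma K_eq_cells: "K = (\<Union>i\<in>S. F i ` K)"
proof
  show "K \<subseteq> (\<Union>i\<in>S. F i ` K)"
  proof
    fix x assume "x \<in> K"
    then obtain \<omega> where w: "\<omega> \<in> UNIV \<rightarrow> S" "x = \<pi> \<omega>" using pi_surj by blast
    have "case_nat (\<omega> 0) (\<lambda>n. \<omega> (Suc n)) = \<omega>" by (auto simp: fun_eq_iff split: nat.split)
    moreover have "(\<lambda>n. \<omega> (Suc n)) \<in> UNIV \<rightarrow> S" "\<omega> 0 \<in> S" using w by auto
    ultimately have "x = F (\<omega> 0) (\<pi> (\<lambda>n. \<omega> (Suc n)))" using pi_shift w by metis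
    then show "x \<in> (\<Union>i\<in>S. F i ` K)"
      using \<open>\<omega> 0 \<in> S\<close> pi_in_K[OF \<open>(\<lambda>n. \<omega> (Suc n)) \<in> UNIV \<rightarrow> S\<close>] by blast
  qed
qed (use F_maps in blast)

text \<open>The critical set is reached from \<open>q\<close> by one letter more than from \<open>p\<close>.\<close>

lemma V0_subset_V1:
  assumes "p \<in> V0"
  shows "\<exists>i\<in>S. \<exists>q\<in>V0. p = F i q"
proof -
  have "p \<in> K" using assms V0_subset_K by blast
  then obtain i q where iq: "i \<in> S" "q \<in> K" "p = F i q" using K_eq_cells by blast
  obtain w where w: "set w \<subseteq> S" "w \<noteq> []" "Fw w p \<in> critical_set" using assms by (auto simp: V0_def)
  have "q \<in> V0" unfolding V0_def
    using iq w by (intro CollectI conjI exI[of _ "w @ [i]"]) (auto simp: Fw_append)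
  then show ?thesis using iq by blast
qed

definition word_prefix :: "nat \<Rightarrow> (nat \<Rightarrow> 'i) \<Rightarrow> 'i list" where
  "word_prefix m \<omega> = map \<omega> [0..<m]"

lemma word_prefix_0 [simp]: "word_prefix 0 \<omega> = []"
  by (simp add: word_prefix_def)

lemma word_prefix_Suc: "word_prefix (Suc m) \<omega> = word_prefix m \<omega> @ [\<omega> m]"
  by (simp add: word_prefix_def)

lemma length_prefix [simp]: "length (word_prefix m \<omega>) = m"
  by (simp add: word_prefix_def)

lemma set_prefix: "\<omega> \<in> UNIV \<rightarrow> S \<Longrightarrow> set (word_prefix m \<omega>) \<subseteq> S"
  by (auto simp: word_prefix_def)

lemma pi_append:
  assumes "set w \<subseteq> S" "\<eta> \<in> UNIV \<rightarrow> S"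
  shows "Fw w (\<pi> \<eta>) = \<pi> (\<lambda>n. if n < length w then w ! n else \<eta> (n - length w))"
  using assms(1)
proof (induction w)
  case (Cons i w)
  let ?e = "\<lambda>n. if n < length w then w ! n else \<eta> (n - length w)"
  have "?e \<in> UNIV \<rightarrow> S" using Cons.prems assms(2) by (auto simp: Pi_iff subset_iff)
  then have "F i (\<pi> ?e) = \<pi> (case_nat i ?e)" using Cons.prems pi_shift[of i ?e] by simp
  moreover have "case_nat i ?e = (\<lambda>n. if n < length (i # w) then (i # w) ! n else \<eta> (n - length (i # w)))"
    by (auto simp: fun_eq_iff split: nat.split)
  ultimately show ?case using Cons by simp
qed simp

text \<open>Continuity of the coding map for the product topology, in terms of finite words.\<close>

lemma prefix_agree_on_open:
  assumes \<omega>: "\<omega> \<in> UNIV \<rightarrow> S" and U: "open U" "\<pi> \<omega> \<in> U"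
  shows "\<exists>m. \<forall>\<eta>\<in>UNIV \<rightarrow> S. (\<forall>n<m. \<eta> n = \<omega> n) \<longrightarrow> \<pi> \<eta> \<in> U"
proof -
  let ?X = "product_topology (\<lambda>_::nat. discrete_topology S) UNIV"
  have top: "topspace ?X = UNIV \<rightarrow> S" by (auto simp: PiE_def)
  have "openin ?X {\<eta> \<in> topspace ?X. \<pi> \<eta> \<in> K \<inter> U}"
    using U by (intro openin_continuous_map_preimage[OF pi_continuous]) auto
  moreover have "\<omega> \<in> {\<eta> \<in> topspace ?X. \<pi> \<eta> \<in> K \<inter> U}"
    using \<omega> U pi_in_K unfolding top by auto
  ultimately obtain V where V: "finite {i. V i \<noteq> topspace (discrete_topology S)}"
      "\<omega> \<in> Pi\<^sub>E UNIV V" "Pi\<^sub>E UNIV V \<subseteq> {\<eta> \<in> topspace ?X. \<pi> \<eta> \<in> K \<inter> U}"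
    unfolding openin_product_topology_alt by (auto 0 3)
  obtain m where m: "\<And>i. V i \<noteq> S \<Longrightarrow> i < m"
    using V(1) unfolding finite_nat_set_iff_bounded by auto
  show ?thesis
  proof (intro exI[of _ m] ballI impI)
    fix \<eta> assume \<eta>: "\<eta> \<in> UNIV \<rightarrow> S" "\<forall>n<m. \<eta> n = \<omega> n"
    have "\<eta> n \<in> V n" for n
      using m[of n] \<eta> V(2) by (cases "n < m") (auto simp: PiE_def Pi_def)
    then show "\<pi> \<eta> \<in> U" using V(3) by (auto simp: PiE_def)
  qed
qed

lemma Fw_prefix_tendsto:
  assumes \<omega>: "\<omega> \<in> UNIV \<rightarrow> S" and p: "p \<in> K"
  shows "(\<lambda>m. Fw (word_prefix m \<omega>) p) \<longlonglongrightarrow> \<pi> \<omega>"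
proof (rule topological_tendstoI)
  fix U assume U: "open U" "\<pi> \<omega> \<in> U"
  obtain \<eta> where \<eta>: "\<eta> \<in> UNIV \<rightarrow> S" "p = \<pi> \<eta>" using p pi_surj by blast
  obtain m where m: "\<And>\<zeta>. \<zeta> \<in> UNIV \<rightarrow> S \<Longrightarrow> (\<And>n. n < m \<Longrightarrow> \<zeta> n = \<omega> n) \<Longrightarrow> \<pi> \<zeta> \<in> U"
    using prefix_agree_on_open[OF \<omega> U] by blast
  have "Fw (word_prefix k \<omega>) p \<in> U" if "m \<le> k" for k
    unfolding \<eta>(2) pi_append[OF set_prefix[OF \<omega>] \<eta>(1)]
    using that \<omega> \<eta> by (intro m) (auto simp: word_prefix_def Pi_iff)
  then show "\<forall>\<^sub>F k in sequentially. Fw (word_prefix k \<omega>) p \<in> U"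
    by (auto simp: eventually_sequentially)
qed

end

section \<open>The self-similar measure\<close>

context regular_harmonic_structure
begin

lemma two_cells: "\<exists>i\<in>S. \<exists>j\<in>S. i \<noteq> j"
  using pcf(2) by (auto simp: V0_def critical_set_def)

lemma sim_dim_sum: "(\<Sum>i\<in>S. r i powr sim_dim) = 1"
proof -
  define h where "h = (\<lambda>d. \<Sum>i\<in>S. r i powr d)"
  obtain i j where ij: "i \<in> S" "j \<in> S" "i \<noteq> j" using two_cells by blast
  have cont: "continuous_on A h" for A
    unfolding h_def using r_regular by (intro continuous_intros) force
  have less: "h d' < h d" if "d < d'" for d d'
    unfolding h_def using that r_regular ij finite_S
    by (intro sum_strict_mono) (auto simp: powr_less_mono')
  have "card {i, j} \<le> card S" using ij finite_S by (intro card_mono) auto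
  moreover have "h 0 = (\<Sum>i\<in>S. 1)"
    unfolding h_def using r_regular by (intro sum.cong) force+
  ultimately have "1 \<le> h 0" using ij by simp
  have "((\<lambda>d. r i powr d) \<longlongrightarrow> 0) at_top" if "i \<in> S" for i
    using r_regular[OF that] by real_asymp
  then have "(h \<longlongrightarrow> 0) at_top" unfolding h_def by (intro tendsto_null_sum)
  then have "eventually (\<lambda>d. h d < 1 \<and> 0 \<le> d) at_top"
    by (intro eventually_conj order_tendstoD(2)[where a = 1] eventually_ge_at_top) auto
  then obtain b where b: "h b < 1" "0 \<le> b" by (auto simp: eventually_at_top_linorder)
  obtain d where d: "h d = 1"
    using IVT2'[of h b 1 0] b \<open>1 \<le> h 0\<close> cont by auto
  have "d' = d" if "h d' = 1" for d'
    using less[of d d'] less[of d' d] that d by force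
  then have "(THE d. h d = 1) = d" using d by blast
  then have "sim_dim = d" unfolding sim_dim_def h_def .
  then show ?thesis using d by (simp add: h_def)
qed

definition letter_measure :: "'i measure" where
  "letter_measure = point_measure S (\<lambda>i. ennreal (r i powr sim_dim))"

definition word_measure :: "(nat \<Rightarrow> 'i) measure" where
  "word_measure = Pi\<^sub>M UNIV (\<lambda>_. letter_measure)"

lemma mu_eq: "mu = distr word_measure (restrict_space borel K) \<pi>"
  by (simp add: mu_def word_measure_def letter_measure_def)

lemma prob_space_letter_measure: "prob_space letter_measure"
  unfolding letter_measure_def
  by (rule prob_spaceI)
    (simp add: emeasure_point_measure_finite finite_S sum_ennreal sim_dim_sum space_point_measure)

lemma space_word_measure: "space word_measure = UNIV \<rightarrow> S"
  by (simp add: word_measure_def space_PiM letter_measure_def space_point_measure PiE_def)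

definition cylinder :: "'i list \<Rightarrow> (nat \<Rightarrow> 'i) set" where
  "cylinder w = {\<eta> \<in> UNIV \<rightarrow> S. word_prefix (length w) \<eta> = w}"

lemma cylinder_iff: "\<eta> \<in> cylinder w \<longleftrightarrow> \<eta> \<in> UNIV \<rightarrow> S \<and> (\<forall>n<length w. \<eta> n = w ! n)"
proof -
  have "word_prefix (length w) \<eta> = w \<longleftrightarrow> (\<forall>n<length w. word_prefix (length w) \<eta> ! n = w ! n)"
    unfolding list_eq_iff_nth_eq[of "word_prefix (length w) \<eta>"] length_prefix by blast
  then show ?thesis unfolding cylinder_def by (auto simp: word_prefix_def)
qed

lemma emeasure_cylinder:
  assumes "set w \<subseteq> S"
  shows "cylinder w \<in> sets word_measure" "0 < emeasure word_measure (cylinder w)"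
proof -
  interpret prob_space letter_measure by (rule prob_space_letter_measure)
  interpret product_prob_space "\<lambda>_::nat. letter_measure" UNIV ..
  let ?J = "{..<length w}"
  have eq: "cylinder w = prod_emb UNIV (\<lambda>_. letter_measure) ?J (Pi\<^sub>E ?J (\<lambda>n. {w ! n}))"
  proof (rule set_eqI)
    fix \<eta>
    have "\<eta> \<in> prod_emb UNIV (\<lambda>_. letter_measure) ?J (Pi\<^sub>E ?J (\<lambda>n. {w ! n})) \<longleftrightarrow>
        \<eta> \<in> UNIV \<rightarrow> S \<and> (\<forall>n<length w. \<eta> n = w ! n)"
      unfolding prod_emb_def letter_measure_def space_point_measure PiE_def Pi_iff by force
    then show "\<eta> \<in> cylinder w \<longleftrightarrow> \<eta> \<in> prod_emb UNIV (\<lambda>_. letter_measure) ?J (Pi\<^sub>E ?J (\<lambda>n. {w ! n}))"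
      by (simp only: cylinder_iff)
  qed
  have in_S: "w ! n \<in> S" if "n \<in> ?J" for n
    using that by (intro subsetD[OF assms] nth_mem) simp
  have sets: "{w ! n} \<in> sets letter_measure" if "n \<in> ?J" for n
    using in_S[OF that] by (simp add: letter_measure_def sets_point_measure)
  show "cylinder w \<in> sets word_measure"
    unfolding eq word_measure_def by (rule sets_PiM_I) (use sets in simp_all)
  have "emeasure word_measure (cylinder w) = (\<Prod>n\<in>?J. emeasure letter_measure {w ! n})"
    unfolding eq word_measure_def by (rule emeasure_PiM_emb) (use sets in simp_all)
  also have "\<dots> = (\<Prod>n\<in>?J. ennreal (r (w ! n) powr sim_dim))"
  proof (rule prod.cong)
    fix n assume "n \<in> ?J"
    then have "w ! n \<in> S" by (rule in_S)
    then show "emeasure letter_measure {w ! n} = ennreal (r (w ! n) powr sim_dim)"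
      unfolding letter_measure_def by (subst emeasure_point_measure_finite) (auto simp: finite_S)
  qed simp
  also have "\<dots> \<noteq> 0"
  proof -
    have "0 < r (w ! n) powr sim_dim" if "n \<in> ?J" for n
      using r_regular[OF in_S[OF that]] by simp
    then have "0 < (\<Prod>n\<in>?J. r (w ! n) powr sim_dim)" by (intro prod_pos) simp
    then have "ennreal (\<Prod>n\<in>?J. r (w ! n) powr sim_dim) \<noteq> 0" by (metis ennreal_eq_0_iff not_le)
    then show ?thesis by (subst prod_ennreal) simp_all
  qed
  finally show "0 < emeasure word_measure (cylinder w)" unfolding zero_less_iff_neq_zero .
qed

lemma cylinder_subset_vimage:
  assumes "\<omega> \<in> UNIV \<rightarrow> S" "open U" "\<pi> \<omega> \<in> U"
  obtains w where "set w \<subseteq> S" "\<omega> \<in> cylinder w" "cylinder w \<subseteq> \<pi> -` U"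
proof -
  obtain m where m: "\<And>\<eta>. \<eta> \<in> UNIV \<rightarrow> S \<Longrightarrow> (\<And>n. n < m \<Longrightarrow> \<eta> n = \<omega> n) \<Longrightarrow> \<pi> \<eta> \<in> U"
    using prefix_agree_on_open[OF assms] by blast
  show thesis
  proof (rule that[of "word_prefix m \<omega>"])
    show "set (word_prefix m \<omega>) \<subseteq> S" by (rule set_prefix[OF assms(1)])
    show "\<omega> \<in> cylinder (word_prefix m \<omega>)" using assms(1) by (simp add: cylinder_def)
    show "cylinder (word_prefix m \<omega>) \<subseteq> \<pi> -` U"
    proof
      fix \<eta> assume "\<eta> \<in> cylinder (word_prefix m \<omega>)"
      then have "\<eta> \<in> UNIV \<rightarrow> S" "\<And>n. n < m \<Longrightarrow> \<eta> n = \<omega> n"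
        unfolding cylinder_iff length_prefix by (simp_all add: word_prefix_def)
      then show "\<eta> \<in> \<pi> -` U" using m by simp
    qed
  qed
qed

text \<open>The preimage of an open set is a union of cylinders, and there are only countably many words.\<close>

lemma pi_measurable: "\<pi> \<in> measurable word_measure (restrict_space borel K)"
proof (rule measurable_restrict_space2)
  show "\<pi> \<in> space word_measure \<rightarrow> K"
    using pi_in_K by (simp add: space_word_measure Pi_iff)
  show "\<pi> \<in> borel_measurable word_measure"
  proof (rule borel_measurableI)
    fix U :: "'a set" assume U: "open U"
    have "\<pi> -` U \<inter> space word_measure = (\<Union>w\<in>{w \<in> lists S. cylinder w \<subseteq> \<pi> -` U}. cylinder w)"
    proof (intro equalityI subsetI)
      fix \<omega>
      show "\<omega> \<in> (\<Union>w\<in>{w \<in> lists S. cylinder w \<subseteq> \<pi> -` U}. cylinder w)"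
        if "\<omega> \<in> \<pi> -` U \<inter> space word_measure"
      proof -
        have "\<omega> \<in> \<pi> -` U \<inter> space word_measure" by (rule that)
        then have \<omega>: "\<omega> \<in> UNIV \<rightarrow> S" "\<pi> \<omega> \<in> U" by (auto simp: space_word_measure)
        obtain w where "set w \<subseteq> S" "\<omega> \<in> cylinder w" "cylinder w \<subseteq> \<pi> -` U"
          using cylinder_subset_vimage[OF \<omega>(1) U \<omega>(2)] .
        then show ?thesis by (intro UN_I[of w]) (auto simp: lists_eq_set)
      qed
    next
      fix \<omega> assume "\<omega> \<in> (\<Union>w\<in>{w \<in> lists S. cylinder w \<subseteq> \<pi> -` U}. cylinder w)"
      then show "\<omega> \<in> \<pi> -` U \<inter> space word_measure"
        by (auto simp: space_word_measure cylinder_def)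
    qed
    moreover have "countable {w \<in> lists S. cylinder w \<subseteq> \<pi> -` U}"
      using finite_S by (intro countable_subset[OF _ countable_lists[of S]]) (auto intro: countable_finite)
    ultimately show "\<pi> -` U \<inter> space word_measure \<in> sets word_measure"
      by (auto intro!: sets.countable_UN' emeasure_cylinder(1))
  qed
qed

lemma prob_space_mu: "prob_space mu"
proof -
  interpret prob_space letter_measure by (rule prob_space_letter_measure)
  have "prob_space word_measure"
    unfolding word_measure_def by (rule prob_space_PiM) (rule prob_space_letter_measure)
  then show ?thesis unfolding mu_eq by (rule prob_space.prob_space_distr) (rule pi_measurable)
qed

lemma space_mu [simp]: "space mu = K"
  by (simp add: mu_eq space_restrict_space)

lemma sets_mu: "sets mu = sets (restrict_space borel K)"
  by (simp add: mu_eq)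

lemma continuous_imp_measurable:
  "continuous_on K f \<Longrightarrow> f \<in> borel_measurable mu"
  using borel_measurable_continuous_on_restrict[of K f] measurable_cong_sets[OF sets_mu refl] by auto

lemma bounded_square_integrable:
  assumes "f \<in> borel_measurable mu" "\<And>x. x \<in> K \<Longrightarrow> \<bar>f x\<bar> \<le> B"
  shows "square_integrable mu f"
proof -
  interpret prob_space mu by (rule prob_space_mu)
  have "AE x in mu. norm ((f x)\<^sup>2) \<le> B\<^sup>2"
    using power_mono[OF assms(2) abs_ge_zero, of _ 2] by (intro AE_I2) simp
  then have "integrable mu (\<lambda>x. (f x)\<^sup>2)"
    by (rule integrable_const_bound) (use assms(1) in measurable)
  then show ?thesis
    using assms(1) by (simp add: square_integrable_def)
qed

lemma integral_square_le:
  fixes f :: "'a \<Rightarrow> real"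
  assumes "f \<in> borel_measurable mu" "\<And>x. x \<in> K \<Longrightarrow> \<bar>f x\<bar> \<le> B"
  shows "(LINT x|mu. (f x)\<^sup>2) \<le> B\<^sup>2"
proof -
  interpret prob_space mu by (rule prob_space_mu)
  have "(LINT x|mu. (f x)\<^sup>2) \<le> (LINT x|mu. B\<^sup>2)"
  proof (rule Bochner_Integration.integral_mono)
    show "integrable mu (\<lambda>x. (f x)\<^sup>2)"
      using bounded_square_integrable[OF assms] by (simp add: square_integrable_def)
    show "(f x)\<^sup>2 \<le> B\<^sup>2" if "x \<in> space mu" for x
      using power_mono[OF assms(2) abs_ge_zero, of x 2] that by simp
  qed simp
  then show ?thesis using prob_space[unfolded space_mu] by simp
qed

lemma continuous_bounded:
  fixes f :: "'a \<Rightarrow> real"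
  assumes "continuous_on K f"
  obtains B where "\<And>x. x \<in> K \<Longrightarrow> \<bar>f x\<bar> \<le> B"
  using compact_imp_bounded[OF compact_continuous_image[OF assms compact_K]]
  by (auto simp: bounded_iff)

lemma continuous_square_integrable:
  assumes "continuous_on K f"
  shows "square_integrable mu f"
proof -
  obtain B where "\<And>x. x \<in> K \<Longrightarrow> \<bar>f x\<bar> \<le> B" using continuous_bounded[OF assms] by blast
  then show ?thesis by (rule bounded_square_integrable[OF continuous_imp_measurable[OF assms]])
qed

text \<open>The measure has full support, since every nonempty relatively open set contains the image of a cylinder,
and cylinders have positive mass.\<close>

lemma AE_le_imp_le:
  assumes f: "continuous_on K f" and ae: "AE x in mu. f x \<le> (c::real)" and x: "x \<in> K"
  shows "f x \<le> c"
proof (rule ccontr)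
  assume "\<not> f x \<le> c"
  obtain \<omega> where \<omega>: "\<omega> \<in> UNIV \<rightarrow> S" "x = \<pi> \<omega>" using x pi_surj by blast
  obtain U where U: "open U" "U \<inter> K = f -` {c<..} \<inter> K"
    using f open_greaterThan[of c] unfolding continuous_on_open_invariant by blast
  have "x \<in> U \<inter> K" unfolding U(2) using x \<open>\<not> f x \<le> c\<close> by simp
  then have "\<pi> \<omega> \<in> U" using \<omega> by simp
  from cylinder_subset_vimage[OF \<omega>(1) U(1) this]
  obtain w where w: "set w \<subseteq> S" "cylinder w \<subseteq> \<pi> -` U" .
  have meas: "K \<inter> U \<in> sets (restrict_space borel K)"
    using U(1) by (auto simp: sets_restrict_space)
  have "emeasure word_measure (cylinder w) \<le> emeasure word_measure (\<pi> -` (K \<inter> U) \<inter> space word_measure)"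
  proof (rule emeasure_mono)
    show "cylinder w \<subseteq> \<pi> -` (K \<inter> U) \<inter> space word_measure"
      using w(2) pi_in_K by (auto simp: space_word_measure cylinder_def)
  qed (rule measurable_sets[OF pi_measurable meas])
  also have "\<dots> = emeasure mu (K \<inter> U)"
    unfolding mu_eq by (rule emeasure_distr[symmetric, OF pi_measurable meas])
  also have "\<dots> = 0"
  proof -
    have "{y \<in> space mu. \<not> f y \<le> c} = U \<inter> K" unfolding U(2) by (auto simp: not_le)
    then show ?thesis
      using ae AE_iff_measurable[of "K \<inter> U" mu "\<lambda>y. f y \<le> c"] meas
      by (simp add: sets_mu Int_commute)
  qed
  finally show False using emeasure_cylinder(2)[OF w(1)] by simp
qed

lemma AE_zero_imp_zero:
  assumes f: "continuous_on K f" and ae: "AE x in mu. f x = (0::real)" and x: "x \<in> K"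
  shows "f x = 0"
proof (rule antisym)
  have "AE x in mu. f x \<le> 0" using ae by eventually_elim simp
  then show "f x \<le> 0" by (rule AE_le_imp_le[OF f _ x])
  have "AE x in mu. - f x \<le> 0" using ae by eventually_elim simp
  then have "- f x \<le> 0" by (rule AE_le_imp_le[OF continuous_on_minus[OF f] _ x])
  then show "0 \<le> f x" by simp
qed

end

section \<open>Discrete energies and the Dirichlet form\<close>

context regular_harmonic_structure
begin

lemma D_row_sum: "p \<in> V0 \<Longrightarrow> (\<Sum>q\<in>V0. D p q) = 0"
  using D_kernel[of "\<lambda>_. 1"] by auto

lemma D_col_sum: "q \<in> V0 \<Longrightarrow> (\<Sum>p\<in>V0. D p q) = 0"
  using D_row_sum[of q] D_sym by (metis (no_types, lifting) sum.cong)

lemma energy0_sym: "energy0 u v = energy0 v u"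
proof -
  have "(\<Sum>p\<in>V0. \<Sum>q\<in>V0. u p * D p q * v q) = (\<Sum>q\<in>V0. \<Sum>p\<in>V0. u p * D p q * v q)"
    by (rule sum.swap)
  also have "\<dots> = (\<Sum>q\<in>V0. \<Sum>p\<in>V0. v q * D q p * u p)"
    using D_sym by (intro sum.cong) auto
  finally show ?thesis by (simp add: energy0_def)
qed

lemma energy0_linear: "energy0 (\<lambda>x. a * u x + b * v x) g = a * energy0 u g + b * energy0 v g"
  by (simp add: energy0_def sum.distrib sum_distrib_left algebra_simps)

lemma energy0_nonneg: "0 \<le> energy0 u u"
  using D_nonpos[of u] by (simp add: energy0_def)

lemma energy0_const:
  assumes "\<And>p. p \<in> V0 \<Longrightarrow> u p = c"
  shows "energy0 u v = 0"
proof -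
  have "(\<Sum>p\<in>V0. \<Sum>q\<in>V0. u p * D p q * v q) = (\<Sum>p\<in>V0. \<Sum>q\<in>V0. c * D p q * v q)"
    using assms by (intro sum.cong) auto
  also have "\<dots> = (\<Sum>q\<in>V0. \<Sum>p\<in>V0. c * D p q * v q)" by (rule sum.swap)
  also have "\<dots> = (\<Sum>q\<in>V0. c * v q * (\<Sum>p\<in>V0. D p q))"
    by (simp add: sum_distrib_left mult_ac)
  also have "\<dots> = 0" by (simp add: D_col_sum)
  finally show ?thesis by (simp add: energy0_def)
qed

text \<open>As rows and columns of \<open>D\<close> sum to zero, the form is that of an electrical network with
conductances \<open>D p q\<close>.\<close>

lemma energy0_differences: "energy0 u u = (\<Sum>p\<in>V0. \<Sum>q\<in>V0. D p q * (u p - u q)\<^sup>2) / 2"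
proof -
  have "(\<Sum>p\<in>V0. \<Sum>q\<in>V0. D p q * (u p - u q)\<^sup>2)
      = (\<Sum>p\<in>V0. \<Sum>q\<in>V0. D p q * (u p)\<^sup>2) + (\<Sum>p\<in>V0. \<Sum>q\<in>V0. D p q * (u q)\<^sup>2)
        - 2 * (\<Sum>p\<in>V0. \<Sum>q\<in>V0. u p * D p q * u q)"
    by (simp add: power2_eq_square sum.distrib sum_subtractf sum_distrib_left algebra_simps)
  moreover have "(\<Sum>p\<in>V0. \<Sum>q\<in>V0. D p q * (u p)\<^sup>2) = 0"
    by (simp add: sum_distrib_right[symmetric] D_row_sum)
  moreover have "(\<Sum>p\<in>V0. \<Sum>q\<in>V0. D p q * (u q)\<^sup>2) = 0"
    by (subst sum.swap) (simp add: sum_distrib_right[symmetric] D_col_sum)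
  ultimately show ?thesis by (simp add: energy0_def)
qed

lemma energy0_edge:
  assumes "p \<in> V0" "q \<in> V0"
  shows "D p q * (u p - u q)\<^sup>2 \<le> 2 * energy0 u u"
proof -
  have nonneg: "0 \<le> D p' q' * (u p' - u q')\<^sup>2" if "p' \<in> V0" "q' \<in> V0" for p' q'
    using D_offdiag[OF that] by (cases "p' = q'") auto
  have "D p q * (u p - u q)\<^sup>2 \<le> (\<Sum>q\<in>V0. D p q * (u p - u q)\<^sup>2)"
    by (rule member_le_sum[where f = "\<lambda>q. D p q * (u p - u q)\<^sup>2"]) (use assms nonneg pcf in auto)
  also have "\<dots> \<le> (\<Sum>p\<in>V0. \<Sum>q\<in>V0. D p q * (u p - u q)\<^sup>2)"
    by (rule member_le_sum[where f = "\<lambda>p. \<Sum>q\<in>V0. D p q * (u p - u q)\<^sup>2"])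
      (use assms nonneg pcf in \<open>auto intro!: sum_nonneg\<close>)
  finally show ?thesis by (simp add: energy0_differences)
qed

text \<open>The network on the boundary is connected: a function constant along its edges is annihilated by \<open>D\<close>.\<close>

lemma constant_if_constant_on_edges:
  assumes edge: "\<And>p q. p \<in> V0 \<Longrightarrow> q \<in> V0 \<Longrightarrow> 0 < D p q \<Longrightarrow> v p = v q"
    and pq: "p \<in> V0" "q \<in> V0"
  shows "v p = (v q :: real)"
proof -
  have "(\<Sum>q\<in>V0. D p q * v q) = 0" if p: "p \<in> V0" for p
  proof -
    have "D p q * v q = D p q * v p" if q: "q \<in> V0" for q
      using edge[OF p q] D_offdiag[OF p q] by (cases "p = q"; cases "D p q = 0") auto
    then have "(\<Sum>q\<in>V0. D p q * v q) = (\<Sum>q\<in>V0. D p q) * v p"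
      unfolding sum_distrib_right by (rule sum.cong[OF refl])
    then show ?thesis by (simp add: D_row_sum p)
  qed
  then obtain c where "\<forall>p\<in>V0. v p = c" using D_kernel[of v] by blast
  then show ?thesis using pq by simp
qed

lemma finite_words: "finite (words m)"
  unfolding words_def by (rule finite_lists_length_eq[OF finite_S])

lemma rw_pos: "set w \<subseteq> S \<Longrightarrow> 0 < rw w"
  by (induction w) (use r_regular in \<open>auto simp: rw_def\<close>)

lemma words_set: "w \<in> words m \<Longrightarrow> set w \<subseteq> S"
  by (simp add: words_def)

lemma energy_m_1: "energy_m 1 u v = (\<Sum>i\<in>S. inverse (r i) * energy0 (u \<circ> F i) (v \<circ> F i))"
proof -
  have "words 1 = (\<lambda>i. [i]) ` S" by (auto simp: words_def length_Suc_conv)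
  then show ?thesis by (simp add: energy_m_def rw_def sum.reindex inj_on_def)
qed

lemma energy_m_Suc:
  "energy_m (Suc m) u v = (\<Sum>w\<in>words m. inverse (rw w) * energy_m 1 (u \<circ> Fw w) (v \<circ> Fw w))"
proof -
  have words: "words (Suc m) = (\<lambda>(w, i). w @ [i]) ` (words m \<times> S)"
  proof (intro equalityI subsetI)
    fix w assume "w \<in> words (Suc m)"
    then have w: "set w \<subseteq> S" "length w = Suc m" by (auto simp: words_def)
    then obtain w' i where wi: "w = w' @ [i]" by (cases w rule: rev_cases) auto
    then have "(w', i) \<in> words m \<times> S" using w by (auto simp: words_def)
    then show "w \<in> (\<lambda>(w, i). w @ [i]) ` (words m \<times> S)" unfolding wi by (rule rev_image_eqI) simp
  qed (auto simp: words_def)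
  have inj: "inj_on (\<lambda>(w, i). w @ [i]) (words m \<times> S)" by (auto simp: inj_on_def)
  have "energy_m (Suc m) u v = (\<Sum>(w, i)\<in>words m \<times> S.
      inverse (rw (w @ [i])) * energy0 (u \<circ> Fw (w @ [i])) (v \<circ> Fw (w @ [i])))"
    unfolding energy_m_def words by (subst sum.reindex[OF inj]) (simp add: case_prod_unfold)
  also have "\<dots> = (\<Sum>w\<in>words m. \<Sum>i\<in>S. inverse (rw w) * (inverse (r i) * energy0 (u \<circ> Fw w \<circ> F i) (v \<circ> Fw w \<circ> F i)))"
    by (simp add: sum.cartesian_product rw_def Fw_append comp_assoc mult_ac)
  also have "\<dots> = (\<Sum>w\<in>words m. inverse (rw w) * energy_m 1 (u \<circ> Fw w) (v \<circ> Fw w))"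
    by (simp only: energy_m_1 sum_distrib_left)
  finally show ?thesis .
qed

lemma energy_m_sym: "energy_m m u v = energy_m m v u"
  by (simp add: energy_m_def energy0_sym[of "u \<circ> _"])

lemma energy_m_linear: "energy_m m (\<lambda>x. a * u x + b * v x) g = a * energy_m m u g + b * energy_m m v g"
  by (simp add: energy_m_def comp_def energy0_linear sum.distrib sum_distrib_left algebra_simps)

lemma energy_m_nonneg: "0 \<le> energy_m m u u"
  unfolding energy_m_def
  by (intro sum_nonneg mult_nonneg_nonneg energy0_nonneg) (use rw_pos words_set in \<open>force simp: less_imp_le\<close>)

text \<open>In each cell the coarser energy is the minimum of the finer one over all extensions.\<close>

lemma energy_m_mono_Suc: "energy_m m u u \<le> energy_m (Suc m) u u"
proof -
  have "energy0 (u \<circ> Fw w) (u \<circ> Fw w) \<le> energy_m 1 (u \<circ> Fw w) (u \<circ> Fw w)" for w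
    using energy_min[of "u \<circ> Fw w"] by blast
  moreover have "0 \<le> inverse (rw w)" if "w \<in> words m" for w
    using rw_pos[OF words_set[OF that]] by simp
  ultimately show ?thesis
    unfolding energy_m_Suc energy_m_def[of m] by (intro sum_mono mult_left_mono)
qed

lemma energy_m_incseq: "incseq (\<lambda>m. energy_m m u u)"
  by (rule incseq_SucI) (rule energy_m_mono_Suc)

text \<open>The contribution of one cell of level \<open>m\<close>; the factor \<open>rw w\<close> makes it decay geometrically in \<open>m\<close>, which
drives the chaining argument for the sup bound.\<close>

lemma energy_m_cell:
  assumes "w \<in> words m"
  shows "energy_m 1 (u \<circ> Fw w) (u \<circ> Fw w) \<le> rw w * energy_m (Suc m) u u"
proof -
  have pos: "0 < rw w'" if "w' \<in> words m" for w' using that by (intro rw_pos words_set)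
  have "inverse (rw w) * energy_m 1 (u \<circ> Fw w) (u \<circ> Fw w) \<le> energy_m (Suc m) u u"
    unfolding energy_m_Suc
    by (rule member_le_sum[where f = "\<lambda>w. inverse (rw w) * energy_m 1 (u \<circ> Fw w) (u \<circ> Fw w)"])
      (use assms pos finite_words in \<open>auto intro!: mult_nonneg_nonneg energy_m_nonneg simp: less_imp_le\<close>)
  then show ?thesis using pos[OF assms] by (simp add: field_simps)
qed

lemma form_dom_bounded:
  assumes "continuous_on K u" "\<And>m. energy_m m u u \<le> C"
  shows "u \<in> form_dom"
proof -
  obtain L where "(\<lambda>m. energy_m m u u) \<longlonglongrightarrow> L"
    using incseq_convergent[OF energy_m_incseq] assms(2) by blast
  then show ?thesis using assms(1) by (auto simp: form_dom_def convergent_def)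
qed

lemma energy_m_le_energy: "u \<in> form_dom \<Longrightarrow> energy_m m u u \<le> energy u u"
  unfolding form_dom_def energy_def
  by (intro incseq_le energy_m_incseq) (simp add: convergent_LIMSEQ_iff)

lemma energy_m_square_combination:
  "energy_m m (\<lambda>x. a * u x + b * v x) (\<lambda>x. a * u x + b * v x)
    = a\<^sup>2 * energy_m m u u + 2 * a * b * energy_m m u v + b\<^sup>2 * energy_m m v v"
  by (simp add: energy_m_linear energy_m_sym[of m _ "\<lambda>x. a * u x + b * v x"] energy_m_sym[of m v u]
      power2_eq_square algebra_simps)

lemma form_dom_combination:
  assumes u: "u \<in> form_dom" and v: "v \<in> form_dom"
  shows "(\<lambda>x. a * u x + b * v x) \<in> form_dom"
proof (rule form_dom_bounded)
  show "continuous_on K (\<lambda>x. a * u x + b * v x)"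
    using u v unfolding form_dom_def by (intro continuous_intros) auto
  show "energy_m m (\<lambda>x. a * u x + b * v x) (\<lambda>x. a * u x + b * v x)
      \<le> 2 * a\<^sup>2 * energy u u + 2 * b\<^sup>2 * energy v v" for m
  proof -
    have "0 \<le> energy_m m (\<lambda>x. a * u x + (- b) * v x) (\<lambda>x. a * u x + (- b) * v x)"
      by (rule energy_m_nonneg)
    then have "energy_m m (\<lambda>x. a * u x + b * v x) (\<lambda>x. a * u x + b * v x)
        \<le> 2 * a\<^sup>2 * energy_m m u u + 2 * b\<^sup>2 * energy_m m v v"
      unfolding energy_m_square_combination by simp
    also have "\<dots> \<le> 2 * a\<^sup>2 * energy u u + 2 * b\<^sup>2 * energy v v"
      by (intro add_mono mult_left_mono energy_m_le_energy u v) auto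
    finally show ?thesis .
  qed
qed

text \<open>Polarisation reduces the convergence of the bilinear energies to that of the quadratic ones.\<close>

lemma energy_m_tendsto:
  assumes u: "u \<in> form_dom" and v: "v \<in> form_dom"
  shows "(\<lambda>m. energy_m m u v) \<longlonglongrightarrow> energy u v"
proof -
  have conv: "convergent (\<lambda>m. energy_m m g g)" if "g \<in> form_dom" for g
    using that by (simp add: form_dom_def)
  have "(\<lambda>m. energy_m m u v) = (\<lambda>m. (energy_m m (\<lambda>x. 1 * u x + 1 * v x) (\<lambda>x. 1 * u x + 1 * v x)
      - energy_m m u u - energy_m m v v) * (1/2))"
    unfolding energy_m_square_combination by simp
  moreover have "convergent (\<lambda>m. (energy_m m (\<lambda>x. 1 * u x + 1 * v x) (\<lambda>x. 1 * u x + 1 * v x)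
      - energy_m m u u - energy_m m v v) * (1/2))"
    by (intro convergent_mult convergent_diff convergent_const conv form_dom_combination u v)
  ultimately have "convergent (\<lambda>m. energy_m m u v)" by (simp only:)
  then show ?thesis unfolding energy_def by (rule convergent_LIMSEQ_iff[THEN iffD1])
qed

lemma energy_sym: "energy u v = energy v u"
  by (simp add: energy_def energy_m_sym[of _ u v])

lemma energy_linear:
  assumes "u \<in> form_dom" "v \<in> form_dom" "g \<in> form_dom"
  shows "energy (\<lambda>x. a * u x + b * v x) g = a * energy u g + b * energy v g"
proof (rule LIMSEQ_unique)
  show "(\<lambda>m. energy_m m (\<lambda>x. a * u x + b * v x) g) \<longlonglongrightarrow> energy (\<lambda>x. a * u x + b * v x) g"
    by (intro energy_m_tendsto form_dom_combination assms)
  show "(\<lambda>m. energy_m m (\<lambda>x. a * u x + b * v x) g) \<longlonglongrightarrow> a * energy u g + b * energy v g"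
    unfolding energy_m_linear by (intro tendsto_intros energy_m_tendsto assms)
qed

lemma energy_nonneg: "u \<in> form_dom \<Longrightarrow> 0 \<le> energy u u"
  using energy_m_le_energy[of u 0] energy_m_nonneg[of 0 u] by linarith

lemma zero_in_form_dom: "(\<lambda>_. 0) \<in> form_dom"
  by (rule form_dom_bounded[where C = 0]) (auto simp: energy_m_def energy0_def comp_def)

lemma form_dom_sum:
  "(\<And>n. n \<in> A \<Longrightarrow> f n \<in> form_dom) \<Longrightarrow> (\<lambda>x. \<Sum>n\<in>A. a n * f n x) \<in> form_dom"
proof (induction A rule: infinite_finite_induct)
  case (insert n A)
  then show ?case using form_dom_combination[of "f n" "\<lambda>x. \<Sum>n\<in>A. a n * f n x" "a n" 1] by simp
qed (simp_all add: zero_in_form_dom)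

lemma energy_sum:
  assumes "\<And>n. n \<in> A \<Longrightarrow> f n \<in> form_dom" "g \<in> form_dom"
  shows "energy (\<lambda>x. \<Sum>n\<in>A. a n * f n x) g = (\<Sum>n\<in>A. a n * energy (f n) g)"
  using assms(1)
proof (induction A rule: infinite_finite_induct)
  case (insert n A)
  then show ?case
    using energy_linear[of "f n" "\<lambda>x. \<Sum>n\<in>A. a n * f n x" g "a n" 1] assms(2)
    by (simp add: form_dom_sum)
qed (use energy_linear[OF zero_in_form_dom zero_in_form_dom assms(2), of 0 0] in simp_all)

end

section \<open>The sup norm is controlled by the energy\<close>

locale dirichlet_spectrum = regular_harmonic_structure K S F \<pi> r D
  for K :: "'a::metric_space set" and S :: "'i set" and F \<pi> r D +
  fixes lam :: "nat \<Rightarrow> real" and \<phi> :: "nat \<Rightarrow> 'a \<Rightarrow> real"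
  assumes eigensystem: "dirichlet_eigensystem lam \<phi>"
begin

sublocale L2_basis mu \<phi>
proof -
  interpret prob_space mu by (rule prob_space_mu)
  show "L2_basis mu \<phi>"
    by unfold_locales (use eigensystem in \<open>simp add: dirichlet_eigensystem_def\<close>)
qed

lemma lam_pos: "0 < lam n"
  using eigensystem by (simp add: dirichlet_eigensystem_def)

lemma eigenfunction_form_dom0: "\<phi> n \<in> form_dom0"
  using eigensystem by (simp add: dirichlet_eigensystem_def has_laplacian_def form_dom0_def)

lemma form_dom0_form_dom: "v \<in> form_dom0 \<Longrightarrow> v \<in> form_dom"
  by (simp add: form_dom0_def)

lemma form_dom_continuous: "v \<in> form_dom \<Longrightarrow> continuous_on K v"
  by (simp add: form_dom_def)

lemma form_dom0_square_integrable: "v \<in> form_dom0 \<Longrightarrow> square_integrable mu v"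
  by (intro continuous_square_integrable form_dom_continuous form_dom0_form_dom)

lemma form_dom0_combination:
  "u \<in> form_dom0 \<Longrightarrow> v \<in> form_dom0 \<Longrightarrow> (\<lambda>x. a * u x + b * v x) \<in> form_dom0"
  by (simp add: form_dom0_def form_dom_combination)

lemma form_dom0_sum:
  "(\<And>n. n \<in> A \<Longrightarrow> f n \<in> form_dom0) \<Longrightarrow> (\<lambda>x. \<Sum>n\<in>A. a n * f n x) \<in> form_dom0"
  by (simp add: form_dom0_def form_dom_sum)

lemma energy_eigenfunction:
  assumes "v \<in> form_dom0"
  shows "energy (\<phi> n) v = lam n * fourier v n"
proof -
  have "energy (\<phi> n) v = - (LINT x|mu. - lam n * \<phi> n x * v x)"
    using eigensystem assms by (simp add: dirichlet_eigensystem_def has_laplacian_def)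
  also have "\<dots> = lam n * fourier v n"
    by (simp add: fourier_def mult_ac)
  finally show ?thesis .
qed

lemma energy_combination:
  assumes "v \<in> form_dom0"
  shows "energy (\<lambda>x. \<Sum>n\<in>A. a n * \<phi> n x) v = (\<Sum>n\<in>A. a n * (lam n * fourier v n))"
  using assms
  by (simp add: energy_sum eigenfunction_form_dom0 form_dom0_form_dom energy_eigenfunction)

lemma energy_norm_combination:
  assumes "finite A"
  shows "energy (\<lambda>x. \<Sum>n\<in>A. a n * \<phi> n x) (\<lambda>x. \<Sum>n\<in>A. a n * \<phi> n x) = (\<Sum>n\<in>A. lam n * (a n)\<^sup>2)"
  by (simp add: energy_combination form_dom0_sum eigenfunction_form_dom0 fourier_combination[OF assms]
      power2_eq_square mult_ac)

text \<open>Connectedness of the level one graph. A function that is constant on the boundary of each cell, and zero on \<open>V0\<close>,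
extends to \<open>u\<close>, constant on each cell. Its energies vanish from level one on, so \<open>\<lambda>\<^sub>n\<close> times its coefficient along \<open>\<phi>\<^sub>n\<close>,
which is the energy of \<open>\<phi>\<^sub>n\<close> and \<open>u\<close>, vanishes for all \<open>n\<close>. As \<open>\<lambda>\<^sub>n > 0\<close>, completeness forces \<open>u = 0\<close>.\<close>

lemma locally_constant_zero:
  assumes cell: "\<And>i p q. i \<in> S \<Longrightarrow> p \<in> V0 \<Longrightarrow> q \<in> V0 \<Longrightarrow> v (F i p) = v (F i q)"
    and bdry: "\<And>p. p \<in> V0 \<Longrightarrow> v p = (0::real)"
    and ip: "i \<in> S" "p \<in> V0"
  shows "v (F i p) = 0"
proof -
  define c where "c = (\<lambda>i. v (F i p))"
  \<comment> \<open>The choice of the cell does not matter: two cells meet in boundary points, where their constants agree.\<close>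
  define u where "u = (\<lambda>x. c (SOME i. i \<in> S \<and> x \<in> F i ` K))"
  have u_cell: "u (F i x) = c i" if i: "i \<in> S" and x: "x \<in> K" for i x
  proof -
    define j where "j = (SOME j. j \<in> S \<and> F i x \<in> F j ` K)"
    have "j \<in> S \<and> F i x \<in> F j ` K"
      unfolding j_def by (rule someI[of _ i]) (use that in auto)
    then obtain y where j: "j \<in> S" "y \<in> K" "F i x = F j y" by auto
    have "c i = c j"
    proof (cases "i = j")
      case False
      then have "x \<in> V0" "y \<in> V0"
        using cells_meet_in_V0[OF i j(1) False x j(2,3)]
          cells_meet_in_V0[OF j(1) i _ j(2) x j(3)[symmetric]] by auto
      then have "c i = v (F i x)" "c j = v (F j y)"
        unfolding c_def using cell ip(2) i j(1) by blast+
      then show ?thesis by (simp add: j(3))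
    qed simp
    then show ?thesis by (simp add: u_def j_def)
  qed
  have "continuous_on (\<Union>i\<in>S. F i ` K) u"
  proof (rule continuous_on_closed_Union[OF finite_S])
    show "closed (F i ` K)" if "i \<in> S" for i
      by (intro compact_imp_closed compact_continuous_image F_continuous compact_K that)
    show "continuous_on (F i ` K) u" if "i \<in> S" for i
      by (rule continuous_on_eq[of _ "\<lambda>_. c i"]) (use u_cell[OF that] in auto)
  qed
  then have u_cont: "continuous_on K u" by (simp flip: K_eq_cells)
  have u_energy: "energy_m (Suc m) u g = 0" for m g
    unfolding energy_m_def
  proof (rule sum.neutral, rule ballI)
    fix w assume "w \<in> words (Suc m)"
    then obtain i w' where w: "w = i # w'" "i \<in> S" "set w' \<subseteq> S" by (auto simp: words_def length_Suc_conv)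
    have "energy0 (u \<circ> Fw w) (g \<circ> Fw w) = 0"
      by (rule energy0_const[of _ "c i"]) (use w u_cell Fw_V0_in_K in auto)
    then show "inverse (rw w) * energy0 (u \<circ> Fw w) (g \<circ> Fw w) = 0" by simp
  qed
  have "energy_m m u u \<le> energy_m (Suc m) u u" for m by (rule energy_m_mono_Suc)
  then have u_dom: "u \<in> form_dom"
    by (intro form_dom_bounded[OF u_cont, of 0]) (simp add: u_energy)
  have "u q = 0" if q: "q \<in> V0" for q
  proof -
    obtain j y where j: "j \<in> S" "y \<in> V0" "q = F j y" using V0_subset_V1[OF q] by blast
    then have "u q = c j" using u_cell V0_subset_K by auto
    also have "\<dots> = v q" unfolding c_def j(3) by (rule cell) (use j ip in auto)
    finally show ?thesis using bdry[OF q] by simp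
  qed
  then have u0: "u \<in> form_dom0" using u_dom by (simp add: form_dom0_def)
  have "fourier u n = 0" for n
  proof -
    have "(\<lambda>m. energy_m (Suc m) u (\<phi> n)) \<longlonglongrightarrow> energy u (\<phi> n)"
      using energy_m_tendsto[OF u_dom form_dom0_form_dom[OF eigenfunction_form_dom0]]
      by (rule LIMSEQ_Suc)
    then have "energy u (\<phi> n) = 0"
      by (intro LIMSEQ_unique[OF _ tendsto_const]) (simp add: u_energy)
    then show ?thesis
      using energy_eigenfunction[OF u0, of n] lam_pos[of n] by (simp add: energy_sym[of u])
  qed
  then have "AE x in mu. u x = 0"
    by (intro AE_zero_if_fourier_zero form_dom0_square_integrable u0)
  then have "u (F i p) = 0"
    by (rule AE_zero_imp_zero[OF u_cont]) (use ip F_maps V0_subset_K in auto)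
  then show ?thesis
    using u_cell[of i p] ip V0_subset_K by (auto simp: c_def)
qed

text \<open>Finiteness of the effective resistance between \<open>x\<close> and \<open>y\<close> in the level one network. This is an
equivalence relation that contains the edges; testing the energy on the indicator of a class replaces an explicit
choice of paths.\<close>

definition comparable :: "'a \<Rightarrow> 'a \<Rightarrow> bool" where
  "comparable x y \<longleftrightarrow> (\<exists>C. \<forall>v. (v x - v y)\<^sup>2 \<le> C * energy_m 1 v v)"

lemma comparable_trans:
  assumes "comparable x y" "comparable y z"
  shows "comparable x z"
proof -
  obtain C1 C2 where C: "\<And>v. (v x - v y)\<^sup>2 \<le> C1 * energy_m 1 v v" "\<And>v. (v y - v z)\<^sup>2 \<le> C2 * energy_m 1 v v"
    using assms unfolding comparable_def by blast
  have "(v x - v z)\<^sup>2 \<le> (2 * C1 + 2 * C2) * energy_m 1 v v" for v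
  proof -
    have "(v x - v z)\<^sup>2 \<le> 2 * (v x - v y)\<^sup>2 + 2 * (v y - v z)\<^sup>2"
      using zero_le_power2[of "v x - 2 * v y + v z"] by (simp add: power2_eq_square algebra_simps)
    then show ?thesis using C[of v] by (simp add: distrib_right)
  qed
  then show ?thesis unfolding comparable_def by blast
qed

lemma comparable_edge:
  assumes "i \<in> S" "p \<in> V0" "q \<in> V0" "0 < D p q"
  shows "comparable (F i p) (F i q)"
  unfolding comparable_def
proof (intro exI allI)
  fix v
  have ri: "0 < r i" using r_regular assms by blast
  have "inverse (r i) * energy0 (v \<circ> F i) (v \<circ> F i) \<le> energy_m 1 v v"
    unfolding energy_m_1
    by (rule member_le_sum[where f = "\<lambda>i. inverse (r i) * energy0 (v \<circ> F i) (v \<circ> F i)"])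
      (use assms finite_S r_regular in \<open>auto intro!: mult_nonneg_nonneg energy0_nonneg simp: less_imp_le\<close>)
  then have "energy0 (v \<circ> F i) (v \<circ> F i) \<le> r i * energy_m 1 v v"
    using ri by (simp add: field_simps)
  then have "D p q * (v (F i p) - v (F i q))\<^sup>2 \<le> 2 * (r i * energy_m 1 v v)"
    using energy0_edge[OF assms(2,3), of "v \<circ> F i"] by simp
  then show "(v (F i p) - v (F i q))\<^sup>2 \<le> (2 * r i / D p q) * energy_m 1 v v"
    using assms(4) by (simp add: pos_le_divide_eq mult_ac)
qed

lemma comparable_boundary_edge:
  assumes "p \<in> V0" "q \<in> V0" "0 < D p q"
  shows "comparable p q"
  unfolding comparable_def
proof (intro exI allI)
  fix v
  have "energy0 v v \<le> energy_m 1 v v" using energy_min[of v] by blast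
  then have "D p q * (v p - v q)\<^sup>2 \<le> 2 * energy_m 1 v v"
    using energy0_edge[OF assms(1,2), of v] by simp
  then show "(v p - v q)\<^sup>2 \<le> (2 / D p q) * energy_m 1 v v"
    using assms(3) by (simp add: pos_le_divide_eq mult_ac)
qed

lemma comparable_sym: "comparable x y \<longleftrightarrow> comparable y x"
  unfolding comparable_def by (simp add: power2_commute)

text \<open>The indicator of the complement of the class of \<open>p0\<close> is constant along all edges, hence constant on the
boundary of each cell, hence zero.\<close>

lemma comparable_level_one:
  assumes p0: "p0 \<in> V0" and i: "i \<in> S" and p: "p \<in> V0"
  shows "comparable p0 (F i p)"
proof -
  define v where "v = (\<lambda>x. if comparable p0 x then 0 else 1 :: real)"
  have v_eq: "v x = v y" if "comparable x y" for x y
    using that comparable_trans comparable_sym unfolding v_def by meson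
  have "comparable p0 p0" unfolding comparable_def by (intro exI[of _ 0]) simp
  then have "v p0 = 0" by (simp add: v_def)
  have "v (F i p) = 0"
  proof (rule locally_constant_zero[OF _ _ i p])
    show "v (F j q) = v (F j q')" if "j \<in> S" "q \<in> V0" "q' \<in> V0" for j q q'
      by (rule constant_if_constant_on_edges[where v = "\<lambda>q. v (F j q)"])
        (use that in \<open>auto intro!: v_eq comparable_edge\<close>)
    show "v q = 0" if "q \<in> V0" for q
    proof -
      have "v q = v p0"
        by (rule constant_if_constant_on_edges)
          (use that p0 in \<open>auto intro!: v_eq comparable_boundary_edge\<close>)
      then show ?thesis using \<open>v p0 = 0\<close> by simp
    qed
  qed
  then show ?thesis by (simp add: v_def split: if_splits)
qed

text \<open>For an address \<open>\<omega>\<close> of \<open>x\<close>, the points \<open>Fw (word_prefix m \<omega>) p0\<close> lead from \<open>p0\<close> to \<open>x\<close>. Consecutive ones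
lie in one cell of level \<open>m\<close> and are a scaled copy of \<open>p0\<close> and \<open>F i p0\<close>, so the square of the difference of \<open>v\<close> is at most a
constant times \<open>\<rho>\<^sup>m \<E>(v, v)\<close>, where \<open>\<rho>\<close> is the largest of the \<open>r i\<close>. The differences sum to a geometric series,
and \<open>v p0 = 0\<close>.\<close>

lemma sup_bound:
  "\<exists>A\<ge>0. \<forall>v\<in>form_dom0. \<forall>x\<in>K. (v x)\<^sup>2 \<le> A * energy v v"
proof -
  obtain p0 where p0: "p0 \<in> V0" using pcf by blast
  have p0K: "p0 \<in> K" using p0 V0_subset_K by blast
  have "\<forall>i\<in>S. \<exists>C. \<forall>v. (v p0 - v (F i p0))\<^sup>2 \<le> C * energy_m 1 v v"
    using comparable_level_one[OF p0 _ p0] unfolding comparable_def by blast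
  then obtain c where c: "\<And>i v. i \<in> S \<Longrightarrow> (v p0 - v (F i p0))\<^sup>2 \<le> c i * energy_m 1 v v"
    by metis
  define C where "C = (\<Sum>i\<in>S. \<bar>c i\<bar>)"
  have C0: "0 \<le> C" unfolding C_def by (rule sum_nonneg) simp
  have C: "(v p0 - v (F i p0))\<^sup>2 \<le> C * energy_m 1 v v" if "i \<in> S" for i v
  proof -
    have "\<bar>c i\<bar> \<le> C" unfolding C_def by (rule member_le_sum) (use that finite_S in auto)
    then have "c i \<le> C" by simp
    then show ?thesis using c[OF that, of v] energy_m_nonneg[of 1 v] by (meson mult_right_mono order_trans)
  qed
  define \<rho> where "\<rho> = Max (r ` S)"
  have S_ne: "S \<noteq> {}" using two_cells by blast
  have r_le: "r i \<le> \<rho>" if "i \<in> S" for i unfolding \<rho>_def using that finite_S by simp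
  have "\<rho> \<in> r ` S" unfolding \<rho>_def using S_ne finite_S by simp
  then have \<rho>: "0 < \<rho>" "\<rho> < 1" using r_regular by auto
  have rw_le: "rw w \<le> \<rho> ^ length w" if "set w \<subseteq> S" for w
    using that
  proof (induction w)
    case (Cons i w)
    have "r i * rw w \<le> \<rho> * \<rho> ^ length w"
      using Cons r_le \<rho> rw_pos[of w] by (intro mult_mono) (auto simp: less_imp_le)
    then show ?case by (simp add: rw_def)
  qed (simp add: rw_def)
  define s where "s = sqrt \<rho>"
  have s: "0 \<le> s" "s < 1" "s\<^sup>2 = \<rho>" using \<rho> by (auto simp: s_def real_sqrt_lt_1_iff)
  show ?thesis
  proof (intro exI[of _ "C / (1 - s)\<^sup>2"] conjI ballI)
    show "0 \<le> C / (1 - s)\<^sup>2" using C0 by simp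
    fix v x assume v: "v \<in> form_dom0" and x: "x \<in> K"
    define E where "E = energy v v"
    have v': "v \<in> form_dom" by (rule form_dom0_form_dom[OF v])
    have E0: "0 \<le> E" unfolding E_def by (rule energy_nonneg[OF v'])
    obtain \<omega> where \<omega>: "\<omega> \<in> UNIV \<rightarrow> S" "x = \<pi> \<omega>" using x pi_surj by blast
    define y where "y = (\<lambda>m. v (Fw (word_prefix m \<omega>) p0))"
    have step: "\<bar>y (Suc m) - y m\<bar> \<le> sqrt (C * E) * s ^ m" for m
    proof -
      let ?w = "word_prefix m \<omega>"
      have w: "?w \<in> words m" using set_prefix[OF \<omega>(1)] by (simp add: words_def)
      have "(y m - y (Suc m))\<^sup>2 = ((v \<circ> Fw ?w) p0 - (v \<circ> Fw ?w) (F (\<omega> m) p0))\<^sup>2"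
        by (simp add: y_def word_prefix_Suc Fw_append)
      also have "\<dots> \<le> C * energy_m 1 (v \<circ> Fw ?w) (v \<circ> Fw ?w)"
        by (rule C) (use \<omega> in auto)
      also have "\<dots> \<le> C * (rw ?w * energy_m (Suc m) v v)"
        by (intro mult_left_mono energy_m_cell w C0)
      also have "\<dots> \<le> C * (\<rho> ^ m * E)"
      proof (rule mult_left_mono[OF mult_mono C0])
        show "rw ?w \<le> \<rho> ^ m" using rw_le[OF words_set[OF w]] by simp
        show "energy_m (Suc m) v v \<le> E" unfolding E_def by (rule energy_m_le_energy[OF v'])
      qed (use \<rho> energy_m_nonneg in auto)
      also have "\<dots> = (sqrt (C * E) * s ^ m)\<^sup>2"
      proof -
        have "(s ^ m)\<^sup>2 = \<rho> ^ m" unfolding s(3)[symmetric] by (simp only: power_mult[symmetric] mult.commute)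
        then show ?thesis using C0 E0 by (simp add: power_mult_distrib)
      qed
      finally have "(y m - y (Suc m))\<^sup>2 \<le> (sqrt (C * E) * s ^ m)\<^sup>2" .
      then have "\<bar>y m - y (Suc m)\<bar> \<le> sqrt (C * E) * s ^ m"
        using C0 E0 s(1) unfolding abs_le_square_iff[symmetric] by simp
      then show ?thesis unfolding abs_minus_commute[of "y m"] .
    qed
    have sum_le: "\<bar>y m - y 0\<bar> \<le> sqrt (C * E) / (1 - s)" for m
    proof -
      have "\<bar>y m - y 0\<bar> = \<bar>\<Sum>k<m. y (Suc k) - y k\<bar>" by (simp only: sum_lessThan_telescope)
      also have "\<dots> \<le> (\<Sum>k<m. \<bar>y (Suc k) - y k\<bar>)" by (rule sum_abs)
      also have "\<dots> \<le> (\<Sum>k<m. sqrt (C * E) * s ^ k)" by (intro sum_mono step)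
      also have "\<dots> = sqrt (C * E) * (\<Sum>k<m. s ^ k)" by (simp add: sum_distrib_left)
      also have "\<dots> \<le> sqrt (C * E) * (1 / (1 - s))"
      proof (rule mult_left_mono)
        have "(\<Sum>k<m. s ^ k) \<le> (\<Sum>k. s ^ k)"
          using s by (intro sum_le_suminf summable_geometric) auto
        also have "\<dots> = 1 / (1 - s)" using s by (intro suminf_geometric) auto
        finally show "(\<Sum>k<m. s ^ k) \<le> 1 / (1 - s)" .
      qed (use C0 E0 in simp)
      finally show ?thesis by simp
    qed
    have "y \<longlonglongrightarrow> v (\<pi> \<omega>)"
      unfolding y_def
    proof (rule continuous_on_tendsto_compose[OF form_dom_continuous[OF v']])
      show "(\<lambda>m. Fw (word_prefix m \<omega>) p0) \<longlonglongrightarrow> \<pi> \<omega>" by (rule Fw_prefix_tendsto[OF \<omega>(1) p0K])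
    qed (use \<omega> x Fw_in_K set_prefix p0K in auto)
    then have "(\<lambda>m. \<bar>y m - y 0\<bar>) \<longlonglongrightarrow> \<bar>v x - y 0\<bar>" unfolding \<omega>(2) by (intro tendsto_intros)
    then have "\<bar>v x - y 0\<bar> \<le> sqrt (C * E) / (1 - s)"
      by (rule LIMSEQ_le_const2) (use sum_le in blast)
    moreover have "y 0 = 0" using v p0 by (simp add: y_def form_dom0_def)
    ultimately have "(v x)\<^sup>2 \<le> (sqrt (C * E) / (1 - s))\<^sup>2"
      by (metis abs_ge_zero diff_zero power2_abs power_mono)
    also have "\<dots> = C / (1 - s)\<^sup>2 * energy v v"
      using C0 E0 by (simp add: power_divide E_def)
    finally show "(v x)\<^sup>2 \<le> C / (1 - s)\<^sup>2 * energy v v" .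
  qed
qed

end

section \<open>Pointwise eigenfunction expansion\<close>

context dirichlet_spectrum
begin

text \<open>Apply the sup bound at \<open>x\<close> to the truncated Green function \<open>\<Sum>n<N. \<phi>\<^sub>n(x) \<phi>\<^sub>n / \<lambda>\<^sub>n\<close>: its value at \<open>x\<close> and
its energy are both the sum \<open>s\<close> in question, so \<open>s\<^sup>2 \<le> A s\<close>.\<close>

lemma green_bound:
  "\<exists>G. \<forall>x\<in>K. \<forall>N. (\<Sum>n<N. (\<phi> n x)\<^sup>2 / lam n) \<le> G"
proof -
  obtain A where A: "0 \<le> A" "\<And>v x. v \<in> form_dom0 \<Longrightarrow> x \<in> K \<Longrightarrow> (v x)\<^sup>2 \<le> A * energy v v"
    using sup_bound by blast
  show ?thesis
  proof (intro exI[of _ A] ballI allI)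
    fix x N assume x: "x \<in> K"
    define a where "a = (\<lambda>n. \<phi> n x / lam n)"
    define v where "v = (\<lambda>y. \<Sum>n<N. a n * \<phi> n y)"
    define s where "s = (\<Sum>n<N. (\<phi> n x)\<^sup>2 / lam n)"
    have v: "v \<in> form_dom0" unfolding v_def by (intro form_dom0_sum eigenfunction_form_dom0)
    have "v x = s" by (simp add: v_def s_def a_def power2_eq_square)
    moreover have "energy v v = s"
      unfolding v_def energy_norm_combination[OF finite_lessThan] s_def
    proof (rule sum.cong)
      show "lam n * (a n)\<^sup>2 = (\<phi> n x)\<^sup>2 / lam n" for n
        using lam_pos[of n] by (simp add: a_def power2_eq_square)
    qed simp
    ultimately have "s * s \<le> A * s" using A(2)[OF v x] by (simp add: power2_eq_square)
    moreover have "0 \<le> s" unfolding s_def using lam_pos by (intro sum_nonneg) (simp add: less_imp_le)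
    ultimately have "s \<le> A" using A(1) by (cases "s = 0") (auto simp: mult_le_cancel_right)
    then show "(\<Sum>n<N. (\<phi> n x)\<^sup>2 / lam n) \<le> A" by (simp add: s_def)
  qed
qed

text \<open>Bessel's inequality for the energy form, in which \<open>\<phi>\<^sub>n / sqrt \<lambda>\<^sub>n\<close> is orthonormal.\<close>

lemma energy_bessel:
  assumes v: "v \<in> form_dom0"
  shows "(\<Sum>n<N. lam n * (fourier v n)\<^sup>2) \<le> energy v v"
proof -
  define a where "a = fourier v"
  define s where "s = (\<lambda>y. \<Sum>n<N. a n * \<phi> n y)"
  have s: "s \<in> form_dom0" unfolding s_def by (intro form_dom0_sum eigenfunction_form_dom0)
  define w where "w = (\<lambda>y. 1 * v y + (-1) * s y)"
  have w: "w \<in> form_dom0" unfolding w_def by (intro form_dom0_combination v s)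
  have fw: "fourier w n = 0" if "n < N" for n
  proof -
    have "fourier s n = a n" unfolding s_def using that by (simp add: fourier_combination)
    moreover have "fourier w n = fourier v n - fourier s n"
      using fourier_diff[OF form_dom0_square_integrable[OF v] form_dom0_square_integrable[OF s]]
      by (simp add: w_def)
    ultimately show ?thesis by (simp add: a_def)
  qed
  have "energy s w = 0"
    unfolding s_def energy_combination[OF w] by (rule sum.neutral) (simp add: fw)
  moreover have "energy s v = (\<Sum>n<N. lam n * (fourier v n)\<^sup>2)"
    unfolding s_def energy_combination[OF v] by (simp add: a_def power2_eq_square mult_ac)
  moreover have "energy w g = energy v g - energy s g" if "g \<in> form_dom0" for g
    unfolding w_def using energy_linear[of v s g 1 "-1"] v s that by (simp add: form_dom0_form_dom)
  moreover have "0 \<le> energy w w" by (intro energy_nonneg form_dom0_form_dom w)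
  ultimately have "0 \<le> energy v w" "energy w v = energy v v - (\<Sum>n<N. lam n * (fourier v n)\<^sup>2)"
    using v w by simp_all
  then show ?thesis unfolding energy_sym[of w v] by linarith
qed

text \<open>The partial sums are Cauchy in energy, hence uniformly Cauchy by the sup bound. The uniform limit is
continuous and has the coefficients of \<open>v\<close>, so it equals \<open>v\<close> almost everywhere, and by full support everywhere.\<close>

lemma eigenfunction_expansion:
  assumes v: "v \<in> form_dom0" and x: "x \<in> K"
  shows "(\<lambda>n. fourier v n * \<phi> n x) sums v x"
proof -
  define a where "a = fourier v"
  define s where "s = (\<lambda>N y. \<Sum>n<N. a n * \<phi> n y)"
  obtain A where A: "0 \<le> A" "\<And>v x. v \<in> form_dom0 \<Longrightarrow> x \<in> K \<Longrightarrow> (v x)\<^sup>2 \<le> A * energy v v"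
    using sup_bound by blast
  have sm: "summable (\<lambda>n. lam n * (a n)\<^sup>2)"
  proof (rule bounded_imp_summable[where B = "energy v v"])
    show "0 \<le> lam n * (a n)\<^sup>2" for n using lam_pos[of n] by simp
    show "(\<Sum>n\<le>N. lam n * (a n)\<^sup>2) \<le> energy v v" for N
      using energy_bessel[OF v, of "Suc N"] by (simp only: lessThan_Suc_atMost a_def)
  qed
  have s_diff: "s N y - s M y = (\<Sum>n\<in>{M..<N}. a n * \<phi> n y)" if "M \<le> N" for M N y
    unfolding s_def lessThan_atLeast0 by (rule sum_diff_nat_ivl) (use that in auto)
  have "uniformly_Cauchy_on K s"
  proof (rule uniformly_Cauchy_onI')
    fix e :: real assume e: "0 < e"
    \<comment> \<open>Dividing by \<open>A + 1\<close> covers \<open>A = 0\<close>.\<close>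
    define e' where "e' = e\<^sup>2 / (A + 1)"
    have "0 < e'" using e A(1) by (simp add: e'_def)
    then obtain M0 where M0: "\<And>m n. M0 \<le> m \<Longrightarrow> norm (\<Sum>k\<in>{m..<n}. lam k * (a k)\<^sup>2) < e'"
      using sm unfolding summable_Cauchy by meson
    show "\<exists>M. \<forall>x\<in>K. \<forall>m\<ge>M. \<forall>n>m. dist (s m x) (s n x) < e"
    proof (intro exI[of _ M0] ballI allI impI)
      fix y m n assume y: "y \<in> K" and mn: "M0 \<le> m" "m < n"
      let ?d = "\<lambda>y. \<Sum>k\<in>{m..<n}. a k * \<phi> k y"
      have "(?d y)\<^sup>2 \<le> A * energy ?d ?d"
        by (rule A(2)[OF _ y]) (intro form_dom0_sum eigenfunction_form_dom0)
      also have "\<dots> = A * (\<Sum>k\<in>{m..<n}. lam k * (a k)\<^sup>2)"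
        by (simp only: energy_norm_combination[OF finite_atLeastLessThan])
      also have "\<dots> \<le> A * e'"
        using M0[OF mn(1), of n] A(1) by (intro mult_left_mono) auto
      also have "\<dots> < (A + 1) * e'" using \<open>0 < e'\<close> by (intro mult_strict_right_mono) auto
      also have "\<dots> = e\<^sup>2"
      proof -
        have "A + 1 \<noteq> 0" using A(1) by linarith
        then show ?thesis by (simp add: e'_def)
      qed
      finally have "\<bar>?d y\<bar>\<^sup>2 < e\<^sup>2" by (simp only: power2_abs)
      then have "\<bar>?d y\<bar> < e" by (rule power2_less_imp_less) (rule less_imp_le[OF e])
      then show "dist (s m y) (s n y) < e"
        unfolding dist_real_def abs_minus_commute[of "s m y"] s_diff[OF less_imp_le[OF mn(2)]] .
    qed
  qed
  then have "uniformly_convergent_on K s" by (rule Cauchy_uniformly_convergent)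
  then obtain l where l: "uniform_limit K s l sequentially"
    by (auto simp: uniformly_convergent_on_def)
  have s_cont: "continuous_on K (s N)" for N
    unfolding s_def by (intro form_dom_continuous form_dom_sum form_dom0_form_dom eigenfunction_form_dom0)
  have l_cont: "continuous_on K l"
    by (rule uniform_limit_theorem[OF _ l]) (simp_all add: s_cont)
  have fl: "fourier l n = a n" for n
  proof (rule ccontr)
    assume ne: "fourier l n \<noteq> a n"
    define e where "e = \<bar>fourier l n - a n\<bar> / 2"
    have e: "0 < e" using ne by (simp add: e_def)
    have "\<forall>\<^sub>F N in sequentially. \<forall>x\<in>K. dist (s N x) (l x) < e"
      using l e by (simp add: uniform_limit_iff)
    then have "\<forall>\<^sub>F N in sequentially. (\<forall>x\<in>K. dist (s N x) (l x) < e) \<and> n < N"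
      by (intro eventually_conj eventually_gt_at_top)
    then obtain N where N: "\<And>x. x \<in> K \<Longrightarrow> dist (s N x) (l x) < e" "n < N"
      by (auto simp: eventually_sequentially)
    let ?d = "\<lambda>x. l x - s N x"
    have d_cont: "continuous_on K ?d" by (intro continuous_on_diff l_cont s_cont)
    have "fourier (s N) n = a n" unfolding s_def using N(2) by (simp add: fourier_combination)
    then have "(fourier l n - a n)\<^sup>2 = (fourier ?d n)\<^sup>2"
      using fourier_diff[OF continuous_square_integrable[OF l_cont] continuous_square_integrable[OF s_cont]]
      by simp
    also have "\<dots> \<le> (LINT x|mu. (?d x)\<^sup>2)"
      by (rule fourier_sq_le[OF continuous_square_integrable[OF d_cont]])
    also have "\<dots> \<le> e\<^sup>2"
    proof (rule integral_square_le[OF continuous_imp_measurable[OF d_cont]])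
      show "\<bar>l x - s N x\<bar> \<le> e" if "x \<in> K" for x
        using N(1)[OF that] by (simp add: dist_real_def)
    qed
    finally have "\<bar>fourier l n - a n\<bar> \<le> e"
      using e unfolding abs_le_square_iff[symmetric] by simp
    then show False using e by (simp add: e_def)
  qed
  have v_cont: "continuous_on K v" by (intro form_dom_continuous form_dom0_form_dom v)
  have d_cont: "continuous_on K (\<lambda>x. v x - l x)" by (intro continuous_on_diff v_cont l_cont)
  have "AE x in mu. v x - l x = 0"
  proof (rule AE_zero_if_fourier_zero[OF continuous_square_integrable[OF d_cont]])
    show "fourier (\<lambda>x. v x - l x) n = 0" for n
      by (simp add: fourier_diff continuous_square_integrable v_cont l_cont fl a_def)
  qed
  then have "v x - l x = 0" by (rule AE_zero_imp_zero[OF d_cont _ x])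
  then have "v x = l x" by simp
  moreover have "(\<lambda>N. s N x) \<longlonglongrightarrow> l x" by (rule tendsto_uniform_limitI[OF l x])
  ultimately show ?thesis by (simp add: sums_def s_def a_def)
qed

end

section \<open>Second differences in time\<close>

lemma integral_triangle_kernel:
  assumes "0 \<le> (h::real)"
  shows "(LINT s|lborel. indicator {0..h} s * (h - s)) = h\<^sup>2 / 2"
proof -
  have "(LINT s|lborel. indicator {0..h} s *\<^sub>R (h - s)) = (h * h - h\<^sup>2 / 2) - (h * 0 - 0\<^sup>2 / 2)"
    by (rule integral_FTC_atLeastAtMost[OF assms, where F = "\<lambda>s. h * s - s\<^sup>2 / 2"])
      (auto intro!: derivative_eq_intros continuous_intros simp: has_real_derivative_iff_has_vector_derivative[symmetric])
  then show ?thesis by (simp add: power2_eq_square)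
qed

lemma second_difference_as_integral:
  assumes f1: "\<And>s. \<bar>s - t\<bar> \<le> h \<Longrightarrow> (f has_real_derivative f' s) (at s)"
    and f2: "\<And>s. \<bar>s - t\<bar> \<le> h \<Longrightarrow> (f' has_real_derivative f'' s) (at s)"
    and cont: "continuous_on {t - h..t + h} f''"
    and h: "0 \<le> h"
  shows "f (t + h) - 2 * f t + f (t - h)
    = (LINT s|lborel. indicator {0..h} s * ((h - s) * (f'' (t + s) + f'' (t - s))))"
proof -
  define F where "F = (\<lambda>s. (h - s) * (f' (t + s) - f' (t - s)) + f (t + s) + f (t - s))"
  have "(LINT s|lborel. indicator {0..h} s *\<^sub>R ((h - s) * (f'' (t + s) + f'' (t - s)))) = F h - F 0"
  proof (rule integral_FTC_atLeastAtMost[OF h])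
    fix s assume s: "0 \<le> s" "s \<le> h"
    have a: "((\<lambda>s. f (t + s)) has_real_derivative f' (t + s) * (0 + 1)) (at s)"
      by (rule DERIV_chain'[of "\<lambda>s. t + s" "0 + 1" s UNIV f])
        (use s in \<open>auto intro!: derivative_eq_intros f1\<close>)
    have b: "((\<lambda>s. f (t - s)) has_real_derivative f' (t - s) * (0 - 1)) (at s)"
      by (rule DERIV_chain'[of "\<lambda>s. t - s" "0 - 1" s UNIV f])
        (use s in \<open>auto intro!: derivative_eq_intros f1\<close>)
    have a': "((\<lambda>s. f' (t + s)) has_real_derivative f'' (t + s) * (0 + 1)) (at s)"
      by (rule DERIV_chain'[of "\<lambda>s. t + s" "0 + 1" s UNIV f'])
        (use s in \<open>auto intro!: derivative_eq_intros f2\<close>)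
    have b': "((\<lambda>s. f' (t - s)) has_real_derivative f'' (t - s) * (0 - 1)) (at s)"
      by (rule DERIV_chain'[of "\<lambda>s. t - s" "0 - 1" s UNIV f'])
        (use s in \<open>auto intro!: derivative_eq_intros f2\<close>)
    have "(F has_real_derivative (h - s) * (f'' (t + s) + f'' (t - s))) (at s)"
      unfolding F_def
      by (rule derivative_eq_intros a b a' b' refl)+ (simp add: algebra_simps)
    then show "(F has_vector_derivative (h - s) * (f'' (t + s) + f'' (t - s))) (at s within {0..h})"
      by (simp add: has_real_derivative_iff_has_vector_derivative has_vector_derivative_at_within)
  next
    have "continuous_on {0..h} (\<lambda>s. f'' (t + s))" "continuous_on {0..h} (\<lambda>s. f'' (t - s))"
      by (rule continuous_on_compose2[OF cont]; auto intro!: continuous_intros)+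
    then show "continuous_on {0..h} (\<lambda>s. (h - s) * (f'' (t + s) + f'' (t - s)))"
      by (intro continuous_intros)
  qed
  then show ?thesis by (simp add: F_def)
qed

text \<open>The triangle kernel \<open>h - s\<close> has mass \<open>h\<^sup>2 / 2\<close> on each side of \<open>t\<close>, so the averages converge to the value
of \<open>b\<close> at \<open>t\<close>.\<close>

lemma sym_deriv2_of_average:
  assumes cont: "continuous_on {t - \<delta>..t + \<delta>} b" and \<delta>: "0 < \<delta>"
    and avg: "\<And>h. 0 < h \<Longrightarrow> h < \<delta> \<Longrightarrow> f (t + h) - 2 * f t + f (t - h)
      = (LINT s|lborel. indicator {0..h} s * ((h - s) * (b (t + s) + b (t - s))))"
  shows "has_sym_deriv2 f (b t) t"
  unfolding has_sym_deriv2_def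
proof (rule tendstoI)
  fix e :: real assume e: "0 < e"
  define e' where "e' = e / 2"
  have e': "0 < e'" "e' < e" using e by (auto simp: e'_def)
  have "t \<in> {t - \<delta>..t + \<delta>}" using \<delta> by simp
  then obtain d where d: "0 < d" "\<And>s. s \<in> {t - \<delta>..t + \<delta>} \<Longrightarrow> dist s t < d \<Longrightarrow> dist (b s) (b t) < e'"
    using cont e'(1) unfolding continuous_on_iff by meson
  have "dist ((f (t + h) - 2 * f t + f (t - h)) / h\<^sup>2) (b t) < e" if h: "0 < h" "h < min \<delta> d" for h
  proof -
    let ?I = "\<lambda>g. LINT s|lborel. indicator {0..h} s * ((h - s) * g s)"
    let ?g = "\<lambda>s. b (t + s) + b (t - s)"
    have near: "\<bar>b (t + s) - b t\<bar> \<le> e'" "\<bar>b (t - s) - b t\<bar> \<le> e'" if "s \<in> {0..h}" for s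
      using d(2)[of "t + s"] d(2)[of "t - s"] that h by (auto simp: dist_real_def)
    have int_const: "?I (\<lambda>_. 2 * c) = c * h\<^sup>2" for c
    proof -
      have "?I (\<lambda>_. 2 * c) = (LINT s|lborel. (2 * c) * (indicator {0..h} s * (h - s)))"
        by (simp only: mult_ac)
      then show ?thesis using h integral_triangle_kernel[of h] by simp
    qed
    have integrable: "integrable lborel (\<lambda>s. indicator {0..h} s * ((h - s) * g s))"
      if "continuous_on {0..h} g" for g
      using borel_integrable_compact[of "{0..h}" "\<lambda>s. (h - s) * g s"] that
      by (simp add: continuous_intros)
    have cont_g: "continuous_on {0..h} ?g"
    proof (rule continuous_on_add)
      show "continuous_on {0..h} (\<lambda>s. b (t + s))" "continuous_on {0..h} (\<lambda>s. b (t - s))"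
        by (rule continuous_on_compose2[OF cont]; use h in \<open>auto intro!: continuous_intros\<close>)+
    qed
    have "?I ?g \<le> ?I (\<lambda>_. 2 * (b t + e'))"
    proof (rule Bochner_Integration.integral_mono)
      show "indicator {0..h} s * ((h - s) * ?g s) \<le> indicator {0..h} s * ((h - s) * (2 * (b t + e')))" for s
      proof (cases "s \<in> {0..h}")
        case True
        then have "?g s \<le> 2 * (b t + e')" using near[OF True] by (simp add: abs_le_iff)
        then show ?thesis using True by (simp add: mult_left_mono)
      qed simp
    qed (intro integrable cont_g continuous_intros)+
    then have le: "?I ?g \<le> (b t + e') * h\<^sup>2" unfolding int_const .
    have "?I (\<lambda>_. 2 * (b t - e')) \<le> ?I ?g"
    proof (rule Bochner_Integration.integral_mono)
      show "indicator {0..h} s * ((h - s) * (2 * (b t - e'))) \<le> indicator {0..h} s * ((h - s) * ?g s)" for s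
      proof (cases "s \<in> {0..h}")
        case True
        then have "2 * (b t - e') \<le> ?g s" using near[OF True] by (simp add: abs_le_iff)
        then show ?thesis using True by (simp add: mult_left_mono)
      qed simp
    qed (intro integrable cont_g continuous_intros)+
    then have ge: "(b t - e') * h\<^sup>2 \<le> ?I ?g" unfolding int_const .
    have h2: "0 < h\<^sup>2" using h by simp
    have "?I ?g / h\<^sup>2 \<le> b t + e'" "b t - e' \<le> ?I ?g / h\<^sup>2"
      using le ge h2 by (simp_all add: pos_divide_le_eq pos_le_divide_eq)
    then have "\<bar>?I ?g / h\<^sup>2 - b t\<bar> \<le> e'" by linarith
    then show ?thesis using avg[of h] h e' by (simp add: dist_real_def)
  qed
  moreover have "0 < min \<delta> d" using \<delta> d by simp
  ultimately show "\<forall>\<^sub>F h in at_right 0. dist ((f (t + h) - 2 * f t + f (t - h)) / h\<^sup>2) (b t) < e"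
    unfolding eventually_at_right_field by blast
qed

text \<open>Rounding \<open>s\<close> to a grid gives countably many pieces, each measurable in \<open>x\<close>; continuity in \<open>s\<close> lets the grid
be refined.\<close>

lemma caratheodory_measurable:
  fixes f :: "real \<Rightarrow> 'a \<Rightarrow> real"
  assumes meas: "\<And>s. f s \<in> borel_measurable M"
    and cont: "\<And>x. x \<in> space M \<Longrightarrow> continuous_on UNIV (\<lambda>s. f s x)"
  shows "(\<lambda>(s, x). f s x) \<in> borel_measurable ((lborel :: real measure) \<Otimes>\<^sub>M M)"
proof -
  define g where "g = (\<lambda>(k::nat) p. f (real_of_int \<lfloor>fst p * real (Suc k)\<rfloor> / real (Suc k)) (snd p))"
  have g_meas: "g k \<in> borel_measurable ((lborel :: real measure) \<Otimes>\<^sub>M M)" for k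
    unfolding g_def
  proof (rule measurable_compose_countable[where
        f = "\<lambda>i p. f (real_of_int i / real (Suc k)) (snd p)" and g = "\<lambda>p. \<lfloor>fst p * real (Suc k)\<rfloor>"])
    show "(\<lambda>p. f (real_of_int i / real (Suc k)) (snd p)) \<in> borel_measurable ((lborel :: real measure) \<Otimes>\<^sub>M M)" for i
      by (rule measurable_compose[OF measurable_snd meas])
    show "(\<lambda>p. \<lfloor>fst p * real (Suc k)\<rfloor>) \<in> measurable ((lborel :: real measure) \<Otimes>\<^sub>M M) (count_space UNIV)"
      by measurable
  qed
  show ?thesis
  proof (rule borel_measurable_LIMSEQ_metric[OF g_meas])
    fix p assume "p \<in> space ((lborel :: real measure) \<Otimes>\<^sub>M M)"
    then obtain s x where p: "p = (s, x)" "x \<in> space M" by (auto simp: space_pair_measure)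
    have "(\<lambda>k. real_of_int \<lfloor>s * real (Suc k)\<rfloor> / real (Suc k)) \<longlonglongrightarrow> s"
    proof (rule tendsto_sandwich)
      have "(s * real (Suc k) - 1) / real (Suc k) = s - inverse (real (Suc k))" for k
        by (simp add: field_simps)
      moreover have "s * real (Suc k) - 1 \<le> real_of_int \<lfloor>s * real (Suc k)\<rfloor>" for k by linarith
      ultimately have "s - inverse (real (Suc k)) \<le> real_of_int \<lfloor>s * real (Suc k)\<rfloor> / real (Suc k)" for k
        by (metis divide_right_mono of_nat_0_le_iff)
      then show "\<forall>\<^sub>F k in sequentially. s - inverse (real (Suc k)) \<le> real_of_int \<lfloor>s * real (Suc k)\<rfloor> / real (Suc k)"
        by simp
      have "real_of_int \<lfloor>s * real (Suc k)\<rfloor> / real (Suc k) \<le> s" for k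
        by (simp add: pos_divide_le_eq)
      then show "\<forall>\<^sub>F k in sequentially. real_of_int \<lfloor>s * real (Suc k)\<rfloor> / real (Suc k) \<le> s"
        by simp
      show "(\<lambda>k. s - inverse (real (Suc k))) \<longlonglongrightarrow> s"
        using tendsto_diff[OF tendsto_const LIMSEQ_inverse_real_of_nat, of s] by simp
    qed simp
    then have "(\<lambda>k. f (real_of_int \<lfloor>s * real (Suc k)\<rfloor> / real (Suc k)) x) \<longlonglongrightarrow> f s x"
      by (rule continuous_on_tendsto_compose[OF cont[OF p(2)]]) simp_all
    then show "(\<lambda>k. g k p) \<longlonglongrightarrow> (case p of (s, x) \<Rightarrow> f s x)" by (simp add: g_def p)
  qed
qed

section \<open>Fourier modes of a bounded Dirichlet harmonic function\<close>

locale bounded_dirichlet_harmonic = dirichlet_spectrum K S F \<pi> r D lam \<phi>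
  for K :: "'a::metric_space set" and S :: "'i set" and F \<pi> r D
    and lam :: "nat \<Rightarrow> real" and \<phi> :: "nat \<Rightarrow> 'a \<Rightarrow> real" +
  fixes u :: "real \<Rightarrow> 'a \<Rightarrow> real" and B :: real
  assumes dirichlet_harmonic: "dirichlet_harmonic u"
    and bound: "\<And>t x. 0 < t \<Longrightarrow> x \<in> K \<Longrightarrow> \<bar>u t x\<bar> \<le> B"
begin

definition u_tt :: "real \<Rightarrow> 'a \<Rightarrow> real" where
  "u_tt t x = deriv (deriv (\<lambda>s. u s x)) t"

definition mode :: "nat \<Rightarrow> real \<Rightarrow> real" where
  "mode n t = fourier (u t) n"

lemma u_form_dom0: "0 < t \<Longrightarrow> u t \<in> form_dom0"
  using dirichlet_harmonic
  by (auto simp: dirichlet_harmonic_def harmonic_def has_laplacian_def form_dom0_def)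

lemma u_continuous: "0 < t \<Longrightarrow> continuous_on K (u t)"
  by (intro form_dom_continuous form_dom0_form_dom u_form_dom0)

lemma u_square_integrable: "0 < t \<Longrightarrow> square_integrable mu (u t)"
  by (intro form_dom0_square_integrable u_form_dom0)

lemma C2: "x \<in> K \<Longrightarrow> C2_pos (\<lambda>t. u t x)"
  using dirichlet_harmonic by (auto simp: dirichlet_harmonic_def harmonic_def)

lemma u_derivatives:
  assumes "x \<in> K" "0 < t"
  shows "((\<lambda>s. u s x) has_real_derivative deriv (\<lambda>s. u s x) t) (at t)"
    "(deriv (\<lambda>s. u s x) has_real_derivative u_tt t x) (at t)"
  using C2[OF assms(1)] assms(2)
  by (auto simp: C2_pos_def u_tt_def DERIV_deriv_iff_real_differentiable)

lemma u_tt_continuous: "x \<in> K \<Longrightarrow> continuous_on {0<..} (\<lambda>t. u_tt t x)"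
  using C2[of x] by (simp add: C2_pos_def u_tt_def[abs_def])

lemma u_tt_boundary:
  assumes p: "p \<in> V0" and t: "0 < t"
  shows "u_tt t p = 0"
proof -
  have zero: "deriv f s = 0" if "\<And>s. 0 < s \<Longrightarrow> f s = 0" "0 < s" for f :: "real \<Rightarrow> real" and s
  proof -
    have "\<forall>\<^sub>F s in nhds s. f s = 0"
      using eventually_nhds_in_open[of "{0<..}" s] that by (auto elim: eventually_mono)
    then have "deriv f s = deriv (\<lambda>_. 0) s" by (rule deriv_cong_ev) simp
    then show ?thesis by simp
  qed
  have "u s p = 0" if "0 < s" for s
    using dirichlet_harmonic p that by (simp add: dirichlet_harmonic_def)
  then have "deriv (\<lambda>s. u s p) s = 0" if "0 < s" for s
    using zero[of "\<lambda>s. u s p"] that by blast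
  then show ?thesis unfolding u_tt_def using zero t by blast
qed

text \<open>On the boundary \<open>u_tt\<close> vanishes, because \<open>u\<close> does for all times, whereas the Laplacian need not. The
difference is invisible to the coefficients, since the eigenfunctions vanish there as well.\<close>

lemma u_tt_eq_laplacian:
  assumes t: "0 < t"
  obtains g where "has_laplacian (u t) g" "\<And>x. x \<in> K \<Longrightarrow> u_tt t x = (if x \<in> V0 then 0 else - g x)"
proof -
  obtain g where g: "has_laplacian (u t) g" "\<forall>x\<in>K - V0. deriv (deriv (\<lambda>s. u s x)) t + g x = 0"
    using dirichlet_harmonic t unfolding dirichlet_harmonic_def harmonic_def by blast
  show thesis
  proof (rule that[OF g(1)])
    fix x assume "x \<in> K"
    then show "u_tt t x = (if x \<in> V0 then 0 else - g x)"
      using u_tt_boundary[OF _ t] g(2) by (auto simp: u_tt_def eq_neg_iff_add_eq_0)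
  qed
qed

lemma u_tt_square_integrable:
  assumes t: "0 < t"
  shows "square_integrable mu (u_tt t)"
proof -
  obtain g where g: "has_laplacian (u t) g" "\<And>x. x \<in> K \<Longrightarrow> u_tt t x = (if x \<in> V0 then 0 else - g x)"
    using u_tt_eq_laplacian[OF t] by blast
  have cont: "continuous_on K g" using g(1) by (simp add: has_laplacian_def)
  have [measurable]: "g \<in> borel_measurable mu" by (rule continuous_imp_measurable[OF cont])
  have "closed V0" by (rule finite_imp_closed) (rule pcf)
  then have "V0 \<in> sets (restrict_space borel K)"
    using V0_subset_K by (auto simp: sets_restrict_space intro!: image_eqI[of _ _ V0])
  then have [measurable]: "V0 \<in> sets mu" by (simp add: sets_mu)
  have "(\<lambda>x. if x \<in> V0 then 0 else - g x) \<in> borel_measurable mu" by measurable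
  then have meas: "u_tt t \<in> borel_measurable mu"
    by (rule measurable_cong[THEN iffD1, rotated]) (simp add: g(2))
  obtain C where C: "\<And>x. x \<in> K \<Longrightarrow> \<bar>g x\<bar> \<le> C" using continuous_bounded[OF cont] by blast
  show ?thesis
  proof (rule bounded_square_integrable[OF meas])
    show "\<bar>u_tt t x\<bar> \<le> C" if "x \<in> K" for x
      using C[OF that] order_trans[OF abs_ge_zero C[OF that]] by (simp add: g(2)[OF that])
  qed
qed

lemma fourier_u_tt:
  assumes t: "0 < t"
  shows "fourier (u_tt t) n = lam n * mode n t"
proof -
  obtain g where g: "has_laplacian (u t) g" "\<And>x. x \<in> K \<Longrightarrow> u_tt t x = (if x \<in> V0 then 0 else - g x)"
    using u_tt_eq_laplacian[OF t] by blast
  have "fourier (u_tt t) n = (LINT x|mu. - (g x * \<phi> n x))"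
    unfolding fourier_def
  proof (rule Bochner_Integration.integral_cong[OF refl])
    fix x assume "x \<in> space mu"
    then show "u_tt t x * \<phi> n x = - (g x * \<phi> n x)"
      using eigenfunction_form_dom0[of n] by (auto simp: g(2) form_dom0_def)
  qed
  also have "\<dots> = energy (u t) (\<phi> n)"
    using g(1) eigenfunction_form_dom0[of n] by (simp add: has_laplacian_def)
  also have "\<dots> = lam n * mode n t"
    using energy_eigenfunction[OF u_form_dom0[OF t]] by (simp add: energy_sym[of "u t"] mode_def)
  finally show ?thesis .
qed

lemma mode_abs_le: "0 < t \<Longrightarrow> \<bar>mode n t\<bar> \<le> B"
proof -
  assume t: "0 < t"
  have "0 \<le> B"
  proof -
    obtain p where "p \<in> V0" using pcf by blast
    then have "p \<in> K" using V0_subset_K by blast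
    then show ?thesis using bound[OF t] abs_ge_zero order_trans by blast
  qed
  have "(mode n t)\<^sup>2 \<le> (LINT x|mu. (u t x)\<^sup>2)"
    unfolding mode_def by (rule fourier_sq_le[OF u_square_integrable[OF t]])
  also have "\<dots> \<le> B\<^sup>2"
    by (rule integral_square_le[OF continuous_imp_measurable[OF u_continuous[OF t]] bound[OF t]])
  finally show ?thesis using \<open>0 \<le> B\<close> unfolding abs_le_square_iff[symmetric] by simp
qed

lemma mode_continuous: "continuous_on {0<..} (mode n)"
  unfolding continuous_on_sequentially
proof (intro ballI allI impI)
  fix X :: "nat \<Rightarrow> real" and t :: real
  assume t: "t \<in> {0<..}" and "(\<forall>k. X k \<in> {0<..}) \<and> X \<longlonglongrightarrow> t"
  then have X: "\<And>k. 0 < X k" "X \<longlonglongrightarrow> t" by auto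
  have t0: "0 < t" using t by simp
  have \<phi>_meas: "\<phi> n \<in> borel_measurable mu"
    by (rule square_integrable_measurable[OF basis_square_integrable])
  have u_meas: "u s \<in> borel_measurable mu" if "0 < s" for s
    by (rule square_integrable_measurable[OF u_square_integrable[OF that]])
  have "(\<lambda>k. LINT x|mu. u (X k) x * \<phi> n x) \<longlonglongrightarrow> (LINT x|mu. u t x * \<phi> n x)"
  proof (rule integral_dominated_convergence[where w = "\<lambda>x. B * \<bar>\<phi> n x\<bar>"])
    show "(\<lambda>x. u t x * \<phi> n x) \<in> borel_measurable mu" "\<And>k. (\<lambda>x. u (X k) x * \<phi> n x) \<in> borel_measurable mu"
      by (intro borel_measurable_times u_meas \<phi>_meas t0 X)+
    have "integrable mu (\<phi> n)"
      using basis_square_integrable[of n]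
      by (auto simp: square_integrable_def intro: square_integrable_imp_integrable[of "\<phi> n"])
    then show "integrable mu (\<lambda>x. B * \<bar>\<phi> n x\<bar>)" by simp
    show "AE x in mu. (\<lambda>k. u (X k) x * \<phi> n x) \<longlonglongrightarrow> u t x * \<phi> n x"
    proof (rule AE_I2)
      fix x assume "x \<in> space mu"
      then have "isCont (\<lambda>s. u s x) t" using u_derivatives(1)[OF _ t0] by (auto intro: DERIV_isCont)
      then show "(\<lambda>k. u (X k) x * \<phi> n x) \<longlonglongrightarrow> u t x * \<phi> n x"
        by (intro tendsto_intros isCont_tendsto_compose[OF _ X(2)])
    qed
    show "AE x in mu. norm (u (X k) x * \<phi> n x) \<le> B * \<bar>\<phi> n x\<bar>" for k
      using bound[OF X(1)] by (intro AE_I2) (simp add: abs_mult mult_right_mono)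
  qed
  then show "(mode n \<circ> X) \<longlonglongrightarrow> mode n t" by (simp add: mode_def[abs_def] fourier_def comp_def)
qed

lemma norm_u_tt_le:
  assumes "0 < t" "\<And>N. (\<Sum>n<N. (lam n)\<^sup>2 * (mode n t)\<^sup>2) \<le> C"
  shows "(LINT x|mu. (u_tt t x)\<^sup>2) \<le> C"
  using assms
  by (intro parseval_le u_tt_square_integrable) (simp_all add: fourier_u_tt power_mult_distrib)

text \<open>The interchange of integrals for \<open>u(t + h) - 2 u(t) + u(t - h)\<close>, written as an average of \<open>u_tt\<close>. The
bound \<open>C\<close> on the L2 norm of \<open>u_tt\<close>, uniform over the time window, makes the integrand integrable on the product.\<close>

lemma second_difference_coefficient:
  assumes h: "0 < h" "h < t"
    and C: "\<And>s N. \<bar>s - t\<bar> \<le> h \<Longrightarrow> (\<Sum>n<N. (lam n)\<^sup>2 * (mode n s)\<^sup>2) \<le> C"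
  shows "mode n (t + h) - 2 * mode n t + mode n (t - h)
    = (LINT s|lborel. indicator {0..h} s * ((h - s) * (lam n * mode n (t + s) + lam n * mode n (t - s))))"
proof -
  \<comment> \<open>Clamping the time keeps it positive, so that \<open>g\<close> is continuous in time on the whole line.\<close>
  define g where "g = (\<lambda>s x. u_tt (max (t - h) s) x)"
  define H where "H = (\<lambda>s x. indicator {0..h} s * ((h - s) * (g (t + s) x + g (t - s) x)) * \<phi> n x)"
  have pos: "0 < max (t - h) s" for s using h by simp
  have \<phi>_meas[measurable]: "\<phi> n \<in> borel_measurable mu"
    by (rule square_integrable_measurable[OF basis_square_integrable])
  have g_sq: "square_integrable mu (g s)" for s
    unfolding g_def by (rule u_tt_square_integrable[OF pos])
  have g_meas[measurable]: "g s \<in> borel_measurable mu" for s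
    by (rule square_integrable_measurable[OF g_sq])
  have g_cont: "continuous_on UNIV (\<lambda>s. g s x)" if "x \<in> K" for x
    unfolding g_def
    by (rule continuous_on_compose2[OF u_tt_continuous[OF that]]) (use pos in \<open>auto intro!: continuous_intros\<close>)
  have in_range: "\<bar>max (t - h) s - t\<bar> \<le> h" if "\<bar>s - t\<bar> \<le> h" for s using that h by auto
  have g_eq: "g s = u_tt s" if "\<bar>s - t\<bar> \<le> h" for s
  proof -
    have "max (t - h) s = s" using that by auto
    then show ?thesis by (simp add: g_def)
  qed
  have g_norm: "(LINT x|mu. (g s x)\<^sup>2) \<le> C" if "\<bar>s - t\<bar> \<le> h" for s
    using norm_u_tt_le[OF _ C[OF that]] that h unfolding g_eq[OF that] by auto
  have mu_sigma_finite: "sigma_finite_measure mu" by unfold_locales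
  interpret pair_sigma_finite lborel mu ..
  have H_meas: "(\<lambda>(s, x). H s x) \<in> borel_measurable (lborel \<Otimes>\<^sub>M mu)"
  proof -
    have "(\<lambda>(s, x). g (t + s) x) \<in> borel_measurable (lborel \<Otimes>\<^sub>M mu)"
      "(\<lambda>(s, x). g (t - s) x) \<in> borel_measurable (lborel \<Otimes>\<^sub>M mu)"
      by (rule caratheodory_measurable;
          use g_meas in \<open>auto intro!: continuous_on_compose2[OF g_cont] continuous_intros\<close>)+
    note [measurable] = this
    have "(\<lambda>p. indicator {0..h} (fst p) * ((h - fst p) *
        ((\<lambda>(s, x). g (t + s) x) p + (\<lambda>(s, x). g (t - s) x) p)) * \<phi> n (snd p)) \<in> borel_measurable (lborel \<Otimes>\<^sub>M mu)"
      by measurable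
    then show ?thesis by (simp add: H_def case_prod_unfold)
  qed
  have H_int: "integrable mu (H s)" for s
  proof -
    have "integrable mu (\<lambda>x. (indicator {0..h} s * (h - s)) * (g (t + s) x * \<phi> n x + g (t - s) x * \<phi> n x))"
      by (intro integrable_mult_right Bochner_Integration.integrable_add square_integrable_mult g_sq basis_square_integrable)
    then show ?thesis by (simp add: H_def algebra_simps)
  qed
  have gphi: "(LINT x|mu. \<bar>g s x * \<phi> n x\<bar>) \<le> (C + 1) / 2" if "\<bar>s - t\<bar> \<le> h" for s
  proof -
    have "(LINT x|mu. \<bar>g s x * \<phi> n x\<bar>) \<le> (LINT x|mu. ((g s x)\<^sup>2 + (\<phi> n x)\<^sup>2) / 2)"
    proof (rule Bochner_Integration.integral_mono)
      show "integrable mu (\<lambda>x. \<bar>g s x * \<phi> n x\<bar>)"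
        by (intro integrable_abs square_integrable_mult g_sq basis_square_integrable)
      show "integrable mu (\<lambda>x. ((g s x)\<^sup>2 + (\<phi> n x)\<^sup>2) / 2)"
        using g_sq[of s] basis_square_integrable[of n] by (simp add: square_integrable_def)
      show "\<bar>g s x * \<phi> n x\<bar> \<le> ((g s x)\<^sup>2 + (\<phi> n x)\<^sup>2) / 2" for x
        using sum_squares_bound[of "\<bar>g s x\<bar>" "\<bar>\<phi> n x\<bar>"] by (simp add: abs_mult)
    qed
    also have "\<dots> = ((LINT x|mu. (g s x)\<^sup>2) + (LINT x|mu. \<phi> n x * \<phi> n x)) / 2"
      using g_sq[of s] basis_square_integrable[of n] by (simp add: square_integrable_def power2_eq_square)
    also have "\<dots> \<le> (C + 1) / 2" using g_norm[OF that] by (simp add: orthonormal)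
    finally show ?thesis .
  qed
  have H_norm: "(LINT x|mu. \<bar>H s x\<bar>) \<le> indicator {0..h} s * (h * (C + 1))" for s
  proof (cases "s \<in> {0..h}")
    case True
    then have s: "0 \<le> s" "s \<le> h" by auto
    have "(LINT x|mu. \<bar>H s x\<bar>) \<le> (LINT x|mu. h * (\<bar>g (t + s) x * \<phi> n x\<bar> + \<bar>g (t - s) x * \<phi> n x\<bar>))"
    proof (rule Bochner_Integration.integral_mono)
      show "integrable mu (\<lambda>x. \<bar>H s x\<bar>)" by (intro integrable_abs H_int)
      show "integrable mu (\<lambda>x. h * (\<bar>g (t + s) x * \<phi> n x\<bar> + \<bar>g (t - s) x * \<phi> n x\<bar>))"
        by (intro integrable_mult_right Bochner_Integration.integrable_add integrable_abs square_integrable_mult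
            g_sq basis_square_integrable)
      show "\<bar>H s x\<bar> \<le> h * (\<bar>g (t + s) x * \<phi> n x\<bar> + \<bar>g (t - s) x * \<phi> n x\<bar>)" for x
      proof -
        have "\<bar>H s x\<bar> = (h - s) * \<bar>g (t + s) x * \<phi> n x + g (t - s) x * \<phi> n x\<bar>"
        proof -
          have "H s x = (h - s) * (g (t + s) x * \<phi> n x + g (t - s) x * \<phi> n x)"
            using True by (simp add: H_def distrib_right mult.assoc)
          then show ?thesis using s by (simp add: abs_mult)
        qed
        also have "\<dots> \<le> h * (\<bar>g (t + s) x * \<phi> n x\<bar> + \<bar>g (t - s) x * \<phi> n x\<bar>)"
          using s by (intro mult_mono abs_triangle_ineq) auto
        finally show ?thesis .
      qed
    qed
    also have "\<dots> = h * ((LINT x|mu. \<bar>g (t + s) x * \<phi> n x\<bar>) + (LINT x|mu. \<bar>g (t - s) x * \<phi> n x\<bar>))"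
      by (subst integral_mult_right_zero, subst Bochner_Integration.integral_add)
        (auto intro!: integrable_abs square_integrable_mult g_sq basis_square_integrable)
    also have "\<dots> \<le> h * ((C + 1) / 2 + (C + 1) / 2)"
      using s h by (intro mult_left_mono add_mono gphi) auto
    finally show ?thesis using True by simp
  qed (simp add: H_def)
  have H_integrable: "integrable (lborel \<Otimes>\<^sub>M mu) (\<lambda>(s, x). H s x)"
  proof (rule Fubini_integrable[OF H_meas])
    show "AE s in lborel. integrable mu (\<lambda>x. case (s, x) of (s, x) \<Rightarrow> H s x)" by (simp add: H_int)
    show "integrable lborel (\<lambda>s. LINT x|mu. norm (case (s, x) of (s, x) \<Rightarrow> H s x))"
    proof (rule Bochner_Integration.integrable_bound[where f = "\<lambda>s. indicator {0..h} s * (h * (C + 1))"])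
      show "integrable lborel (\<lambda>s. indicator {0..h} s * (h * (C + 1)))"
        by (intro integrable_mult_left integrable_real_indicator) (use h in simp_all)
      have "(\<lambda>p. norm ((\<lambda>(s, x). H s x) p)) \<in> borel_measurable (lborel \<Otimes>\<^sub>M mu)"
        by (rule measurable_compose[OF H_meas borel_measurable_norm])
      then show "(\<lambda>s. LINT x|mu. norm (case (s, x) of (s, x) \<Rightarrow> H s x)) \<in> borel_measurable lborel"
        by (intro sigma_finite_measure.borel_measurable_lebesgue_integral[OF mu_sigma_finite])
          (simp add: case_prod_unfold)
      show "AE s in lborel. norm (LINT x|mu. norm (case (s, x) of (s, x) \<Rightarrow> H s x))
          \<le> norm (indicator {0..h} s * (h * (C + 1)))"
      proof (rule AE_I2)
        fix s
        have "0 \<le> (LINT x|mu. \<bar>H s x\<bar>)" by simp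
        then show "norm (LINT x|mu. norm (case (s, x) of (s, x) \<Rightarrow> H s x)) \<le> norm (indicator {0..h} s * (h * (C + 1)))"
          using H_norm[of s] unfolding prod.case real_norm_def by linarith
      qed
    qed
  qed
  have "mode n (t + h) - 2 * mode n t + mode n (t - h) = (LINT x|mu. (u (t + h) x - 2 * u t x + u (t - h) x) * \<phi> n x)"
  proof -
    have int: "integrable mu (\<lambda>x. u s x * \<phi> n x)" if "0 < s" for s
      by (intro square_integrable_mult u_square_integrable basis_square_integrable that)
    have i3: "integrable mu (\<lambda>x. u (t + h) x * \<phi> n x)" "integrable mu (\<lambda>x. u t x * \<phi> n x)"
        "integrable mu (\<lambda>x. u (t - h) x * \<phi> n x)"
      using h by (auto intro!: int)
    have "(LINT x|mu. (u (t + h) x - 2 * u t x + u (t - h) x) * \<phi> n x)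
        = (LINT x|mu. u (t + h) x * \<phi> n x - 2 * (u t x * \<phi> n x) + u (t - h) x * \<phi> n x)"
      by (simp add: algebra_simps)
    also have "\<dots> = mode n (t + h) - 2 * mode n t + mode n (t - h)"
      using i3 by (simp add: mode_def fourier_def)
    finally show ?thesis by simp
  qed
  also have "\<dots> = (LINT x|mu. LINT s|lborel. H s x)"
  proof (rule Bochner_Integration.integral_cong[OF refl])
    fix x assume "x \<in> space mu"
    then have x: "x \<in> K" by simp
    have "u (t + h) x - 2 * u t x + u (t - h) x
        = (LINT s|lborel. indicator {0..h} s * ((h - s) * (u_tt (t + s) x + u_tt (t - s) x)))"
    proof (rule second_difference_as_integral)
      show "continuous_on {t - h..t + h} (\<lambda>t. u_tt t x)"
        by (rule continuous_on_subset[OF u_tt_continuous[OF x]]) (use h in auto)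
    qed (use h in \<open>auto intro!: u_derivatives x\<close>)
    also have "\<dots> = (LINT s|lborel. indicator {0..h} s * ((h - s) * (g (t + s) x + g (t - s) x)))"
    proof (rule Bochner_Integration.integral_cong[OF refl])
      show "indicator {0..h} s * ((h - s) * (u_tt (t + s) x + u_tt (t - s) x))
          = indicator {0..h} s * ((h - s) * (g (t + s) x + g (t - s) x))" for s
        by (cases "s \<in> {0..h}") (simp_all add: g_eq)
    qed
    finally show "(u (t + h) x - 2 * u t x + u (t - h) x) * \<phi> n x = (LINT s|lborel. H s x)"
      by (simp add: H_def)
  qed
  also have "\<dots> = (LINT s|lborel. LINT x|mu. H s x)"
    using Fubini_integral[OF H_integrable] by simp
  also have "\<dots> = (LINT s|lborel. indicator {0..h} s * ((h - s) * (lam n * mode n (t + s) + lam n * mode n (t - s))))"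
  proof (rule Bochner_Integration.integral_cong[OF refl])
    fix s
    show "(LINT x|mu. H s x) = indicator {0..h} s * ((h - s) * (lam n * mode n (t + s) + lam n * mode n (t - s)))"
    proof (cases "s \<in> {0..h}")
      case True
      then have s: "0 < t + s" "0 < t - s" "\<bar>t + s - t\<bar> \<le> h" "\<bar>t - s - t\<bar> \<le> h" using h by auto
      have "(LINT x|mu. H s x)
          = (LINT x|mu. (h - s) * (u_tt (t + s) x * \<phi> n x + u_tt (t - s) x * \<phi> n x))"
        unfolding H_def g_eq[OF s(3)] g_eq[OF s(4)] using True by (simp add: distrib_right mult.assoc)
      also have "\<dots> = (h - s) * ((LINT x|mu. u_tt (t + s) x * \<phi> n x) + (LINT x|mu. u_tt (t - s) x * \<phi> n x))"
        by (subst integral_mult_right_zero, subst Bochner_Integration.integral_add)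
          (auto intro!: square_integrable_mult u_tt_square_integrable basis_square_integrable s)
      also have "\<dots> = (h - s) * (lam n * mode n (t + s) + lam n * mode n (t - s))"
        using fourier_u_tt[OF s(1), of n] fourier_u_tt[OF s(2), of n] by (simp add: fourier_def)
      finally show ?thesis using True by simp
    qed (simp add: H_def)
  qed
  finally show ?thesis .
qed

lemma mode_sym_deriv2:
  assumes t: "0 < t"
  shows "has_sym_deriv2 (mode n) (lam n * mode n t) t"
proof (rule sym_deriv2_from_local_bounds[where a = "t / 2" and b = "2 * t" and w = "\<lambda>n. (lam n)\<^sup>2"])
  show "continuous_on {t / 2..2 * t} (mode n)" for n
    by (rule continuous_on_subset[OF mode_continuous]) (use t in auto)
  show "\<exists>C. \<forall>N. (\<Sum>n<N. (lam n)\<^sup>2 * (mode n s)\<^sup>2) \<le> C" if "s \<in> {t / 2..2 * t}" for s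
  proof -
    have s: "0 < s" using that t by auto
    have "(\<Sum>n<N. (lam n)\<^sup>2 * (mode n s)\<^sup>2) \<le> (LINT x|mu. (u_tt s x)\<^sup>2)" for N
      using bessel[OF u_tt_square_integrable[OF s], of N] by (simp add: fourier_u_tt[OF s] power_mult_distrib)
    then show ?thesis by blast
  qed
  show "has_sym_deriv2 (mode n) (lam n * mode n s) s"
    if s: "s \<in> {t / 2<..<2 * t}" and e: "0 < e"
      and C: "\<And>r N. r \<in> {t / 2..2 * t} \<Longrightarrow> \<bar>r - s\<bar> < e \<Longrightarrow> (\<Sum>n<N. (lam n)\<^sup>2 * (mode n r)\<^sup>2) \<le> C"
    for n s C e
  proof -
    define d where "d = min e (min (s - t / 2) (2 * t - s))"
    have d: "0 < d" "d \<le> e" "d \<le> s - t / 2" "d \<le> 2 * t - s" using s e by (auto simp: d_def)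
    show ?thesis
    proof (rule sym_deriv2_of_average[OF _ d(1)])
      show "continuous_on {s - d..s + d} (\<lambda>s. lam n * mode n s)"
        by (intro continuous_intros continuous_on_subset[OF mode_continuous]) (use t d in auto)
      show "mode n (s + h) - 2 * mode n s + mode n (s - h)
          = (LINT r|lborel. indicator {0..h} r * ((h - r) * (lam n * mode n (s + r) + lam n * mode n (s - r))))"
        if h: "0 < h" "h < d" for h
      proof (rule second_difference_coefficient[OF h(1)])
        show "h < s" using h d t by linarith
        show "(\<Sum>n<N. (lam n)\<^sup>2 * (mode n r)\<^sup>2) \<le> C" if "\<bar>r - s\<bar> \<le> h" for r N
          using that h d by (intro C) (auto simp: abs_le_iff)
      qed
    qed
  qed
qed (use t lam_pos in auto)

end

section \<open>The boundary value and its Poisson integral\<close>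

context bounded_dirichlet_harmonic
begin

text \<open>The limit of the mode at time 0, extrapolated from time 1.\<close>

definition boundary_coeff :: "nat \<Rightarrow> real" where
  "boundary_coeff n = mode n 1 * exp (sqrt (lam n))"

lemma mode_eq:
  assumes t: "0 < t"
  shows "mode n t = boundary_coeff n * exp (- sqrt (lam n) * t)"
proof (cases "1 \<le> t")
  case True
  have "mode n t = mode n 1 * exp (- sqrt (lam n) * (t - 1))"
    by (rule bounded_sym_deriv2_eq[OF mode_continuous mode_sym_deriv2 lam_pos mode_abs_le _ True]) simp_all
  then show ?thesis by (simp add: boundary_coeff_def exp_add[symmetric] algebra_simps)
next
  case False
  then have "mode n 1 = mode n t * exp (- sqrt (lam n) * (1 - t))"
    by (intro bounded_sym_deriv2_eq[OF mode_continuous mode_sym_deriv2 lam_pos mode_abs_le t]) simp_all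
  then show ?thesis by (simp add: boundary_coeff_def mult.assoc exp_add[symmetric] algebra_simps)
qed

lemma boundary_coeff_square_sum_le: "(\<Sum>n<N. (boundary_coeff n)\<^sup>2) \<le> B\<^sup>2"
proof -
  have "((\<lambda>t. \<Sum>n<N. (boundary_coeff n * exp (- sqrt (lam n) * t))\<^sup>2) \<longlongrightarrow> (\<Sum>n<N. (boundary_coeff n * exp (- sqrt (lam n) * 0))\<^sup>2)) (at_right 0)"
    by (intro tendsto_intros)
  moreover have "\<forall>\<^sub>F t in at_right 0. (\<Sum>n<N. (boundary_coeff n * exp (- sqrt (lam n) * t))\<^sup>2) \<le> B\<^sup>2"
  proof (rule eventually_at_right_less[THEN eventually_mono])
    fix t :: real assume t: "0 < t"
    have "(\<Sum>n<N. (boundary_coeff n * exp (- sqrt (lam n) * t))\<^sup>2) = (\<Sum>n<N. (fourier (u t) n)\<^sup>2)"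
      by (simp only: mode_eq[OF t, symmetric] mode_def)
    also have "\<dots> \<le> (LINT x|mu. (u t x)\<^sup>2)" by (rule bessel[OF u_square_integrable[OF t]])
    also have "\<dots> \<le> B\<^sup>2"
      by (rule integral_square_le[OF continuous_imp_measurable[OF u_continuous[OF t]] bound[OF t]])
    finally show "(\<Sum>n<N. (boundary_coeff n * exp (- sqrt (lam n) * t))\<^sup>2) \<le> B\<^sup>2" .
  qed
  ultimately have "(\<Sum>n<N. (boundary_coeff n * exp (- sqrt (lam n) * 0))\<^sup>2) \<le> B\<^sup>2"
    by (rule tendsto_upperbound) simp
  then show ?thesis by simp
qed

lemma boundary_coeff_square_summable: "summable (\<lambda>n. (boundary_coeff n)\<^sup>2)"
proof (rule bounded_imp_summable[where B = "B\<^sup>2"])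
  show "(\<Sum>n\<le>N. (boundary_coeff n)\<^sup>2) \<le> B\<^sup>2" for N
    using boundary_coeff_square_sum_le[of "Suc N"] by (simp only: lessThan_Suc_atMost)
qed simp

text \<open>The excess of \<open>\<bar>f\<bar>\<close> over \<open>B\<close> is at most \<open>\<bar>f - u(t)\<bar>\<close> at every point, and the L2 norm of \<open>f - u(t)\<close>
tends to 0 with \<open>t\<close>, by Parseval and dominated convergence of the series.\<close>

lemma boundary_value_AE_bounded:
  assumes f: "square_integrable mu f" and fc: "\<And>n. fourier f n = boundary_coeff n"
  shows "AE x in mu. \<bar>f x\<bar> \<le> B"
proof -
  define t where "t = (\<lambda>k. inverse (real (Suc k)))"
  have t: "0 < t k" for k by (simp add: t_def)
  have t_lim: "t \<longlonglongrightarrow> 0" unfolding t_def by (rule LIMSEQ_inverse_real_of_nat)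
  define d where "d = (\<lambda>n k. (boundary_coeff n - boundary_coeff n * exp (- sqrt (lam n) * t k))\<^sup>2)"
  have d_le: "d n k \<le> (boundary_coeff n)\<^sup>2" for n k
  proof -
    have "0 \<le> sqrt (lam n) * t k" using lam_pos[of n] t[of k] by (simp add: less_imp_le)
    then have e: "0 \<le> 1 - exp (- sqrt (lam n) * t k)" "1 - exp (- sqrt (lam n) * t k) \<le> 1" by simp_all
    have "d n k = (boundary_coeff n)\<^sup>2 * (1 - exp (- sqrt (lam n) * t k))\<^sup>2"
      unfolding d_def by (simp add: power_mult_distrib[symmetric] right_diff_distrib)
    also have "\<dots> \<le> (boundary_coeff n)\<^sup>2 * 1\<^sup>2"
      using e by (intro mult_left_mono power_mono) auto
    finally show ?thesis by simp
  qed
  have d_lim: "(\<lambda>k. d n k) \<longlonglongrightarrow> 0" for n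
  proof -
    have "(\<lambda>k. d n k) \<longlonglongrightarrow> (boundary_coeff n - boundary_coeff n * exp (- sqrt (lam n) * 0))\<^sup>2"
      unfolding d_def by (intro tendsto_intros t_lim)
    then show ?thesis by simp
  qed
  have "(\<lambda>k. \<Sum>n. d n k) \<longlonglongrightarrow> (\<Sum>n. 0)"
  proof (rule tannerys_theorem[THEN conjunct2, THEN conjunct2, OF d_lim _ boundary_coeff_square_summable])
    show "\<forall>\<^sub>F (n, k) in sequentially \<times>\<^sub>F sequentially. norm (d n k) \<le> (boundary_coeff n)\<^sup>2"
      using d_le by (intro always_eventually) (auto simp: d_def)
  qed simp
  then have lim: "(\<lambda>k. \<Sum>n. d n k) \<longlonglongrightarrow> 0" by simp
  define w where "w = (\<lambda>x. max 0 (\<bar>f x\<bar> - B))"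
  have f_meas[measurable]: "f \<in> borel_measurable mu" by (rule square_integrable_measurable[OF f])
  have diff_sq: "square_integrable mu (\<lambda>x. f x - u (t k) x)" for k
    by (intro square_integrable_diff f u_square_integrable t)
  have diff_int: "integrable mu (\<lambda>x. (f x - u (t k) x)\<^sup>2)" for k
    using diff_sq[of k] by (simp add: square_integrable_def)
  have w_le: "(w x)\<^sup>2 \<le> (f x - u (t k) x)\<^sup>2" if "x \<in> K" for x k
  proof -
    have "\<bar>w x\<bar> \<le> \<bar>f x - u (t k) x\<bar>" using bound[OF t that, of k] unfolding w_def by linarith
    then show ?thesis by (simp only: abs_le_square_iff)
  qed
  have w_int: "integrable mu (\<lambda>x. (w x)\<^sup>2)"
  proof (rule Bochner_Integration.integrable_bound[OF diff_int[of 0]])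
    show "(\<lambda>x. (w x)\<^sup>2) \<in> borel_measurable mu" unfolding w_def by measurable
    show "AE x in mu. norm ((w x)\<^sup>2) \<le> norm ((f x - u (t 0) x)\<^sup>2)"
      using w_le by (intro AE_I2) simp
  qed
  have "(LINT x|mu. (w x)\<^sup>2) \<le> (\<Sum>n. d n k)" for k
  proof -
    have sm: "summable (\<lambda>n. d n k)"
      by (rule summable_comparison_test'[OF boundary_coeff_square_summable]) (use d_le in \<open>simp add: d_def\<close>)
    have "(LINT x|mu. (w x)\<^sup>2) \<le> (LINT x|mu. (f x - u (t k) x)\<^sup>2)"
      by (rule Bochner_Integration.integral_mono[OF w_int diff_int]) (simp add: w_le)
    also have "\<dots> \<le> (\<Sum>n. d n k)"
    proof (rule parseval_le[OF diff_sq])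
      have "fourier (\<lambda>x. f x - u (t k) x) n = boundary_coeff n - boundary_coeff n * exp (- sqrt (lam n) * t k)" for n
        unfolding fourier_diff[OF f u_square_integrable[OF t]] fc mode_def[symmetric] mode_eq[OF t] ..
      then have "(\<Sum>n<N. (fourier (\<lambda>x. f x - u (t k) x) n)\<^sup>2) = (\<Sum>n<N. d n k)" for N
        by (simp only: d_def)
      also have "(\<Sum>n<N. d n k) \<le> (\<Sum>n. d n k)" for N
        by (rule sum_le_suminf[OF sm]) (simp_all add: d_def)
      finally show "(\<Sum>n<N. (fourier (\<lambda>x. f x - u (t k) x) n)\<^sup>2) \<le> (\<Sum>n. d n k)" for N .
    qed
    finally show ?thesis .
  qed
  then have "(LINT x|mu. (w x)\<^sup>2) \<le> 0"
    using LIMSEQ_le_const[OF lim] by blast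
  moreover have "0 \<le> (LINT x|mu. (w x)\<^sup>2)" by simp
  ultimately have "(LINT x|mu. (w x)\<^sup>2) = 0" by linarith
  then have "AE x in mu. (w x)\<^sup>2 = 0"
    by (subst (asm) integral_nonneg_eq_0_iff_AE[OF w_int]) simp_all
  then show ?thesis
  proof eventually_elim
    case (elim x)
    then have "w x = 0" by simp
    then show ?case unfolding w_def by linarith
  qed
qed

text \<open>Trades the exponential factor of the Poisson kernel for the weight \<open>1 / \<lambda>\<^sub>n\<close> of the Green function.\<close>

lemma exp_decay_le:
  assumes "0 < l" "0 < t"
  shows "exp (- sqrt l * t) \<le> 2 / t\<^sup>2 / l"
proof -
  have z: "0 \<le> sqrt l * t" using assms by simp
  have "(sqrt l * t)\<^sup>2 / 2 \<le> exp (sqrt l * t)"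
    using exp_lower_Taylor_quadratic[OF z] z by linarith
  then have "l * t\<^sup>2 / 2 \<le> exp (sqrt l * t)" using assms by (simp add: power_mult_distrib)
  moreover have "0 < l * t\<^sup>2 / 2" using assms by simp
  ultimately have "inverse (exp (sqrt l * t)) \<le> inverse (l * t\<^sup>2 / 2)" by (rule le_imp_inverse_le)
  then show ?thesis by (simp add: exp_minus field_simps)
qed

text \<open>By the Green function bound the partial sums of the Poisson kernel are bounded uniformly in \<open>y\<close>, so the
series may be integrated against \<open>f\<close> term by term.\<close>

lemma poisson_integral_eq_sum:
  assumes t: "0 < t" and x: "x \<in> K" and f: "square_integrable mu f"
  shows "(\<lambda>n. exp (- sqrt (lam n) * t) * \<phi> n x * fourier f n) sums poisson_integral mu lam \<phi> t f x"
proof -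
  obtain G where G: "\<And>x N. x \<in> K \<Longrightarrow> (\<Sum>n<N. (\<phi> n x)\<^sup>2 / lam n) \<le> G" using green_bound by blast
  define k where "k = (\<lambda>n y. exp (- sqrt (lam n) * t) * \<phi> n x * \<phi> n y)"
  define C where "C = 2 / t\<^sup>2"
  have C: "0 < C" using t by (simp add: C_def)
  have k_le: "\<bar>k n y\<bar> \<le> C * (((\<phi> n x)\<^sup>2 / lam n + (\<phi> n y)\<^sup>2 / lam n) / 2)" for n y
  proof -
    have "\<bar>k n y\<bar> = exp (- sqrt (lam n) * t) * \<bar>\<phi> n x * \<phi> n y\<bar>" by (simp add: k_def abs_mult mult.assoc)
    also have "\<dots> \<le> (C / lam n) * (((\<phi> n x)\<^sup>2 + (\<phi> n y)\<^sup>2) / 2)"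
    proof (rule mult_mono)
      show "exp (- sqrt (lam n) * t) \<le> C / lam n" unfolding C_def by (rule exp_decay_le[OF lam_pos t])
      show "\<bar>\<phi> n x * \<phi> n y\<bar> \<le> ((\<phi> n x)\<^sup>2 + (\<phi> n y)\<^sup>2) / 2"
        using sum_squares_bound[of "\<bar>\<phi> n x\<bar>" "\<bar>\<phi> n y\<bar>"] by (simp add: abs_mult)
      show "0 \<le> C / lam n" using C lam_pos[of n] by simp
    qed simp
    also have "\<dots> = C * (((\<phi> n x)\<^sup>2 / lam n + (\<phi> n y)\<^sup>2 / lam n) / 2)"
      by (simp add: add_divide_distrib algebra_simps)
    finally show ?thesis .
  qed
  have abs_sum_le: "(\<Sum>n<N. \<bar>k n y\<bar>) \<le> C * G" if y: "y \<in> K" for N y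
  proof -
    have "(\<Sum>n<N. \<bar>k n y\<bar>) \<le> (\<Sum>n<N. C * (((\<phi> n x)\<^sup>2 / lam n + (\<phi> n y)\<^sup>2 / lam n) / 2))"
      by (intro sum_mono k_le)
    also have "\<dots> = C * (((\<Sum>n<N. (\<phi> n x)\<^sup>2 / lam n) + (\<Sum>n<N. (\<phi> n y)\<^sup>2 / lam n)) / 2)"
      by (simp only: sum_distrib_left[symmetric] sum_divide_distrib[symmetric] sum.distrib)
    also have "\<dots> \<le> C * ((G + G) / 2)"
      using C by (intro mult_left_mono divide_right_mono add_mono G x y) auto
    finally show ?thesis by simp
  qed
  have summable: "summable (\<lambda>n. k n y)" if y: "y \<in> K" for y
  proof (rule summable_rabs_cancel, rule bounded_imp_summable[where B = "C * G"])
    show "(\<Sum>n\<le>N. \<bar>k n y\<bar>) \<le> C * G" for N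
      using abs_sum_le[OF y, of "Suc N"] by (simp only: lessThan_Suc_atMost)
  qed simp
  have [measurable]: "f \<in> borel_measurable mu" "\<And>n. \<phi> n \<in> borel_measurable mu"
    using square_integrable_measurable f basis_square_integrable by blast+
  have k_meas[measurable]: "k n \<in> borel_measurable mu" for n unfolding k_def by measurable
  have "(\<lambda>N. LINT y|mu. (\<Sum>n<N. k n y) * f y) \<longlonglongrightarrow> (LINT y|mu. poisson_kernel lam \<phi> t x y * f y)"
  proof (rule integral_dominated_convergence[where w = "\<lambda>y. C * G * \<bar>f y\<bar>"])
    have ker: "(\<lambda>N. \<Sum>n<N. k n y) \<longlonglongrightarrow> poisson_kernel lam \<phi> t x y" if "y \<in> K" for y
      using summable_LIMSEQ[OF summable[OF that]] by (simp add: poisson_kernel_def k_def)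
    have "poisson_kernel lam \<phi> t x \<in> borel_measurable mu"
      by (rule borel_measurable_LIMSEQ_metric[where f = "\<lambda>N y. \<Sum>n<N. k n y"]) (use ker in auto)
    then show "(\<lambda>y. poisson_kernel lam \<phi> t x y * f y) \<in> borel_measurable mu" by measurable
    show "(\<lambda>y. (\<Sum>n<N. k n y) * f y) \<in> borel_measurable mu" for N by measurable
    have "integrable mu f"
      using f by (auto simp: square_integrable_def intro: square_integrable_imp_integrable[of f])
    then show "integrable mu (\<lambda>y. C * G * \<bar>f y\<bar>)" by simp
    show "AE y in mu. (\<lambda>N. (\<Sum>n<N. k n y) * f y) \<longlonglongrightarrow> poisson_kernel lam \<phi> t x y * f y"
      by (rule AE_I2) (auto intro!: tendsto_mult_right ker)
    show "AE y in mu. norm ((\<Sum>n<N. k n y) * f y) \<le> C * G * \<bar>f y\<bar>" for N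
    proof (rule AE_I2)
      fix y assume "y \<in> space mu"
      then have "\<bar>\<Sum>n<N. k n y\<bar> \<le> C * G"
        using order_trans[OF sum_abs abs_sum_le] by simp
      then show "norm ((\<Sum>n<N. k n y) * f y) \<le> C * G * \<bar>f y\<bar>" by (simp add: abs_mult mult_right_mono)
    qed
  qed
  moreover have "(LINT y|mu. (\<Sum>n<N. k n y) * f y)
      = (\<Sum>n<N. exp (- sqrt (lam n) * t) * \<phi> n x * fourier f n)" for N
  proof -
    have "(LINT y|mu. (\<Sum>n<N. k n y) * f y)
        = (LINT y|mu. f y * (\<Sum>n<N. (exp (- sqrt (lam n) * t) * \<phi> n x) * \<phi> n y))"
      unfolding k_def by (intro Bochner_Integration.integral_cong refl mult.commute)
    then show ?thesis by (simp only: integral_combination[OF f])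
  qed
  ultimately show ?thesis by (simp add: sums_def poisson_integral_def)
qed

theorem poisson_representation:
  "\<exists>f\<in>Linf mu. \<forall>t>0. \<forall>x\<in>K. u t x = poisson_integral mu lam \<phi> t f x"
proof -
  obtain f where f: "square_integrable mu f" "\<And>n. fourier f n = boundary_coeff n"
    using riesz_fischer[of boundary_coeff "B\<^sup>2"] boundary_coeff_square_sum_le by blast
  have meas: "f \<in> borel_measurable mu" by (rule square_integrable_measurable[OF f(1)])
  have "Linf_norm mu f \<le> ereal B"
    unfolding Linf_norm_def
  proof (rule esssup_I)
    show "(\<lambda>x. ereal \<bar>f x\<bar>) \<in> borel_measurable mu" using meas by measurable
    show "AE x in mu. ereal \<bar>f x\<bar> \<le> ereal B" using boundary_value_AE_bounded[OF f] by simp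
  qed
  then have "f \<in> Linf mu" using meas by (auto simp: Linf_def)
  moreover have "u t x = poisson_integral mu lam \<phi> t f x" if t: "0 < t" and x: "x \<in> K" for t x
  proof (rule sums_unique2)
    show "(\<lambda>n. exp (- sqrt (lam n) * t) * \<phi> n x * fourier f n) sums poisson_integral mu lam \<phi> t f x"
      by (rule poisson_integral_eq_sum[OF t x f(1)])
    have "(\<lambda>n. fourier (u t) n * \<phi> n x) = (\<lambda>n. exp (- sqrt (lam n) * t) * \<phi> n x * fourier f n)"
      unfolding f(2) mode_def[symmetric] mode_eq[OF t] by (simp only: mult_ac)
    then show "(\<lambda>n. exp (- sqrt (lam n) * t) * \<phi> n x * fourier f n) sums u t x"
      using eigenfunction_expansion[OF u_form_dom0[OF t] x] by (simp only:)
  qed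
  ultimately show ?thesis by blast
qed

end

theorem theorem4p5:
  fixes K :: "'a::metric_space set"
    and S :: "'i set"
    and F :: "'i \<Rightarrow> 'a \<Rightarrow> 'a"
    and \<pi> :: "(nat \<Rightarrow> 'i) \<Rightarrow> 'a"
    and r :: "'i \<Rightarrow> real"
    and D :: "'a \<Rightarrow> 'a \<Rightarrow> real"
    and lam :: "nat \<Rightarrow> real"
    and \<phi> :: "nat \<Rightarrow> 'a \<Rightarrow> real"
    and u :: "real \<Rightarrow> 'a \<Rightarrow> real"
  assumes "regular_harmonic_structure K S F \<pi> r D"
    and "harmonic_data.dirichlet_eigensystem K S F \<pi> r D lam \<phi>"
    and "harmonic_data.dirichlet_harmonic K S F \<pi> r D u"
    and "(SUP t\<in>{0<..}. Linf_norm (harmonic_data.mu K S \<pi> r) (u t)) < \<infinity>"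
  shows "\<exists>f \<in> Linf (harmonic_data.mu K S \<pi> r).
           \<forall>t>0. \<forall>x\<in>K. u t x = poisson_integral (harmonic_data.mu K S \<pi> r) lam \<phi> t f x"
proof -
  interpret dirichlet_spectrum K S F \<pi> r D lam \<phi>
    using assms(1,2) by (simp add: dirichlet_spectrum_def dirichlet_spectrum_axioms_def)
  obtain B where B: "(SUP t\<in>{0<..}. Linf_norm mu (u t)) \<le> ereal B"
    using assms(4) by (cases "SUP t\<in>{0<..}. Linf_norm mu (u t)") auto
  \<comment> \<open>By continuity and full support the essential bound holds at every point.\<close>
  have "\<bar>u t x\<bar> \<le> B" if t: "0 < t" and x: "x \<in> K" for t x
  proof (rule AE_le_imp_le[OF _ _ x])
    have "u t \<in> form_dom"
      using assms(3) t by (auto simp: dirichlet_harmonic_def harmonic_def has_laplacian_def)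
    then show "continuous_on K (\<lambda>x. \<bar>u t x\<bar>)"
      by (intro continuous_on_rabs form_dom_continuous)
    have "Linf_norm mu (u t) \<le> ereal B"
      using B t by (auto simp: SUP_le_iff)
    then show "AE x in mu. \<bar>u t x\<bar> \<le> B"
      using esssup_AE[of "\<lambda>x. ereal \<bar>u t x\<bar>" mu]
      unfolding Linf_norm_def by (auto elim!: eventually_mono dest: order_trans)
  qed
  then interpret bounded_dirichlet_harmonic K S F \<pi> r D lam \<phi> u B
    using assms(3) by unfold_locales
  show ?thesis by (rule poisson_representation)
qed

end
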